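(* Suppose that Assumptions A1 and A2 (stated in the context) are satisfied with $q\in(1,\infty)$, $\Omega=\mathbb{R}^m$ and $E(\|X\|_2^2)<\infty$, and let $\delta_n=\eta/n$ with $\eta\in(0,\infty)$. Then, as $n\to\infty$, $$n^{1/2}\{\Lambda^+_{\delta_n}(P_n)-\beta_n^{ERM}\}\Rightarrow\Lambda_\eta.$$ Moreover, if $\eta(n)=\eta+o(1)$ and $C_n\to C$, then $$\Lambda^n_{\eta(n)}=\{u:\varphi_n^*(C_nu)\le\eta(n)\}\to\Lambda_\eta.$$
   Context: Setting. $\Omega\subseteq\mathbb{R}^m$ is closed, $B\subseteq\mathbb{R}^d$ is closed and convex. $X,X_1,X_2,\dots$ are i.i.d. with law $P_*$ on $\Omega$; $P_n=n^{-1}\sum_{i=1}^n\delta_{X_i}$ is the empirical measure. $E_P$ is expectation when $X\sim P$, and $E=E_{P_*}$. $\mathcal{P}(\Omega)$ is the set of probability distributions on $\Omega$. For $q\in[1,\infty]$, $p$ is the dual exponent, $1/p+1/q=1$. $D_c(P,Q)=\min_{\pi\in\Pi(P,Q)}E_\pi\{c(X,Y)\}$, where $\Pi(P,Q)$ is the set of couplings of $P,Q$, and $W(P,Q)=D_c(P,Q)^{1/2}$. For $\delta\ge 0$, $\mathcal{U}_\delta(P_n)=\{P\in\mathcal{P}(\Omega):W(P_n,P)\le\delta^{1/2}\}$. Assumption A1. $c(u,w)=\|u-w\|_q^2$ on $\Omega\times\Omega$. Assumption A2. The loss $\ell:\Omega\times B\to\mathbb{R}$ satisfies: (a) $\ell$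 is twice continuously differentiable and $\ell(x,\cdot)$ is convex for each $x$. (b) With $h(x,\beta)=D_\beta\ell(x,\beta)$, there is $\beta_*\in B^\circ$ (interior) with $E\{h(X,\beta_* )\}=0$; moreover $E\{\|h(X,\beta_* )\|_2^2\}<\infty$, the symmetric matrix $C=E\{D_\beta h(X,\beta_* )\}\succ0$ (positive definite), $E\{D_xh(X,\beta_* )D_xh(X,\beta_* )^T\}\succ0$, and $\mathrm{pr}\{\|D_x\ell(X,\beta_* )\|_p>0\}>0$. (c) For every $\beta$, $\|D_{xx}\ell(\cdot;\beta)\|_p$ is uniformly continuous and bounded by $M(\beta)$ for a continuous function $M$; there is a finite $M'>0$ with $\|D_xh(x,\beta)\|_q\le M'(1+\|x\|_q)$ for $\beta$ in a neighborhood of $\beta_*$; and for $\|\Delta\|_q+\|u\|_q\le1$, $\|D_xh(x+\Delta,\beta_*+u)-D_xh(x,\beta_* )\|_q\le\kappa'(x)(\|\Delta\|_q+\|u\|_q)$ and $\|D_\beta h(x+\Delta,\beta_*+u)-D_\beta h(x,\beta_* )\|_q\le\bar\kappa(x)(\|\Delta\|_q+\|u\|_q)$, with $\kappa',\bar\kappa:\mathbb{R}^m\to[0,\infty)$, $E\{\kappa'(X)^2\}<\infty$, $E\{\bar\kappa(X)^2\}<\infty$. $\beta_n^{ERM}\in\arg\min_{\beta\in B}E_{P_n}\{\ell(X;\beta)\}$. $\Lambda_\delta(P_n)=\{\beta\in B:\beta\in\arg\min_{b\in B}E_P\{\ell(X;b)\}\text{ for some }P\in\mathcal{U}_\delta(P_n)\}$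 and $\Lambda^+_\delta(P_n)=\mathrm{cl}\{\cap_{\epsilon>0}\Lambda_{\delta+\epsilon}(P_n)\}$. $\varphi(\xi)=4^{-1}E[\|\{D_xh(X,\beta_* )\}^T\xi\|_p^2]$, $\varphi^*(\zeta)=\sup_{\xi\in\mathbb{R}^d}\{\xi^T\zeta-\varphi(\xi)\}$, $\Lambda_\eta=\{u:\varphi^*(Cu)\le\eta\}$; $\varphi_n(\xi)=\frac{1}{4n}\sum_{i=1}^n\|\{D_xh(X_i,\beta_* )\}^T\xi\|_p^2$ and $\varphi_n^*(\zeta)=\sup_{\xi\in\mathbb{R}^d}\{\xi^T\zeta-\varphi_n(\xi)\}$. Convergence. $\Rightarrow$ is weak convergence and $\to$ (for random objects) is convergence in probability. The space of closed subsets of $\mathbb{R}^d$ carries the topology of Painlevé–Kuratowski convergence (the Fell topology, metrizable) with its Borel $\sigma$-algebra: $A_n\to A$ iff $A$ equals both the inner limit (limits of convergent sequences $a_n\in A_n$) and the outer limit (limits of convergent sequences $a_k\in A_{n_k}$ along subsequences). *)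

theory Defs
  imports "HOL-Probability.Probability"
begin

section \<open>Norms and derivatives\<close>

definition lp_norm :: "real \<Rightarrow> real ^ 'k \<Rightarrow> real" where
  "lp_norm p x = (\<Sum>i\<in>UNIV. \<bar>x $ i\<bar> powr p) powr (1 / p)"

text \<open>Operator norm induced by the vector norm.\<close>

definition mat_lp_norm :: "real \<Rightarrow> real ^ 'k ^ 'r \<Rightarrow> real" where
  "mat_lp_norm p A = (SUP x\<in>{x. lp_norm p x \<le> 1}. lp_norm p (A *v x))"

definition pos_def :: "real ^ 'k ^ 'k \<Rightarrow> bool" where
  "pos_def A \<longleftrightarrow> transpose A = A \<and> (\<forall>v. v \<noteq> 0 \<longrightarrow> v \<bullet> (A *v v) > 0)"

text \<open>
  Derivatives on a set \<open>S\<close> that need not be open are taken relative to \<open>S\<close>. They are unique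
  if \<open>S\<close> is convex with nonempty interior, the only case used below.
\<close>

definition gradient :: "(real ^ 'k \<Rightarrow> real) \<Rightarrow> (real ^ 'k) filter \<Rightarrow> real ^ 'k" where
  "gradient f F = (\<chi> i. frechet_derivative f F (axis i 1))"

definition C2_on :: "'a::real_normed_vector set \<Rightarrow> ('a \<Rightarrow> 'b::real_normed_vector) \<Rightarrow> bool" where
  "C2_on S f \<longleftrightarrow>
    (\<exists>(f' :: 'a \<Rightarrow> 'a \<Rightarrow>\<^sub>L 'b) (f'' :: 'a \<Rightarrow> 'a \<Rightarrow>\<^sub>L 'a \<Rightarrow>\<^sub>L 'b).
      (\<forall>z\<in>S. (f has_derivative blinfun_apply (f' z)) (at z within S)) \<and>
      (\<forall>z\<in>S. (f' has_derivative blinfun_apply (f'' z)) (at z within S)) \<and>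
      continuous_on S f'')"

text \<open>
  The loss at the observation \<open>x\<close> and the parameter \<open>\<beta>\<close> is \<open>l x \<beta>\<close>. Its gradient in \<open>\<beta>\<close>,
  usually written \<open>h\<close>, is \<open>dbeta l B\<close>; \<open>dx_h\<close> and \<open>dbeta_h\<close> are the partial derivatives of \<open>h\<close>.
\<close>

definition dbeta :: "(real ^ 'm \<Rightarrow> real ^ 'd \<Rightarrow> real) \<Rightarrow> (real ^ 'd) set \<Rightarrow>
    real ^ 'm \<Rightarrow> real ^ 'd \<Rightarrow> real ^ 'd" where
  "dbeta l B x \<beta> = gradient (l x) (at \<beta> within B)"

definition dx :: "(real ^ 'm \<Rightarrow> real ^ 'd \<Rightarrow> real) \<Rightarrow>
    real ^ 'm \<Rightarrow> real ^ 'd \<Rightarrow> real ^ 'm" where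
  "dx l x \<beta> = gradient (\<lambda>y. l y \<beta>) (at x)"

definition dxx :: "(real ^ 'm \<Rightarrow> real ^ 'd \<Rightarrow> real) \<Rightarrow>
    real ^ 'm \<Rightarrow> real ^ 'd \<Rightarrow> real ^ 'm ^ 'm" where
  "dxx l x \<beta> = jacobian (\<lambda>y. dx l y \<beta>) (at x)"

definition dx_h :: "(real ^ 'm \<Rightarrow> real ^ 'd \<Rightarrow> real) \<Rightarrow> (real ^ 'd) set \<Rightarrow>
    real ^ 'm \<Rightarrow> real ^ 'd \<Rightarrow> real ^ 'm ^ 'd" where
  "dx_h l B x \<beta> = jacobian (\<lambda>y. dbeta l B y \<beta>) (at x)"

definition dbeta_h :: "(real ^ 'm \<Rightarrow> real ^ 'd \<Rightarrow> real) \<Rightarrow> (real ^ 'd) set \<Rightarrow>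
    real ^ 'm \<Rightarrow> real ^ 'd \<Rightarrow> real ^ 'd ^ 'd" where
  "dbeta_h l B x \<beta> = jacobian (dbeta l B x) (at \<beta> within B)"

definition mean_hessian :: "(real ^ 'm \<Rightarrow> real ^ 'd \<Rightarrow> real) \<Rightarrow> (real ^ 'd) set \<Rightarrow>
    (real ^ 'm) measure \<Rightarrow> real ^ 'd \<Rightarrow> real ^ 'd ^ 'd" where
  "mean_hessian l B P \<beta> = (\<integral>x. dbeta_h l B x \<beta> \<partial>P)"


section \<open>Assumptions on the loss\<close>

text \<open>The observation space is the whole of \<open>real ^ 'm\<close>.\<close>

definition loss_smooth_convex ::
  "(real ^ 'd) set \<Rightarrow> (real ^ 'm \<Rightarrow> real ^ 'd \<Rightarrow> real) \<Rightarrow> bool" where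
  "loss_smooth_convex B l \<longleftrightarrow>
    C2_on (UNIV \<times> B) (\<lambda>(x, \<beta>). l x \<beta>) \<and> (\<forall>x. convex_on B (l x))"

definition loss_optimality ::
  "real \<Rightarrow> (real ^ 'm) measure \<Rightarrow> (real ^ 'd) set \<Rightarrow> (real ^ 'm \<Rightarrow> real ^ 'd \<Rightarrow> real) \<Rightarrow>
    real ^ 'd \<Rightarrow> bool" where
  "loss_optimality p P B l \<beta>s \<longleftrightarrow>
    \<beta>s \<in> interior B \<and>
    integrable P (\<lambda>x. (norm (dbeta l B x \<beta>s))\<^sup>2) \<and>
    (\<integral>x. dbeta l B x \<beta>s \<partial>P) = 0 \<and>
    integrable P (\<lambda>x. dbeta_h l B x \<beta>s) \<and>
    pos_def (mean_hessian l B P \<beta>s) \<and>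
    integrable P (\<lambda>x. dx_h l B x \<beta>s ** transpose (dx_h l B x \<beta>s)) \<and>
    pos_def (\<integral>x. dx_h l B x \<beta>s ** transpose (dx_h l B x \<beta>s) \<partial>P) \<and>
    measure P {x. lp_norm p (dx l x \<beta>s) > 0} > 0"

definition loss_derivative_bounds ::
  "real \<Rightarrow> real \<Rightarrow> (real ^ 'm) measure \<Rightarrow> (real ^ 'd) set \<Rightarrow>
    (real ^ 'm \<Rightarrow> real ^ 'd \<Rightarrow> real) \<Rightarrow> real ^ 'd \<Rightarrow> bool" where
  "loss_derivative_bounds p q P B l \<beta>s \<longleftrightarrow>
    (\<exists>M. continuous_on B M \<and>
      (\<forall>\<beta>\<in>B. uniformly_continuous_on UNIV (\<lambda>x. mat_lp_norm p (dxx l x \<beta>)) \<and>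
              (\<forall>x. mat_lp_norm p (dxx l x \<beta>) \<le> M \<beta>))) \<and>
    (\<exists>M'>0. \<forall>\<^sub>F \<beta> in nhds \<beta>s. \<forall>x. mat_lp_norm q (dx_h l B x \<beta>) \<le> M' * (1 + lp_norm q x)) \<and>
    (\<exists>\<kappa>. (\<forall>x. \<kappa> x \<ge> 0) \<and> \<kappa> \<in> borel_measurable borel \<and> integrable P (\<lambda>x. (\<kappa> x)\<^sup>2) \<and>
      (\<forall>x \<Delta> u. lp_norm q \<Delta> + lp_norm q u \<le> 1 \<and> \<beta>s + u \<in> B \<longrightarrow>
        mat_lp_norm q (dx_h l B (x + \<Delta>) (\<beta>s + u) - dx_h l B x \<beta>s)
          \<le> \<kappa> x * (lp_norm q \<Delta> + lp_norm q u))) \<and>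
    (\<exists>\<kappa>. (\<forall>x. \<kappa> x \<ge> 0) \<and> \<kappa> \<in> borel_measurable borel \<and> integrable P (\<lambda>x. (\<kappa> x)\<^sup>2) \<and>
      (\<forall>x \<Delta> u. lp_norm q \<Delta> + lp_norm q u \<le> 1 \<and> \<beta>s + u \<in> B \<longrightarrow>
        mat_lp_norm q (dbeta_h l B (x + \<Delta>) (\<beta>s + u) - dbeta_h l B x \<beta>s)
          \<le> \<kappa> x * (lp_norm q \<Delta> + lp_norm q u)))"


section \<open>Optimal transport and distributionally robust estimation\<close>

definition couplings :: "'a::topological_space measure \<Rightarrow> 'a measure \<Rightarrow> ('a \<times> 'a) measure set" where
  "couplings P Q =
    {\<pi>. prob_space \<pi> \<and> sets \<pi> = sets (borel \<Otimes>\<^sub>M borel) \<and>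
         distr \<pi> borel fst = P \<and> distr \<pi> borel snd = Q}"

definition transport_cost ::
  "('a::topological_space \<Rightarrow> 'a \<Rightarrow> real) \<Rightarrow> 'a measure \<Rightarrow> 'a measure \<Rightarrow> ennreal" where
  "transport_cost c P Q = (INF \<pi>\<in>couplings P Q. \<integral>\<^sup>+ (x, y). ennreal (c x y) \<partial>\<pi>)"

definition wasserstein ::
  "('a::topological_space \<Rightarrow> 'a \<Rightarrow> real) \<Rightarrow> 'a measure \<Rightarrow> 'a measure \<Rightarrow> ennreal" where
  "wasserstein c P Q =
    (if transport_cost c P Q = \<top> then \<top> else ennreal (sqrt (enn2real (transport_cost c P Q))))"

definition ambiguity_set ::
  "('a::topological_space \<Rightarrow> 'a \<Rightarrow> real) \<Rightarrow> real \<Rightarrow> 'a measure \<Rightarrow> 'a measure set" where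
  "ambiguity_set c \<delta> P =
    {Q. prob_space Q \<and> sets Q = sets borel \<and> wasserstein c P Q \<le> ennreal (sqrt \<delta>)}"

text \<open>The data are \<open>x 0, \<dots>, x (n - 1)\<close>; only \<open>n \<ge> 1\<close> is meaningful.\<close>

definition empirical_measure :: "nat \<Rightarrow> (nat \<Rightarrow> 'a::topological_space) \<Rightarrow> 'a measure" where
  "empirical_measure n x = distr (uniform_count_measure {..<n}) borel x"

definition risk_minimizers ::
  "('a \<Rightarrow> 'b \<Rightarrow> real) \<Rightarrow> 'b set \<Rightarrow> 'a measure \<Rightarrow> 'b set" where
  "risk_minimizers l B P = {\<beta>. is_arg_min (\<lambda>b. \<integral>x. l x b \<partial>P) (\<lambda>b. b \<in> B) \<beta>}"

definition compatible_set ::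
  "('a::topological_space \<Rightarrow> 'a \<Rightarrow> real) \<Rightarrow> ('a \<Rightarrow> 'b \<Rightarrow> real) \<Rightarrow> 'b set \<Rightarrow> real \<Rightarrow>
    'a measure \<Rightarrow> 'b set" where
  "compatible_set c l B \<delta> P = (\<Union>Q\<in>ambiguity_set c \<delta> P. risk_minimizers l B Q)"

definition compatible_set_plus ::
  "('a::topological_space \<Rightarrow> 'a \<Rightarrow> real) \<Rightarrow> ('a \<Rightarrow> 'b::topological_space \<Rightarrow> real) \<Rightarrow> 'b set \<Rightarrow>
    real \<Rightarrow> 'a measure \<Rightarrow> 'b set" where
  "compatible_set_plus c l B \<delta> P = closure (\<Inter>\<epsilon>\<in>{0<..}. compatible_set c l B (\<delta> + \<epsilon>) P)"

definition limit_form :: "real \<Rightarrow> (real ^ 'm \<Rightarrow> real ^ 'd \<Rightarrow> real) \<Rightarrow> (real ^ 'd) set \<Rightarrow>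
    (real ^ 'm) measure \<Rightarrow> real ^ 'd \<Rightarrow> real ^ 'd \<Rightarrow> real" where
  "limit_form p l B P \<beta>s \<xi> =
    1 / 4 * (\<integral>x. (lp_norm p (transpose (dx_h l B x \<beta>s) *v \<xi>))\<^sup>2 \<partial>P)"

definition empirical_form :: "real \<Rightarrow> (real ^ 'm \<Rightarrow> real ^ 'd \<Rightarrow> real) \<Rightarrow> (real ^ 'd) set \<Rightarrow>
    nat \<Rightarrow> (nat \<Rightarrow> real ^ 'm) \<Rightarrow> real ^ 'd \<Rightarrow> real ^ 'd \<Rightarrow> real" where
  "empirical_form p l B n x \<beta>s \<xi> =
    1 / (4 * real n) * (\<Sum>i<n. (lp_norm p (transpose (dx_h l B (x i) \<beta>s) *v \<xi>))\<^sup>2)"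

definition convex_conjugate :: "('a::real_inner \<Rightarrow> real) \<Rightarrow> 'a \<Rightarrow> ereal" where
  "convex_conjugate f \<zeta> = (SUP \<xi>. ereal (\<xi> \<bullet> \<zeta> - f \<xi>))"

definition conjugate_sublevel :: "(real ^ 'd \<Rightarrow> real) \<Rightarrow> real ^ 'd ^ 'd \<Rightarrow> real \<Rightarrow> (real ^ 'd) set" where
  "conjugate_sublevel f C \<eta> = {u. convex_conjugate f (C *v u) \<le> ereal \<eta>}"


section \<open>The space of closed sets and modes of convergence\<close>

definition fell_topology :: "'a::topological_space set topology" where
  "fell_topology = topology_generated_by
    ({{F. closed F \<and> F \<inter> K = {}} | K. compact K} \<union>
     {{F. closed F \<and> F \<inter> G \<noteq> {}} | G. open G})"

lemma topspace_fell_topology: "topspace fell_topology = {F. closed F}"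
proof -
  have "{F. closed F} = {F :: 'a set. closed F \<and> F \<inter> {} = {}}"
    by simp
  then have "{F :: 'a set. closed F} \<in> {{F. closed F \<and> F \<inter> K = {}} | K. compact K}"
    using compact_empty by blast
  then show ?thesis
    unfolding fell_topology_def topology_generated_by_topspace by auto
qed

definition borel_sets_of :: "'a topology \<Rightarrow> 'a measure" where
  "borel_sets_of T = sigma (topspace T) {U. openin T U}"

text \<open>
  Random closed sets such as those below need not be measurable with respect to the given
  \<sigma>-algebra on the sample space. Convergence is therefore understood with outer expectations and
  outer probabilities (Hoffmann-Jorgensen). For measurable maps these are the ordinary
  expectations and probabilities, and the notions below are the usual ones.
\<close>

definition outer_expectation :: "'w measure \<Rightarrow> ('w \<Rightarrow> real) \<Rightarrow> real" where
  "outer_expectation M Y =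
    Inf {integral\<^sup>L M U | U. integrable M U \<and> (\<forall>\<omega>\<in>space M. Y \<omega> \<le> U \<omega>)}"

definition converges_weakly ::
  "'a topology \<Rightarrow> 'w measure \<Rightarrow> (nat \<Rightarrow> 'w \<Rightarrow> 'a) \<Rightarrow> 'a measure \<Rightarrow> bool" where
  "converges_weakly T M A \<nu> \<longleftrightarrow>
    prob_space \<nu> \<and> sets \<nu> = sets (borel_sets_of T) \<and>
    (\<forall>n. \<forall>\<omega>\<in>space M. A n \<omega> \<in> topspace T) \<and>
    (\<forall>f. continuous_map T euclideanreal f \<and> bounded (f ` topspace T) \<longrightarrow>
      (\<lambda>n. outer_expectation M (\<lambda>\<omega>. f (A n \<omega>))) \<longlonglongrightarrow> integral\<^sup>L \<nu> f)"

text \<open>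
  Convergence in probability to a constant. If \<open>T\<close> is metrizable, this says that the distance to
  \<open>a\<close> tends to \<open>0\<close> in probability, for any metric that induces \<open>T\<close>.
\<close>

definition converges_in_prob ::
  "'a topology \<Rightarrow> 'w measure \<Rightarrow> (nat \<Rightarrow> 'w \<Rightarrow> 'a) \<Rightarrow> 'a \<Rightarrow> bool" where
  "converges_in_prob T M A a \<longleftrightarrow>
    a \<in> topspace T \<and> (\<forall>n. \<forall>\<omega>\<in>space M. A n \<omega> \<in> topspace T) \<and>
    (\<forall>U. openin T U \<and> a \<in> U \<longrightarrow>
      (\<lambda>n. outer_measure_of M {\<omega>\<in>space M. A n \<omega> \<notin> U}) \<longlonglongrightarrow> 0)"

end

theory Submission
  imports Defs
begin

text \<open>
  By first-order optimality, a parameter in the interior of \<open>B\<close> is compatible with a distribution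
  \<open>Q\<close> iff the score has mean zero under \<open>Q\<close>. Along a coupling \<open>\<pi>\<close> of \<open>P\<^sub>n\<close> and \<open>Q\<close> whose
  transport cost is \<open>O(1/n)\<close>, the score expands linearly, uniformly over all such couplings:
  \[ n^{1/2} E_Q\{h(Y, \beta_* + n^{-1/2} u)\}
     = C u + H_n + n^{1/2} E_\pi\{D_x h(X, \beta_*) (Y - X)\} + o(1), \quad
     H_n = n^{1/2} E_{P_n}\{h(X, \beta_*)\}. \]
  The case \<open>Q = P\<^sub>n\<close> locates the empirical minimizer at \<open>- C\<^sup>-\<^sup>1 H\<^sub>n\<close>, so the rescaled deviation of a
  compatible parameter from it is, up to \<open>o(1)\<close>, a \<open>u\<close> with
  $C u = - n^{1/2} E_\pi\{D_x h(X, \beta_*) (Y - X)\}$, and Young's inequality bounds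
  $\xi^T C u - \varphi(\xi)$ by \<open>\<eta>\<close> for every \<open>\<xi>\<close>.
  Conversely, if \<open>u\<close> lies in the limit set, then separating a point from a convex set gives a fixed
  square-integrable \<open>v\<close> with $E\{\|v(X)\|_q^2\} < \eta$ and $E\{D_x h(X, \beta_*) v(X)\}$ close to
  $- C u$, and moving each \<open>X\<^sub>i\<close> by $n^{-1/2} v(X_i)$ produces a compatible parameter near \<open>u\<close>. Such a
  \<open>v\<close> is also the dual witness by which the empirical sublevel sets meet every neighbourhood of \<open>u\<close>.
  Only weak laws of large numbers and the tightness of \<open>H\<^sub>n\<close> are needed, no central limit theorem.
\<close>

subsection \<open>Norms on coordinate space\<close>

text \<open>The obstacle is that a plan of cost O(1/n) may carry a small mass far, where the
  derivative of the score is controlled by linear growth only. The remainder is then linear in the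
  displacement and could survive multiplication by \<open>sqrt n\<close>. It is cut at a level N of
  a random modulus \<kappa>: below N, a long displacement is absorbed into its square; above N,
  Young's inequality pairs the displacement with the tail of the square of \<kappa>, whose
  expectation is small. The bound involves only sample means and the cost, so one event serves all
  plans.

  The score H_n enters the equation of a compatible parameter and that of the empirical minimizer in
  the same way and cancels in their difference; its tightness keeps both in a fixed ball, where the
  expansion holds. The limit set is therefore deterministic, and both modes of convergence reduce to
  hitting open sets and missing compact sets with probability tending to 1. Missing needs finitely
  many \<xi>, by compactness. Hitting needs a witness of energy strictly below \<eta>, so that
  sampling fluctuations do not push it out of the transport ball.\<close>

lemma lp_norm_nonneg [simp]: "0 \<le> lp_norm p x"
  by (simp add: lp_norm_def)

lemma lp_norm_powr:
  assumes "p > 0"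
  shows "lp_norm p x powr p = (\<Sum>i\<in>UNIV. \<bar>x $ i\<bar> powr p)"
  using assms by (simp add: lp_norm_def powr_powr sum_nonneg)

lemma component_le_lp_norm:
  assumes "p > 0"
  shows "\<bar>x $ i\<bar> \<le> lp_norm p x"
proof -
  have "\<bar>x $ i\<bar> = (\<bar>x $ i\<bar> powr p) powr (1 / p)"
    using assms by (simp add: powr_powr)
  also have "\<dots> \<le> lp_norm p x"
    unfolding lp_norm_def using assms
    by (intro powr_mono2) (auto intro!: member_le_sum)
  finally show ?thesis .
qed

lemma lp_norm_eq_0:
  assumes "p > 0"
  shows "lp_norm p x = 0 \<longleftrightarrow> x = 0"
proof
  assume "lp_norm p x = 0"
  then have "\<bar>x $ i\<bar> \<le> 0" for i
    using component_le_lp_norm[OF assms, of x i] by simp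
  then show "x = 0" by (simp add: vec_eq_iff)
qed (simp add: lp_norm_def)

lemma lp_norm_zero [simp]: "lp_norm p 0 = 0"
  by (simp add: lp_norm_def)

lemma lp_norm_scaleR:
  assumes "p > 0"
  shows "lp_norm p (r *\<^sub>R x) = \<bar>r\<bar> * lp_norm p x"
proof -
  have "(\<Sum>i\<in>UNIV. \<bar>(r *\<^sub>R x) $ i\<bar> powr p) = \<bar>r\<bar> powr p * (\<Sum>i\<in>UNIV. \<bar>x $ i\<bar> powr p)"
    by (simp add: abs_mult powr_mult sum_distrib_left)
  then show ?thesis
    using assms by (simp add: lp_norm_def powr_mult sum_nonneg powr_powr)
qed

lemma lp_norm_minus [simp]: "lp_norm p (- x) = lp_norm p x"
  by (simp add: lp_norm_def)

lemma lp_norm_minus_commute: "lp_norm p (x - y) = lp_norm p (y - x)"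
  using lp_norm_minus[of p "x - y"] by simp

lemma norm_le_lp_norm:
  fixes x :: "real ^ 'k"
  assumes "p > 0"
  shows "norm x \<le> CARD('k) * lp_norm p x"
proof -
  have "norm x \<le> (\<Sum>i\<in>UNIV. \<bar>x $ i\<bar>)"
    by (rule norm_le_l1_cart)
  also have "\<dots> \<le> (\<Sum>i\<in>(UNIV :: 'k set). lp_norm p x)"
    by (intro sum_mono component_le_lp_norm assms)
  finally show ?thesis by simp
qed

lemma lp_norm_le_norm:
  fixes x :: "real ^ 'k"
  assumes "p \<ge> 1"
  shows "lp_norm p x \<le> CARD('k) * norm x"
proof -
  have "lp_norm p x \<le> (\<Sum>i\<in>(UNIV :: 'k set). norm x powr p) powr (1 / p)"
    unfolding lp_norm_def using assms
    by (intro powr_mono2 sum_mono) (auto intro!: sum_nonneg simp: component_le_norm_cart)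
  also have "\<dots> = CARD('k) powr (1 / p) * norm x"
    using assms by (simp add: powr_mult powr_powr)
  also have "\<dots> \<le> CARD('k) powr 1 * norm x"
    using assms by (intro mult_right_mono powr_mono) auto
  finally show ?thesis by simp
qed

text \<open>The identity puts \<open>1 / p\<close> strictly between 0 and 1; this also excludes
  \<open>p = 0\<close>, where division returns 0.\<close>

lemma conjugate_exponent_gt_1:
  fixes p q :: real
  assumes "1 < q" "1 / p + 1 / q = 1"
  shows "1 < p"
proof -
  have "1 / q < 1" "0 < 1 / q" using assms by auto
  then have "0 < 1 / p" "1 / p < 1" using assms by linarith+
  then show ?thesis by (simp add: divide_less_eq_1)
qed

text \<open>Both vectors are normalized and Young's inequality is summed over the coordinates; each
  power sum is then 1, which leaves \<open>1 / p + 1 / q\<close>.\<close>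

lemma lp_norm_Holder:
  fixes a v :: "real ^ 'k"
  assumes q: "1 < q" and pq: "1 / p + 1 / q = 1"
  shows "a \<bullet> v \<le> lp_norm p a * lp_norm q v"
proof -
  have p: "1 < p"
    by (rule conjugate_exponent_gt_1[OF assms])
  show ?thesis
  proof (cases "a = 0 \<or> v = 0")
    case True
    then show ?thesis by auto
  next
    case False
    define \<alpha> \<nu> where "\<alpha> = lp_norm p a" and "\<nu> = lp_norm q v"
    have pos: "\<alpha> > 0" "\<nu> > 0"
      using False lp_norm_eq_0[of p a] lp_norm_eq_0[of q v] p q
      by (auto simp: \<alpha>_def \<nu>_def order_less_le)
    have "a \<bullet> v / (\<alpha> * \<nu>) = (\<Sum>i\<in>UNIV. (a $ i / \<alpha>) * (v $ i / \<nu>))"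
      unfolding inner_vec_def sum_divide_distrib by (rule sum.cong) auto
    also have "\<dots> \<le> (\<Sum>i\<in>UNIV. (\<bar>a $ i\<bar> / \<alpha>) powr p / p + (\<bar>v $ i\<bar> / \<nu>) powr q / q)"
    proof (intro sum_mono)
      fix i
      have "(a $ i / \<alpha>) * (v $ i / \<nu>) \<le> (\<bar>a $ i\<bar> / \<alpha>) * (\<bar>v $ i\<bar> / \<nu>)"
        using pos abs_ge_self[of "(a $ i / \<alpha>) * (v $ i / \<nu>)"] by (simp add: abs_mult)
      also have "\<dots> \<le> (\<bar>a $ i\<bar> / \<alpha>) powr p / p + (\<bar>v $ i\<bar> / \<nu>) powr q / q"
        using pos by (intro Youngs_inequality p q pq) auto
      finally show "(a $ i / \<alpha>) * (v $ i / \<nu>) \<le> (\<bar>a $ i\<bar> / \<alpha>) powr p / p + (\<bar>v $ i\<bar> / \<nu>) powr q / q" .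
    qed
    also have "\<dots> = (\<alpha> powr p) / (\<alpha> powr p) / p + (\<nu> powr q) / (\<nu> powr q) / q"
      using pos p q
      by (simp add: \<alpha>_def \<nu>_def lp_norm_powr powr_divide sum.distrib flip: sum_divide_distrib)
    also have "\<dots> = 1"
      using pos pq by simp
    finally show ?thesis
      using pos by (simp add: \<alpha>_def \<nu>_def divide_le_eq)
  qed
qed

text \<open>The duality map, that is, the gradient of half the squared p-norm for
  \<open>p > 1\<close>. The leading factor makes it homogeneous of degree 1, so that it attains
  equality in Hoelder's inequality and preserves the norm when passing to the conjugate
  exponent.\<close>

definition lp_dual :: "real \<Rightarrow> real ^ 'k \<Rightarrow> real ^ 'k" where
  "lp_dual p a = (\<chi> i. lp_norm p a powr (2 - p) * (sgn (a $ i) * \<bar>a $ i\<bar> powr (p - 1)))"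

lemma inner_lp_dual:
  assumes "1 < p"
  shows "a \<bullet> lp_dual p a = (lp_norm p a)\<^sup>2"
proof -
  have "a $ i * lp_dual p a $ i = lp_norm p a powr (2 - p) * \<bar>a $ i\<bar> powr p" for i
  proof -
    have "a $ i * sgn (a $ i) = \<bar>a $ i\<bar>"
      by (simp add: abs_sgn)
    moreover have "\<bar>a $ i\<bar> * \<bar>a $ i\<bar> powr (p - 1) = \<bar>a $ i\<bar> powr p"
      using powr_mult_base[of "\<bar>a $ i\<bar>" "p - 1"] by simp
    moreover have "a $ i * lp_dual p a $ i
        = lp_norm p a powr (2 - p) * ((a $ i * sgn (a $ i)) * \<bar>a $ i\<bar> powr (p - 1))"
      by (simp add: lp_dual_def)
    ultimately show ?thesis
      by simp
  qed
  then have "a \<bullet> lp_dual p a = lp_norm p a powr (2 - p) * (\<Sum>i\<in>UNIV. \<bar>a $ i\<bar> powr p)"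
    by (simp add: inner_vec_def sum_distrib_left)
  also have "\<dots> = lp_norm p a powr 2"
    using assms by (simp add: lp_norm_powr[symmetric] powr_add[symmetric])
  finally show ?thesis by simp
qed

lemma lp_norm_lp_dual:
  assumes q: "1 < q" and pq: "1 / p + 1 / q = 1" and p: "1 < p"
  shows "lp_norm q (lp_dual p a) = lp_norm p a"
proof (cases "a = 0")
  case True
  then show ?thesis by (simp add: lp_dual_def lp_norm_def)
next
  case False
  then have pos: "lp_norm p a > 0"
    using lp_norm_eq_0[of p a] p by (auto simp: order_less_le)
  \<comment> \<open>This form of conjugacy turns the coordinate powers into p-th powers and makes
    the total exponent of the norm equal to 1.\<close>
  have pq': "(p - 1) * q = p"
    using pq p q by (simp add: field_simps)
  define N where "N = lp_norm p a"
  have "\<bar>lp_dual p a $ i\<bar> powr q = N powr ((2 - p) * q) * \<bar>a $ i\<bar> powr p" for i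
    by (cases "a $ i = 0") (simp_all add: lp_dual_def N_def abs_mult powr_mult powr_powr pq' abs_sgn_eq)
  then have "lp_norm q (lp_dual p a) = (N powr ((2 - p) * q) * N powr p) powr (1 / q)"
    using p by (simp add: lp_norm_def[of q] N_def lp_norm_powr sum_distrib_left)
  also have "\<dots> = N powr (((2 - p) * q + p) / q)"
    by (simp add: powr_powr flip: powr_add)
  also have "((2 - p) * q + p) / q = 1"
    using q pq' by (simp add: field_simps)
  finally show ?thesis using pos by (simp add: N_def)
qed

text \<open>Minkowski's inequality by duality: \<open>v + w\<close> is paired with its own dual
  vector, and Hoelder's inequality is applied to each summand with the roles of the exponents
  exchanged.\<close>

lemma lp_norm_triangle:
  fixes v w :: "real ^ 'k"
  assumes q: "1 < q"
  shows "lp_norm q (v + w) \<le> lp_norm q v + lp_norm q w"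
proof (cases "v + w = 0")
  case True
  then show ?thesis by simp
next
  case False
  then have pos: "lp_norm q (v + w) > 0"
    using lp_norm_eq_0[of q "v + w"] q by (auto simp: order_less_le)
  define p where "p = q / (q - 1)"
  have p: "1 < p" and pq: "1 / q + 1 / p = 1"
    using q by (auto simp: p_def field_simps)
  define a where "a = lp_dual q (v + w)"
  have a: "lp_norm p a = lp_norm q (v + w)"
    unfolding a_def using p pq q by (intro lp_norm_lp_dual) auto
  have "(lp_norm q (v + w))\<^sup>2 = v \<bullet> a + w \<bullet> a"
    using inner_lp_dual[OF q, of "v + w"] by (simp add: a_def inner_add_left)
  also have "\<dots> \<le> lp_norm q v * lp_norm p a + lp_norm q w * lp_norm p a"
    by (intro add_mono lp_norm_Holder p pq)
  also have "\<dots> = (lp_norm q v + lp_norm q w) * lp_norm q (v + w)"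
    by (simp add: a algebra_simps)
  finally show ?thesis
    using pos by (simp add: power2_eq_square)
qed

lemma borel_measurable_lp_norm [measurable]: "lp_norm p \<in> borel_measurable borel"
  unfolding lp_norm_def by measurable

lemma borel_measurable_vecI:
  fixes f :: "'a \<Rightarrow> real ^ 'k"
  assumes "\<And>i. (\<lambda>x. f x $ i) \<in> borel_measurable M"
  shows "f \<in> borel_measurable M"
proof (rule borel_measurable_euclidean_space[THEN iffD2], rule ballI)
  fix b :: "real ^ 'k" assume "b \<in> Basis"
  then obtain i where b: "b = axis i (1::real)" by (auto simp: Basis_vec_def)
  show "(\<lambda>x. f x \<bullet> b) \<in> borel_measurable M"
    using assms[of i] by (simp add: b inner_axis)
qed

lemma borel_measurable_lp_dual: "lp_dual p \<in> borel_measurable borel"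
proof (rule borel_measurable_vecI)
  show "(\<lambda>x. lp_dual p x $ i) \<in> borel_measurable borel" for i
    unfolding lp_dual_def vec_lambda_beta sgn_if by measurable
qed

section \<open>Operator norms compared with the Euclidean norm, and small tails of integrals\<close>

lemma lp_norm_mult_vec_le:
  fixes A :: "real ^ 'k ^ 'r"
  assumes p: "1 \<le> p"
  shows "lp_norm p (A *v v) \<le> mat_lp_norm p A * lp_norm p v"
proof (cases "v = 0")
  case True
  then show ?thesis by simp
next
  case False
  then have pos: "lp_norm p v > 0"
    using lp_norm_eq_0[of p v] p by (auto simp: order_less_le)
  \<comment> \<open>A real supremum bounds its set only if the set is bounded above; this comes from
    the Euclidean operator norm and the equivalence of norms.\<close>
  have bdd: "bdd_above ((\<lambda>x. lp_norm p (A *v x)) ` {x. lp_norm p x \<le> 1})"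
  proof (rule bdd_aboveI2)
    fix x :: "real ^ 'k" assume "x \<in> {x. lp_norm p x \<le> 1}"
    then have "lp_norm p x \<le> 1" by simp
    then have "real CARD('k) * lp_norm p x \<le> real CARD('k) * 1"
      by (intro mult_left_mono) auto
    then have "norm x \<le> CARD('k)"
      using norm_le_lp_norm[of p x] p by linarith
    have "lp_norm p (A *v x) \<le> CARD('r) * norm (A *v x)"
      by (rule lp_norm_le_norm[OF p])
    also have "\<dots> \<le> CARD('r) * (onorm ((*v) A) * norm x)"
      by (intro mult_left_mono onorm) auto
    also have "\<dots> \<le> CARD('r) * (onorm ((*v) A) * CARD('k))"
      using \<open>norm x \<le> CARD('k)\<close> by (intro mult_left_mono) (auto intro!: onorm_pos_le)
    finally show "lp_norm p (A *v x) \<le> CARD('r) * (onorm ((*v) A) * CARD('k))" .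
  qed
  have "lp_norm p (A *v ((1 / lp_norm p v) *\<^sub>R v)) \<le> mat_lp_norm p A"
    unfolding mat_lp_norm_def using pos p
    by (intro cSUP_upper[OF _ bdd]) (simp add: lp_norm_scaleR)
  moreover have "A *v ((1 / lp_norm p v) *\<^sub>R v) = (1 / lp_norm p v) *\<^sub>R (A *v v)"
    by (simp add: linear_scale)
  ultimately show ?thesis
    using pos p by (simp add: lp_norm_scaleR field_simps)
qed

text \<open>The hypotheses on the loss are stated in \<open>mat_lp_norm\<close>, while all later
  estimates are Euclidean. The two cardinalities are the constants of norm equivalence in the target
  and in the source.\<close>

lemma norm_mult_vec_le_mat_lp_norm:
  fixes A :: "real ^ 'k ^ 'r"
  assumes p: "1 \<le> p" and K: "mat_lp_norm p A \<le> K"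
  shows "norm (A *v v) \<le> real CARD('r) * real CARD('k) * K * norm v"
proof -
  have "mat_lp_norm p A * lp_norm p v \<le> K * (CARD('k) * norm v)"
  proof -
    have "0 \<le> mat_lp_norm p A"
    proof -
      have "lp_norm p (A *v axis (SOME i. True) 1) \<le> mat_lp_norm p A * lp_norm p (axis (SOME i. True) 1 :: real ^ 'k)"
        by (rule lp_norm_mult_vec_le[OF p])
      moreover have "lp_norm p (axis (SOME i. True) 1 :: real ^ 'k) > 0"
        using lp_norm_eq_0[of p "axis (SOME i. True) 1 :: real ^ 'k"] p
        by (simp add: order_less_le)
      ultimately show ?thesis
        using lp_norm_nonneg[of p "A *v axis (SOME i. True) 1"]
        by (smt (verit) mult_neg_pos)
    qed
    then show ?thesis
      using K p by (intro mult_mono lp_norm_le_norm) auto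
  qed
  then have "lp_norm p (A *v v) \<le> K * (CARD('k) * norm v)"
    using lp_norm_mult_vec_le[OF p, of A v] by simp
  then have "real CARD('r) * lp_norm p (A *v v) \<le> CARD('r) * (K * (CARD('k) * norm v))"
    by (intro mult_left_mono) auto
  then show ?thesis
    using norm_le_lp_norm[of p "A *v v"] p unfolding mult.assoc mult.left_commute[of K] by linarith
qed

text \<open>Here \<open>norm A\<close> is the Frobenius norm, so the bound is Cauchy-Schwarz in each
  row.\<close>

lemma norm_mult_vec_le_norm:
  fixes A :: "real ^ 'k ^ 'r"
  shows "norm (A *v v) \<le> norm A * norm v"
proof -
  have "norm (A *v v) = L2_set (\<lambda>i. row i A \<bullet> v) UNIV"
    by (simp add: norm_vec_def matrix_vector_mul_component row_def L2_set_def)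
  also have "\<dots> \<le> L2_set (\<lambda>i. norm (A $ i) * norm v) UNIV"
    unfolding L2_set_def row_def
    by (intro real_sqrt_le_mono sum_mono)
       (metis Cauchy_Schwarz_ineq2 abs_ge_zero power2_abs power_mono vec_lambda_eta)
  also have "\<dots> = norm A * norm v"
    by (simp add: L2_set_left_distrib norm_vec_def)
  finally show ?thesis .
qed

text \<open>Dominated convergence with majorant \<open>norm (f x)\<close>: every value of k is
  finite, so each point eventually leaves the tail. Cutting f by a second function k allows a square
  to be cut at a level of its root.\<close>

lemma integral_tail_small:
  fixes f k :: "'a \<Rightarrow> real"
  assumes f: "integrable P f" and k [measurable]: "k \<in> borel_measurable P" and e: "0 < e"
  obtains N :: nat where "\<bar>\<integral>x. (if k x > real N then f x else 0) \<partial>P\<bar> < e"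
proof -
  have [measurable]: "f \<in> borel_measurable P" using f by auto
  have "(\<lambda>N. \<integral>x. (if k x > real N then f x else 0) \<partial>P) \<longlonglongrightarrow> (\<integral>x. 0 \<partial>P)"
  proof (rule integral_dominated_convergence[where w="\<lambda>x. norm (f x)"])
    show "AE x in P. (\<lambda>N. if k x > real N then f x else 0) \<longlonglongrightarrow> 0"
    proof (intro AE_I2)
      fix x
      obtain N0 :: nat where "k x < N0" using reals_Archimedean2 by blast
      then have "\<forall>\<^sub>F N in sequentially. (if k x > real N then f x else 0) = 0"
        by (intro eventually_sequentiallyI[of N0]) auto
      then show "(\<lambda>N. if k x > real N then f x else 0) \<longlonglongrightarrow> 0"
        by (rule tendsto_eventually)
    qed
  qed (use f in auto)
  then have "\<forall>\<^sub>F N in sequentially. \<bar>\<integral>x. (if k x > real N then f x else 0) \<partial>P\<bar> < e"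
    using e by (auto simp: tendsto_iff)
  then show thesis using that by (auto simp: eventually_sequentially)
qed

subsection \<open>Events of asymptotically full probability\<close>

text \<open>The events in question quantify over all couplings or concern random closed sets and may
  fail to be measurable, so the exceptional set is covered by a measurable E of small
  measure.\<close>

definition whp :: "'w measure \<Rightarrow> (nat \<Rightarrow> 'w \<Rightarrow> bool) \<Rightarrow> bool" where
  "whp M Q \<longleftrightarrow> (\<forall>\<tau>>0. \<forall>\<^sub>F n in sequentially.
     \<exists>E\<in>sets M. measure M E \<le> \<tau> \<and> (\<forall>\<omega>\<in>space M - E. Q n \<omega>))"

lemma whpD:
  assumes "whp M Q" "0 < \<tau>"
  shows "\<forall>\<^sub>F n in sequentially. \<exists>E\<in>sets M. measure M E \<le> \<tau> \<and> (\<forall>\<omega>\<in>space M - E. Q n \<omega>)"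
  using assms by (auto simp: whp_def)

lemma whp_eventually:
  assumes "\<forall>\<^sub>F n in sequentially. \<forall>\<omega>\<in>space M. Q n \<omega>"
  shows "whp M Q"
  unfolding whp_def
proof (intro allI impI)
  fix \<tau> :: real assume "0 < \<tau>"
  show "\<forall>\<^sub>F n in sequentially. \<exists>E\<in>sets M. measure M E \<le> \<tau> \<and> (\<forall>\<omega>\<in>space M - E. Q n \<omega>)"
    using assms by eventually_elim (use \<open>0 < \<tau>\<close> in \<open>auto intro!: bexI[of _ "{}"]\<close>)
qed

context prob_space
begin

lemma whp_conj:
  assumes "whp M Q" "whp M Q'"
  shows "whp M (\<lambda>n \<omega>. Q n \<omega> \<and> Q' n \<omega>)"
  unfolding whp_def
proof (intro allI impI)
  fix \<tau> :: real assume "0 < \<tau>"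
  then have "0 < \<tau> / 2" by simp
  show "\<forall>\<^sub>F n in sequentially. \<exists>E\<in>sets M. measure M E \<le> \<tau> \<and> (\<forall>\<omega>\<in>space M - E. Q n \<omega> \<and> Q' n \<omega>)"
    using whpD[OF assms(1) \<open>0 < \<tau> / 2\<close>] whpD[OF assms(2) \<open>0 < \<tau> / 2\<close>]
  proof eventually_elim
    case (elim n)
    then obtain E E' where "E \<in> sets M" "measure M E \<le> \<tau> / 2" "\<forall>\<omega>\<in>space M - E. Q n \<omega>"
      and "E' \<in> sets M" "measure M E' \<le> \<tau> / 2" "\<forall>\<omega>\<in>space M - E'. Q' n \<omega>" by blast
    moreover from this have "measure M (E \<union> E') \<le> \<tau>"
      using measure_Un_le[of E M E'] by simp
    ultimately show ?case by (intro bexI[of _ "E \<union> E'"]) auto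
  qed
qed

lemma whp_mono:
  assumes "whp M Q" "eventually R sequentially"
    and "\<And>n \<omega>. R n \<Longrightarrow> \<omega> \<in> space M \<Longrightarrow> Q n \<omega> \<Longrightarrow> Q' n \<omega>"
  shows "whp M Q'"
  unfolding whp_def
proof (intro allI impI)
  fix \<tau> :: real assume "0 < \<tau>"
  show "\<forall>\<^sub>F n in sequentially. \<exists>E\<in>sets M. measure M E \<le> \<tau> \<and> (\<forall>\<omega>\<in>space M - E. Q' n \<omega>)"
    using whpD[OF assms(1) \<open>0 < \<tau>\<close>] assms(2) by eventually_elim (use assms(3) in blast)
qed

lemma whp_mono':
  assumes "whp M Q" "\<And>n \<omega>. n \<ge> 1 \<Longrightarrow> \<omega> \<in> space M \<Longrightarrow> Q n \<omega> \<Longrightarrow> Q' n \<omega>"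
  shows "whp M Q'"
  by (rule whp_mono[OF assms(1) eventually_ge_at_top[of 1] assms(2)])

lemma whp_ball:
  assumes "finite I" "\<And>i. i \<in> I \<Longrightarrow> whp M (Q i)"
  shows "whp M (\<lambda>n \<omega>. \<forall>i\<in>I. Q i n \<omega>)"
  using assms
proof (induction I)
  case empty
  show ?case by (rule whp_eventually) simp
next
  case (insert i I)
  then have "whp M (\<lambda>n \<omega>. Q i n \<omega> \<and> (\<forall>i\<in>I. Q i n \<omega>))"
    by (intro whp_conj) auto
  then show ?case by simp
qed

text \<open>The outer measure of a set is attained by a measurable cover, which serves as the
  exceptional event.\<close>

lemma whp_iff_outer_measure:
  "whp M Q \<longleftrightarrow> (\<lambda>n. outer_measure_of M {\<omega>\<in>space M. \<not> Q n \<omega>}) \<longlonglongrightarrow> 0"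
proof
  assume Q: "whp M Q"
  show "(\<lambda>n. outer_measure_of M {\<omega>\<in>space M. \<not> Q n \<omega>}) \<longlonglongrightarrow> 0"
  proof (rule order_tendstoI)
    fix a :: ennreal assume "0 < a"
    then obtain \<tau> where \<tau>: "0 < \<tau>" "ennreal \<tau> < a"
    proof (cases a)
      case (real r)
      then show ?thesis using \<open>0 < a\<close> that[of "r / 2"] by (auto simp: ennreal_less_iff)
    next
      case top
      then show ?thesis using that[of 1] by simp
    qed
    show "\<forall>\<^sub>F n in sequentially. outer_measure_of M {\<omega>\<in>space M. \<not> Q n \<omega>} < a"
      using whpD[OF Q \<tau>(1)]
    proof eventually_elim
      case (elim n)
      then obtain E where E: "E \<in> sets M" "measure M E \<le> \<tau>" "\<forall>\<omega>\<in>space M - E. Q n \<omega>" by blast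
      then have "outer_measure_of M {\<omega>\<in>space M. \<not> Q n \<omega>} \<le> outer_measure_of M E"
        by (intro outer_measure_of_mono) auto
      also have "\<dots> \<le> ennreal \<tau>"
        using E by (simp add: emeasure_eq_measure ennreal_leI)
      finally show ?case using \<tau> by simp
    qed
  qed simp
next
  assume lim: "(\<lambda>n. outer_measure_of M {\<omega>\<in>space M. \<not> Q n \<omega>}) \<longlonglongrightarrow> 0"
  show "whp M Q"
    unfolding whp_def
  proof (intro allI impI)
    fix \<tau> :: real assume "0 < \<tau>"
    then have "\<forall>\<^sub>F n in sequentially. outer_measure_of M {\<omega>\<in>space M. \<not> Q n \<omega>} < ennreal \<tau>"
      using lim by (intro order_tendstoD) auto
    then show "\<forall>\<^sub>F n in sequentially. \<exists>E\<in>sets M. measure M E \<le> \<tau> \<and> (\<forall>\<omega>\<in>space M - E. Q n \<omega>)"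
    proof eventually_elim
      case (elim n)
      obtain E where E: "E \<in> sets M" "{\<omega>\<in>space M. \<not> Q n \<omega>} \<subseteq> E"
        "outer_measure_of M {\<omega>\<in>space M. \<not> Q n \<omega>} = emeasure M E"
        using outer_measure_of_attain[of "{\<omega>\<in>space M. \<not> Q n \<omega>}" M] by auto
      with elim \<open>0 < \<tau>\<close> have "measure M E \<le> \<tau>"
        by (simp add: emeasure_eq_measure ennreal_less_iff)
      with E show ?case by blast
    qed
  qed
qed

text \<open>Half of \<tau> is spent on a level L that H exceeds rarely for every
  \<open>n \<ge> 1\<close>, the other half on the statement at that fixed L. This is how the
  unbounded score is treated as a bounded quantity.\<close>

lemma whp_of_tight:
  fixes H :: "nat \<Rightarrow> 'a \<Rightarrow> real"
  assumes tight: "\<And>\<tau>. 0 < \<tau> \<Longrightarrow> \<exists>L. \<forall>n\<ge>1. \<exists>E\<in>sets M. measure M E \<le> \<tau> \<and> (\<forall>\<omega>\<in>space M - E. H n \<omega> \<le> L)"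
    and Q: "\<And>L. whp M (\<lambda>n \<omega>. H n \<omega> \<le> L \<longrightarrow> Q n \<omega>)"
  shows "whp M Q"
  unfolding whp_def
proof (intro allI impI)
  fix \<tau> :: real assume "0 < \<tau>"
  then have "0 < \<tau> / 2" by simp
  from tight[OF this] obtain L where
    L: "\<forall>n\<ge>1. \<exists>E\<in>sets M. measure M E \<le> \<tau> / 2 \<and> (\<forall>\<omega>\<in>space M - E. H n \<omega> \<le> L)" by blast
  show "\<forall>\<^sub>F n in sequentially. \<exists>E\<in>sets M. measure M E \<le> \<tau> \<and> (\<forall>\<omega>\<in>space M - E. Q n \<omega>)"
    using whpD[OF Q[of L] \<open>0 < \<tau> / 2\<close>] eventually_ge_at_top[of 1]
  proof eventually_elim
    case (elim n)
    then obtain E where E: "E \<in> sets M" "measure M E \<le> \<tau> / 2"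
      "\<forall>\<omega>\<in>space M - E. H n \<omega> \<le> L \<longrightarrow> Q n \<omega>" by blast
    from L elim obtain E' where E': "E' \<in> sets M" "measure M E' \<le> \<tau> / 2"
      "\<forall>\<omega>\<in>space M - E'. H n \<omega> \<le> L" by blast
    have "measure M (E \<union> E') \<le> \<tau>"
      using measure_Un_le[of E M E'] E E' by simp
    with E E' show ?case by (intro bexI[of _ "E \<union> E'"]) auto
  qed
qed

end

subsection \<open>Independent samples\<close>

text \<open>Vector valued, so that moduli, scores and Hessian matrices are averaged by one notion;
  the value at \<open>n = 0\<close> is 0.\<close>

definition sample_mean :: "nat \<Rightarrow> (nat \<Rightarrow> 'a) \<Rightarrow> ('a \<Rightarrow> 'b::real_vector) \<Rightarrow> 'b" where
  "sample_mean n x f = (\<Sum>i<n. f (x i)) /\<^sub>R real n"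

lemma
  fixes f :: "'a::topological_space \<Rightarrow> 'b::euclidean_space"
  assumes n: "n \<ge> 1" and f: "f \<in> borel_measurable borel"
  shows integrable_empirical_measure: "integrable (empirical_measure n x) f"
    and integral_empirical_measure: "integral\<^sup>L (empirical_measure n x) f = sample_mean n x f"
proof -
  have x: "x \<in> measurable (uniform_count_measure {..<n}) borel"
    by (simp add: uniform_count_measure_def measurable_def)
  have U: "uniform_count_measure {..<n} = point_measure {..<n} (\<lambda>_. ennreal (1 / real n))"
    by (simp add: uniform_count_measure_def)
  show "integrable (empirical_measure n x) f"
    unfolding empirical_measure_def
    by (subst integrable_distr_eq[OF x f]) (simp add: U integrable_point_measure_finite)
  show "integral\<^sup>L (empirical_measure n x) f = sample_mean n x f"
    unfolding empirical_measure_def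
    by (subst integral_distr[OF x f])
       (use n in \<open>simp add: U lebesgue_integral_point_measure_finite sample_mean_def
          scaleR_sum_right divide_inverse\<close>)
qed

lemma prob_space_empirical_measure:
  assumes "n \<ge> 1"
  shows "prob_space (empirical_measure n x)"
proof -
  have "prob_space (uniform_count_measure {..<n})"
    using assms by (intro prob_space_uniform_count_measure) (auto simp: lessThan_empty_iff)
  then show ?thesis
    unfolding empirical_measure_def
    by (rule prob_space.prob_space_distr) (simp add: uniform_count_measure_def measurable_def)
qed

lemma sets_empirical_measure [simp, measurable_cong]: "sets (empirical_measure n x) = sets borel"
  by (simp add: empirical_measure_def)

locale iid_sample = prob_space M for M :: "'w measure" +
  fixes X :: "nat \<Rightarrow> 'w \<Rightarrow> 'b::topological_space" and P :: "'b measure"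
  assumes indep: "indep_vars (\<lambda>_. borel) X UNIV"
    and law: "distr M borel (X i) = P"
begin

lemma X_measurable [measurable]: "X i \<in> borel_measurable M"
  using indep by (auto simp: indep_vars_def)

lemma prob_space_P: "prob_space P"
  using prob_space_distr[OF X_measurable[of 0]] law[of 0] by simp

lemma sets_P [simp, measurable_cong]: "sets P = sets borel"
  using law[of 0] by (metis sets_distr)

lemma
  fixes f :: "'b \<Rightarrow> 'c::{banach, second_countable_topology}"
  assumes f: "integrable P f"
  shows integrable_X: "integrable M (\<lambda>\<omega>. f (X i \<omega>))"
    and integral_X: "(\<integral>\<omega>. f (X i \<omega>) \<partial>M) = integral\<^sup>L P f"
proof -
  have [measurable]: "f \<in> borel_measurable borel"
    using borel_measurable_integrable[OF f] by simp
  show "integrable M (\<lambda>\<omega>. f (X i \<omega>))"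
    using f law[of i] by (metis X_measurable \<open>f \<in> borel_measurable borel\<close> integrable_distr_eq)
  show "(\<integral>\<omega>. f (X i \<omega>) \<partial>M) = integral\<^sup>L P f"
    using integral_distr[OF X_measurable[of i] \<open>f \<in> borel_measurable borel\<close>] law[of i] by simp
qed

text \<open>Products with distinct indices integrate to 0 by independence and centering, so only the
  n diagonal terms remain.\<close>

lemma second_moment_sum:
  fixes g :: "'b \<Rightarrow> real"
  assumes g: "g \<in> borel_measurable borel" and g2: "integrable P (\<lambda>x. (g x)\<^sup>2)"
    and mean: "integral\<^sup>L P g = 0"
  shows "integrable M (\<lambda>\<omega>. (\<Sum>i<n. g (X i \<omega>))\<^sup>2)"
    and "(\<integral>\<omega>. (\<Sum>i<n. g (X i \<omega>))\<^sup>2 \<partial>M) = real n * (\<integral>x. (g x)\<^sup>2 \<partial>P)"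
proof -
  interpret P: prob_space P by (rule prob_space_P)
  have gP: "integrable P g"
    by (rule P.square_integrable_imp_integrable) (use g g2 in auto)
  have prod: "integrable M (\<lambda>\<omega>. g (X i \<omega>) * g (X j \<omega>))"
      "(\<integral>\<omega>. g (X i \<omega>) * g (X j \<omega>) \<partial>M) = 0" if "i \<noteq> j" for i j
  proof -
    have ind: "indep_vars (\<lambda>_. borel) (\<lambda>k \<omega>. g (X k \<omega>)) {i, j}"
      by (rule indep_vars_compose2[OF indep_vars_subset[OF indep]]) (use g in auto)
    have int: "\<And>k. k \<in> {i, j} \<Longrightarrow> integrable M (\<lambda>\<omega>. g (X k \<omega>))"
      by (rule integrable_X[OF gP])
    show "integrable M (\<lambda>\<omega>. g (X i \<omega>) * g (X j \<omega>))"
      using indep_vars_integrable[OF _ ind int] that by simp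
    show "(\<integral>\<omega>. g (X i \<omega>) * g (X j \<omega>) \<partial>M) = 0"
      using indep_vars_lebesgue_integral[OF _ ind int] that by (simp add: integral_X[OF gP] mean)
  qed
  have sq: "integrable M (\<lambda>\<omega>. g (X i \<omega>) * g (X i \<omega>))"
      "(\<integral>\<omega>. g (X i \<omega>) * g (X i \<omega>) \<partial>M) = (\<integral>x. (g x)\<^sup>2 \<partial>P)" for i
    using integrable_X[OF g2, of i] integral_X[OF g2, of i] by (simp_all add: power2_eq_square)
  have all: "integrable M (\<lambda>\<omega>. g (X i \<omega>) * g (X j \<omega>))" for i j
    using prod(1) sq(1) by (cases "i = j") auto
  have expand: "(\<lambda>\<omega>. (\<Sum>i<n. g (X i \<omega>))\<^sup>2) = (\<lambda>\<omega>. \<Sum>i<n. \<Sum>j<n. g (X i \<omega>) * g (X j \<omega>))"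
    by (simp add: power2_eq_square sum_product)
  show "integrable M (\<lambda>\<omega>. (\<Sum>i<n. g (X i \<omega>))\<^sup>2)"
    unfolding expand by (intro Bochner_Integration.integrable_sum all)
  have "(\<integral>\<omega>. (\<Sum>i<n. g (X i \<omega>))\<^sup>2 \<partial>M) = (\<Sum>i<n. \<Sum>j<n. \<integral>\<omega>. g (X i \<omega>) * g (X j \<omega>) \<partial>M)"
    unfolding expand
    by (subst Bochner_Integration.integral_sum, auto intro!: all Bochner_Integration.integrable_sum)
       (subst Bochner_Integration.integral_sum, auto intro!: all)
  also have "\<dots> = (\<Sum>i<n. \<Sum>j<n. if j = i then (\<integral>x. (g x)\<^sup>2 \<partial>P) else 0)"
    by (intro sum.cong) (auto simp: sq(2) prod(2))
  also have "\<dots> = real n * (\<integral>x. (g x)\<^sup>2 \<partial>P)"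
    by simp
  finally show "(\<integral>\<omega>. (\<Sum>i<n. g (X i \<omega>))\<^sup>2 \<partial>M) = real n * (\<integral>x. (g x)\<^sup>2 \<partial>P)" .
qed

lemma sum_Chebyshev:
  fixes g :: "'b \<Rightarrow> real"
  assumes g: "g \<in> borel_measurable borel" and g2: "integrable P (\<lambda>x. (g x)\<^sup>2)"
    and mean: "integral\<^sup>L P g = 0" and a: "0 < a"
  shows "prob {\<omega>\<in>space M. a \<le> \<bar>\<Sum>i<n. g (X i \<omega>)\<bar>} \<le> real n * (\<integral>x. (g x)\<^sup>2 \<partial>P) / a\<^sup>2"
proof -
  have [measurable]: "g \<in> borel_measurable borel" by (rule g)
  show ?thesis
    using second_moment_method[of "\<lambda>\<omega>. \<Sum>i<n. g (X i \<omega>)" a] second_moment_sum[OF g g2 mean, of n] a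
    by simp
qed

text \<open>Khinchin's weak law; the truncation argument avoids a second moment.\<close>

lemma weak_law_real:
  fixes f :: "'b \<Rightarrow> real"
  assumes f: "integrable P f" and e: "0 < e"
  shows "whp M (\<lambda>n \<omega>. \<bar>sample_mean n (\<lambda>i. X i \<omega>) f - integral\<^sup>L P f\<bar> < e)"
  unfolding whp_def
proof (intro allI impI)
  fix \<tau> :: real assume \<tau>: "0 < \<tau>"
  interpret P: prob_space P by (rule prob_space_P)
  have [measurable]: "f \<in> borel_measurable borel"
    using borel_measurable_integrable[OF f] by simp
  \<comment> \<open>The first entry makes Markov's inequality at threshold \<open>e / 4\<close> cost
    at most \<open>\<tau> / 2\<close>; the second keeps the change of the mean caused by truncation
    below \<open>e / 4\<close>.\<close>
  define \<delta> where "\<delta> = min (e * \<tau> / 8) (e / 4)"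
  have \<delta>: "0 < \<delta>" using e \<tau> by (simp add: \<delta>_def)
  obtain N :: nat where N: "\<bar>\<integral>x. (if \<bar>f x\<bar> > real N then \<bar>f x\<bar> else 0) \<partial>P\<bar> < \<delta>"
    using integral_tail_small[of P "\<lambda>x. \<bar>f x\<bar>" "\<lambda>x. \<bar>f x\<bar>" \<delta>] f \<delta> by auto
  define r where "r x = (if \<bar>f x\<bar> > real N then \<bar>f x\<bar> else 0)" for x
  define t where "t x = (if \<bar>f x\<bar> > real N then 0 else f x)" for x
  define g where "g x = t x - integral\<^sup>L P t" for x
  have [measurable]: "r \<in> borel_measurable borel" "t \<in> borel_measurable borel" "g \<in> borel_measurable borel"
    by (auto simp: r_def [abs_def] t_def [abs_def] g_def [abs_def])
  have r: "integrable P r" and t: "integrable P t"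
    by (rule Bochner_Integration.integrable_bound[OF f]; simp add: r_def t_def)+
  have r0: "0 \<le> r x" for x by (simp add: r_def)
  have t_le: "\<bar>t x\<bar> \<le> N" for x by (simp add: t_def)
  have It_le: "\<bar>integral\<^sup>L P t\<bar> \<le> N"
  proof -
    have "\<bar>integral\<^sup>L P t\<bar> \<le> (\<integral>x. \<bar>t x\<bar> \<partial>P)" by (rule integral_abs_bound)
    also have "\<dots> \<le> (\<integral>x. real N \<partial>P)" by (intro integral_mono) (use t t_le in auto)
    finally show ?thesis by (simp add: P.prob_space)
  qed
  have g_le: "\<bar>g x\<bar> \<le> 2 * N" for x using t_le[of x] It_le by (simp add: g_def)
  have g2_le: "(g x)\<^sup>2 \<le> (2 * N)\<^sup>2" for x
    using power_mono[OF g_le[of x], of 2] by simp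
  have g2: "integrable P (\<lambda>x. (g x)\<^sup>2)"
    by (rule Bochner_Integration.integrable_bound[of _ "\<lambda>_. (real (2 * N))\<^sup>2"])
       (use g2_le in \<open>auto simp: P.integrable_const\<close>)
  have Ig2: "(\<integral>x. (g x)\<^sup>2 \<partial>P) \<le> (2 * N)\<^sup>2"
  proof -
    have "(\<integral>x. (g x)\<^sup>2 \<partial>P) \<le> (\<integral>x. (real (2 * N))\<^sup>2 \<partial>P)" using g2 g2_le by (intro integral_mono) auto
    then show ?thesis by (simp add: P.prob_space)
  qed
  have Ig: "integral\<^sup>L P g = 0"
    using t by (simp add: g_def [abs_def] P.prob_space)
  have Ir: "integral\<^sup>L P r < \<delta>" using N by (simp add: r_def [abs_def])
  have split: "\<bar>f x - t x\<bar> = r x" for x by (simp add: r_def t_def)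
  have If: "\<bar>integral\<^sup>L P f - integral\<^sup>L P t\<bar> \<le> integral\<^sup>L P r"
  proof -
    have "integral\<^sup>L P f - integral\<^sup>L P t = (\<integral>x. f x - t x \<partial>P)" using f t by simp
    also have "\<bar>\<dots>\<bar> \<le> (\<integral>x. \<bar>f x - t x\<bar> \<partial>P)" by (rule integral_abs_bound)
    finally show ?thesis by (simp add: split)
  qed
  have "(\<lambda>n. (2 * real N)\<^sup>2 * 16 / e\<^sup>2 / real n) \<longlonglongrightarrow> 0"
    by (rule lim_const_over_n)
  then have "\<forall>\<^sub>F n in sequentially. (2 * real N)\<^sup>2 * 16 / e\<^sup>2 / real n < \<tau> / 2"
    using \<tau> by (intro order_tendstoD) auto
  then show "\<forall>\<^sub>F n in sequentially. \<exists>E\<in>sets M. measure M E \<le> \<tau> \<and>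
     (\<forall>\<omega>\<in>space M - E. \<bar>sample_mean n (\<lambda>i. X i \<omega>) f - integral\<^sup>L P f\<bar> < e)"
    using eventually_ge_at_top[of 1]
  proof eventually_elim
    case (elim n)
    \<comment> \<open>On \<open>E1\<close> the centered bounded part deviates, which Chebyshev makes
      rare; on \<open>E2\<close> the discarded part is large on average, which Markov makes rare
      without a second moment.\<close>
    define E1 where "E1 = {\<omega>\<in>space M. real n * (e / 4) \<le> \<bar>\<Sum>i<n. g (X i \<omega>)\<bar>}"
    define E2 where "E2 = {\<omega>\<in>space M. e / 4 \<le> sample_mean n (\<lambda>i. X i \<omega>) r}"
    have m [measurable]: "(\<lambda>\<omega>. sample_mean n (\<lambda>i. X i \<omega>) r) \<in> borel_measurable M"
      by (simp add: sample_mean_def)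
    have E: "E1 \<in> sets M" "E2 \<in> sets M" unfolding E1_def E2_def by measurable
    have "prob E1 \<le> real n * (\<integral>x. (g x)\<^sup>2 \<partial>P) / (real n * (e / 4))\<^sup>2"
      unfolding E1_def by (rule sum_Chebyshev[OF _ g2 Ig]) (use elim e in auto)
    also have "\<dots> \<le> real n * (2 * N)\<^sup>2 / (real n * (e / 4))\<^sup>2"
      by (intro divide_right_mono mult_left_mono Ig2) auto
    also have "\<dots> = (2 * real N)\<^sup>2 * 16 / e\<^sup>2 / real n"
      using elim e by (simp add: field_simps power2_eq_square)
    finally have p1: "prob E1 \<le> \<tau> / 2" using elim by simp
    have int: "integrable M (\<lambda>\<omega>. sample_mean n (\<lambda>i. X i \<omega>) r)"
      unfolding sample_mean_def by (intro integrable_scaleR_right Bochner_Integration.integrable_sum integrable_X r)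
    have mean: "(\<integral>\<omega>. sample_mean n (\<lambda>i. X i \<omega>) r \<partial>M) = integral\<^sup>L P r"
      unfolding sample_mean_def
      using elim by (simp add: integrable_X r integral_X)
    have "prob E2 \<le> integral\<^sup>L P r / (e / 4)"
      unfolding E2_def mean[symmetric]
      by (rule integral_Markov_inequality_measure[OF int sets.empty_sets])
         (use e in \<open>auto simp: sample_mean_def intro!: mult_nonneg_nonneg sum_nonneg r0 AE_I2\<close>)
    also have "\<dots> \<le> \<tau> / 2"
      using Ir e by (simp add: \<delta>_def field_simps)
    finally have "prob (E1 \<union> E2) \<le> \<tau>"
      using p1 E measure_Un_le[of E1 M E2] by simp
    moreover have "\<bar>sample_mean n (\<lambda>i. X i \<omega>) f - integral\<^sup>L P f\<bar> < e" if "\<omega> \<in> space M - (E1 \<union> E2)" for \<omega>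
    proof -
      let ?m = "sample_mean n (\<lambda>i. X i \<omega>)"
      have "\<bar>\<Sum>i<n. g (X i \<omega>)\<bar> < real n * (e / 4)" "?m r < e / 4"
        using that by (auto simp: E1_def E2_def)
      moreover have "(\<Sum>i<n. g (X i \<omega>)) = real n * (?m t - integral\<^sup>L P t)"
        using elim by (simp add: g_def sum_subtractf sample_mean_def field_simps)
      ultimately have "\<bar>?m t - integral\<^sup>L P t\<bar> < e / 4"
        using elim by (simp add: abs_mult)
      moreover have "\<bar>?m f - ?m t\<bar> \<le> ?m r"
      proof -
        have "?m f - ?m t = (\<Sum>i<n. f (X i \<omega>) - t (X i \<omega>)) /\<^sub>R real n"
          by (simp add: sample_mean_def sum_subtractf right_diff_distrib)
        also have "\<bar>\<dots>\<bar> \<le> (\<Sum>i<n. \<bar>f (X i \<omega>) - t (X i \<omega>)\<bar>) /\<^sub>R real n"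
          by (simp add: abs_mult mult_left_mono)
        finally show ?thesis by (simp add: split sample_mean_def)
      qed
      moreover have "integral\<^sup>L P r < e / 4" using Ir by (simp add: \<delta>_def)
      ultimately show ?thesis
        using If \<open>?m r < e / 4\<close> by linarith
    qed
    ultimately show ?case using E by (intro bexI[of _ "E1 \<union> E2"]) auto
  qed
qed

lemma sample_mean_inner: "sample_mean n x f \<bullet> b = sample_mean n x (\<lambda>y. f y \<bullet> b)"
  by (simp add: sample_mean_def inner_sum_left)

lemma weak_law:
  fixes f :: "'b \<Rightarrow> 'c::euclidean_space"
  assumes f: "integrable P f" and e: "0 < e"
  shows "whp M (\<lambda>n \<omega>. norm (sample_mean n (\<lambda>i. X i \<omega>) f - integral\<^sup>L P f) < e)"
proof -
  let ?d = "e / (2 * real DIM('c))"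
  have "0 < ?d" using e by simp
  have "whp M (\<lambda>n \<omega>. \<forall>b\<in>Basis. \<bar>sample_mean n (\<lambda>i. X i \<omega>) (\<lambda>x. f x \<bullet> b) - (\<integral>x. f x \<bullet> b \<partial>P)\<bar> < ?d)"
    using f \<open>0 < ?d\<close> by (intro whp_ball weak_law_real) auto
  then show ?thesis
  proof (rule whp_mono')
    fix n \<omega>
    assume *: "\<forall>b\<in>Basis. \<bar>sample_mean n (\<lambda>i. X i \<omega>) (\<lambda>x. f x \<bullet> b) - (\<integral>x. f x \<bullet> b \<partial>P)\<bar> < ?d"
    let ?v = "sample_mean n (\<lambda>i. X i \<omega>) f - integral\<^sup>L P f"
    have "norm ?v \<le> (\<Sum>b\<in>Basis. \<bar>?v \<bullet> b\<bar>)" by (rule norm_le_l1)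
    also have "\<dots> \<le> (\<Sum>b\<in>(Basis :: 'c set). ?d)"
      using * f by (intro sum_mono) (auto simp: inner_diff_left sample_mean_inner less_imp_le)
    also have "\<dots> < e" using e by simp
    finally show "norm ?v < e" .
  qed
qed

text \<open>Chebyshev's inequality for each coordinate at a threshold proportional to
  \<open>sqrt n\<close> gives a bound in which n cancels, hence one level for all
  \<open>n \<ge> 1\<close>.\<close>

lemma sqrt_n_sample_mean_tight:
  fixes h :: "'b \<Rightarrow> 'c::euclidean_space"
  assumes h: "h \<in> borel_measurable borel" and h2: "integrable P (\<lambda>x. (norm (h x))\<^sup>2)"
    and mean: "integral\<^sup>L P h = 0" and \<tau>: "0 < \<tau>"
  shows "\<exists>L. \<forall>n\<ge>1. \<exists>E\<in>sets M. measure M E \<le> \<tau> \<and>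
    (\<forall>\<omega>\<in>space M - E. norm (sqrt (real n) *\<^sub>R sample_mean n (\<lambda>i. X i \<omega>) h) \<le> L)"
proof -
  interpret P: prob_space P by (rule prob_space_P)
  have [measurable]: "h \<in> borel_measurable borel" by (rule h)
  have hP: "integrable P h"
    using P.square_integrable_imp_integrable[of "\<lambda>x. norm (h x)"] h2
    by (simp add: integrable_norm_iff)
  define S where "S = (\<integral>x. (norm (h x))\<^sup>2 \<partial>P)"
  have S: "0 \<le> S" by (simp add: S_def)
  \<comment> \<open>Chosen so that the coordinate bounds \<open>(S + 1) / a\<^sup>2\<close> add up
    to \<tau>; adding 1 keeps a positive when S vanishes.\<close>
  define a where "a = sqrt (real DIM('c) * (S + 1) / \<tau>)"
  have a: "0 < a" "a\<^sup>2 = real DIM('c) * (S + 1) / \<tau>" using S \<tau> by (auto simp: a_def)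
  have "\<exists>E\<in>sets M. measure M E \<le> \<tau> \<and>
    (\<forall>\<omega>\<in>space M - E. norm (sqrt (real n) *\<^sub>R sample_mean n (\<lambda>i. X i \<omega>) h) \<le> real DIM('c) * a)"
    if n: "n \<ge> 1" for n
  proof -
    define E where "E b = {\<omega>\<in>space M. sqrt (real n) * a \<le> \<bar>\<Sum>i<n. h (X i \<omega>) \<bullet> b\<bar>}" for b
    have E [measurable]: "E b \<in> sets M" for b unfolding E_def by measurable
    have pE: "prob (E b) \<le> \<tau> / real DIM('c)" if b: "b \<in> Basis" for b
    proof -
      have le: "(h x \<bullet> b)\<^sup>2 \<le> (norm (h x))\<^sup>2" for x
        using Basis_le_norm[OF b, of "h x"] by (metis abs_ge_zero power2_abs power_mono)
      have i2: "integrable P (\<lambda>x. (h x \<bullet> b)\<^sup>2)"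
        by (rule Bochner_Integration.integrable_bound[OF h2]) (use le in auto)
      have "prob (E b) \<le> real n * (\<integral>x. (h x \<bullet> b)\<^sup>2 \<partial>P) / (sqrt (real n) * a)\<^sup>2"
        unfolding E_def by (rule sum_Chebyshev[OF _ i2]) (use n a hP mean in auto)
      also have "\<dots> = (\<integral>x. (h x \<bullet> b)\<^sup>2 \<partial>P) / a\<^sup>2"
        using n by (simp add: power_mult_distrib)
      also have "\<dots> \<le> (S + 1) / a\<^sup>2"
      proof -
        have "(\<integral>x. (h x \<bullet> b)\<^sup>2 \<partial>P) \<le> S" unfolding S_def by (intro integral_mono i2 h2 le)
        then show ?thesis by (intro divide_right_mono) auto
      qed
      also have "\<dots> = \<tau> / real DIM('c)" using S \<tau> by (simp add: a(2))
      finally show ?thesis .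
    qed
    have "prob (\<Union>b\<in>Basis. E b) \<le> (\<Sum>b\<in>Basis. prob (E b))"
      by (rule finite_measure_subadditive_finite) auto
    also have "\<dots> \<le> (\<Sum>b\<in>(Basis :: 'c set). \<tau> / real DIM('c))" by (intro sum_mono pE)
    also have "\<dots> = \<tau>" by simp
    finally have "prob (\<Union>b\<in>Basis. E b) \<le> \<tau>" .
    moreover have "norm (sqrt (real n) *\<^sub>R sample_mean n (\<lambda>i. X i \<omega>) h) \<le> real DIM('c) * a"
      if \<omega>: "\<omega> \<in> space M - (\<Union>b\<in>Basis. E b)" for \<omega>
    proof -
      let ?v = "sqrt (real n) *\<^sub>R sample_mean n (\<lambda>i. X i \<omega>) h"
      have "\<bar>?v \<bullet> b\<bar> \<le> a" if b: "b \<in> Basis" for b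
      proof -
        have "\<bar>\<Sum>i<n. h (X i \<omega>) \<bullet> b\<bar> < sqrt (real n) * a" using \<omega> b by (force simp: E_def)
        moreover have "?v \<bullet> b = (\<Sum>i<n. h (X i \<omega>) \<bullet> b) / sqrt (real n)"
          using n by (simp add: sample_mean_def inner_sum_left field_simps)
        ultimately show ?thesis using n by (simp add: abs_divide pos_divide_le_eq mult.commute)
      qed
      then have "(\<Sum>b\<in>Basis. \<bar>?v \<bullet> b\<bar>) \<le> (\<Sum>b\<in>(Basis :: 'c set). a)" by (intro sum_mono)
      then show ?thesis using norm_le_l1[of ?v] by simp
    qed
    ultimately show ?thesis
      by (intro bexI[of _ "\<Union>b\<in>Basis. E b"]) (auto intro!: sets.finite_UN)
  qed
  then show ?thesis by blast
qed

end

subsection \<open>Convergence in the Fell topology\<close>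

context prob_space
begin

text \<open>Induction over the generation of open sets from the hit and miss sets. Because a is a
  fixed set, a union needs only one member that contains a, chosen independently of n and \<omega>;
  an intersection of two sets is a conjunction of events.\<close>

lemma whp_fell_open:
  fixes A :: "nat \<Rightarrow> 'a \<Rightarrow> 'b::topological_space set"
  assumes A: "\<And>n \<omega>. \<omega> \<in> space M \<Longrightarrow> closed (A n \<omega>)"
    and miss: "\<And>K. compact K \<Longrightarrow> a \<inter> K = {} \<Longrightarrow> whp M (\<lambda>n \<omega>. A n \<omega> \<inter> K = {})"
    and hit: "\<And>G. open G \<Longrightarrow> a \<inter> G \<noteq> {} \<Longrightarrow> whp M (\<lambda>n \<omega>. A n \<omega> \<inter> G \<noteq> {})"
    and U: "openin fell_topology U" "a \<in> U"
  shows "whp M (\<lambda>n \<omega>. A n \<omega> \<in> U)"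
proof -
  have "generate_topology_on
    ({{F. closed F \<and> F \<inter> K = {}} | K. compact K} \<union>
     {{F. closed F \<and> F \<inter> G \<noteq> {}} | G. open G}) U"
    using U(1) unfolding fell_topology_def by (rule openin_topology_generated_by)
  then show ?thesis
    using U(2)
  proof (induction rule: generate_topology_on.induct)
    case Empty
    then show ?case by simp
  next
    case (Int U V)
    then have "whp M (\<lambda>n \<omega>. A n \<omega> \<in> U \<and> A n \<omega> \<in> V)" by (intro whp_conj) auto
    then show ?case by simp
  next
    case (UN \<K>)
    then obtain V where "V \<in> \<K>" "a \<in> V" by blast
    with UN.IH[of V] have "whp M (\<lambda>n \<omega>. A n \<omega> \<in> V)" by blast
    then show ?case by (rule whp_mono') (use \<open>V \<in> \<K>\<close> in blast)
  next
    case (Basis S)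
    from Basis(1) show ?case
    proof
      assume "S \<in> {{F. closed F \<and> F \<inter> K = {}} | K. compact K}"
      then obtain K where K: "S = {F. closed F \<and> F \<inter> K = {}} \<and> compact K"
        unfolding mem_Collect_eq by (rule exE)
      with Basis(2) have "whp M (\<lambda>n \<omega>. A n \<omega> \<inter> K = {})" by (intro miss) auto
      then show ?thesis by (rule whp_mono') (use A K in auto)
    next
      assume "S \<in> {{F. closed F \<and> F \<inter> G \<noteq> {}} | G. open G}"
      then obtain G where G: "S = {F. closed F \<and> F \<inter> G \<noteq> {}} \<and> open G"
        unfolding mem_Collect_eq by (rule exE)
      with Basis(2) have "whp M (\<lambda>n \<omega>. A n \<omega> \<inter> G \<noteq> {})" by (intro hit) auto
      then show ?thesis by (rule whp_mono') (use A G in auto)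
    qed
  qed
qed

lemma converges_in_prob_fellI:
  fixes A :: "nat \<Rightarrow> 'a \<Rightarrow> 'b::topological_space set"
  assumes "closed a"
    and "\<And>n \<omega>. \<omega> \<in> space M \<Longrightarrow> closed (A n \<omega>)"
    and "\<And>K. compact K \<Longrightarrow> a \<inter> K = {} \<Longrightarrow> whp M (\<lambda>n \<omega>. A n \<omega> \<inter> K = {})"
    and "\<And>G. open G \<Longrightarrow> a \<inter> G \<noteq> {} \<Longrightarrow> whp M (\<lambda>n \<omega>. A n \<omega> \<inter> G \<noteq> {})"
  shows "converges_in_prob fell_topology M A a"
  unfolding converges_in_prob_def
  using assms whp_fell_open[OF assms(2,3,4)]
  by (auto simp: topspace_fell_topology whp_iff_outer_measure)

lemma converges_in_prob_whp:
  assumes "converges_in_prob T M A a" "openin T U" "a \<in> U"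
  shows "whp M (\<lambda>n \<omega>. A n \<omega> \<in> U)"
  using assms by (auto simp: converges_in_prob_def whp_iff_outer_measure)

text \<open>Off E the value is within e of y, and on E it is off by at most \<open>2 * K\<close>. So
  \<open>y + e + 2 * K * indicator E\<close> is one of the majorants in the infimum, and every
  majorant lies above \<open>y - e - 2 * K * indicator E\<close>.\<close>

lemma outer_expectation_close:
  fixes Y :: "'a \<Rightarrow> real"
  assumes bound: "\<And>\<omega>. \<omega> \<in> space M \<Longrightarrow> \<bar>Y \<omega>\<bar> \<le> K" and y: "\<bar>y\<bar> \<le> K"
    and E: "E \<in> sets M" "measure M E \<le> \<tau>"
    and close: "\<And>\<omega>. \<omega> \<in> space M - E \<Longrightarrow> \<bar>Y \<omega> - y\<bar> \<le> e" and e: "0 \<le> e"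
  shows "\<bar>outer_expectation M Y - y\<bar> \<le> e + 2 * K * \<tau>"
proof -
  have K: "0 \<le> K" using y by simp
  have ind: "integrable M (indicator E :: _ \<Rightarrow> real)"
    using E by (intro integrable_real_indicator) (auto simp: emeasure_eq_measure)
  have int: "integrable M (\<lambda>\<omega>. c + d * indicator E \<omega>)" for c d :: real
    using ind by (intro Bochner_Integration.integrable_add integrable_const integrable_mult_right)
  have val: "(\<integral>\<omega>. c + d * indicator E \<omega> \<partial>M) = c + d * measure M E" for c d :: real
  proof -
    have "(\<integral>\<omega>. c + d * indicator E \<omega> \<partial>M) = (\<integral>\<omega>. c \<partial>M) + (\<integral>\<omega>. d * indicator E \<omega> \<partial>M)"
      using ind by (intro Bochner_Integration.integral_add integrable_const integrable_mult_right)
    also have "\<dots> = c + d * measure M E"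
      using E(1) by (simp add: prob_space)
    finally show ?thesis .
  qed
  let ?S = "{integral\<^sup>L M U | U. integrable M U \<and> (\<forall>\<omega>\<in>space M. Y \<omega> \<le> U \<omega>)}"
  have ge: "y - e - 2 * K * \<tau> \<le> s" if s: "s \<in> ?S" for s
  proof -
    from s obtain U where U: "integrable M U" "\<forall>\<omega>\<in>space M. Y \<omega> \<le> U \<omega>" "s = integral\<^sup>L M U"
      by blast
    have "(\<integral>\<omega>. (y - e) + (- 2 * K) * indicator E \<omega> \<partial>M) \<le> integral\<^sup>L M U"
    proof (intro integral_mono int U)
      fix \<omega> assume \<omega>: "\<omega> \<in> space M"
      have "Y \<omega> \<le> U \<omega>" using U \<omega> by blast
      then show "(y - e) + (- 2 * K) * indicator E \<omega> \<le> U \<omega>"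
        using bound[OF \<omega>] y close[of \<omega>] \<omega> e by (cases "\<omega> \<in> E") auto
    qed
    then have "y - e - 2 * K * measure M E \<le> s" unfolding val U(3) by simp
    moreover have "2 * K * measure M E \<le> 2 * K * \<tau>" using E K by (intro mult_left_mono) auto
    ultimately show ?thesis by simp
  qed
  have mem: "(\<integral>\<omega>. (y + e) + (2 * K) * indicator E \<omega> \<partial>M) \<in> ?S"
  proof -
    have "\<forall>\<omega>\<in>space M. Y \<omega> \<le> (y + e) + (2 * K) * indicator E \<omega>"
    proof
      fix \<omega> assume \<omega>: "\<omega> \<in> space M"
      show "Y \<omega> \<le> (y + e) + (2 * K) * indicator E \<omega>"
        using bound[OF \<omega>] y close[of \<omega>] \<omega> e by (cases "\<omega> \<in> E") auto
    qed
    then show ?thesis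
      unfolding mem_Collect_eq
      by (intro exI[of _ "\<lambda>\<omega>. (y + e) + (2 * K) * indicator E \<omega>"] conjI refl int)
  qed
  have "outer_expectation M Y \<le> (y + e) + (2 * K) * measure M E"
    unfolding outer_expectation_def
    unfolding val[symmetric] by (intro cInf_lower mem bdd_belowI[of _ "y - e - 2 * K * \<tau>"] ge)
  moreover have "2 * K * measure M E \<le> 2 * K * \<tau>" using E K by (intro mult_left_mono) auto
  moreover have "y - e - 2 * K * \<tau> \<le> outer_expectation M Y"
    unfolding outer_expectation_def using mem by (intro cInf_greatest ge) (rule ex_in_conv[THEN iffD1], rule exI)
  ultimately show ?thesis by linarith
qed

text \<open>Convergence in probability to a constant gives weak convergence to its point mass: the
  preimage under f of a small ball around \<open>f a\<close> is an open set containing a.\<close>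

lemma converges_weakly_return:
  assumes a: "a \<in> topspace T" and A: "\<And>n \<omega>. \<omega> \<in> space M \<Longrightarrow> A n \<omega> \<in> topspace T"
    and U: "\<And>U. openin T U \<Longrightarrow> a \<in> U \<Longrightarrow> whp M (\<lambda>n \<omega>. A n \<omega> \<in> U)"
  shows "converges_weakly T M A (return (borel_sets_of T) a)"
proof -
  have sub: "{U. openin T U} \<subseteq> Pow (topspace T)" by (auto dest: openin_subset)
  have sp: "space (borel_sets_of T) = topspace T"
    unfolding borel_sets_of_def by (rule space_measure_of[OF sub])
  have lim: "(\<lambda>n. outer_expectation M (\<lambda>\<omega>. f (A n \<omega>))) \<longlonglongrightarrow> integral\<^sup>L (return (borel_sets_of T) a) f"
    if f: "continuous_map T euclideanreal f" and bdd: "bounded (f ` topspace T)" for f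
  proof -
    have "f \<in> borel_measurable (borel_sets_of T)"
    proof (rule borel_measurableI)
      fix S :: "real set" assume "open S"
      then have "openin T {x \<in> topspace T. f x \<in> S}"
        using f by (auto simp: continuous_map_def)
      then show "f -` S \<inter> space (borel_sets_of T) \<in> sets (borel_sets_of T)"
        unfolding sp unfolding borel_sets_of_def
        by (auto simp: sets_measure_of[OF sub] vimage_def Int_def conj_commute intro!: sigma_sets.Basic)
    qed
    then have int: "integral\<^sup>L (return (borel_sets_of T) a) f = f a"
      by (intro integral_return) (simp_all add: sp a)
    obtain K where K: "\<And>x. x \<in> topspace T \<Longrightarrow> \<bar>f x\<bar> \<le> K" "0 < K"
      using bdd by (auto simp: bounded_pos)
    show ?thesis
      unfolding int
    proof (rule LIMSEQ_I)
      fix r :: real assume r: "0 < r"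
      define V where "V = {x \<in> topspace T. f x \<in> ball (f a) (r / 4)}"
      have "openin T V"
        unfolding V_def by (rule openin_continuous_map_preimage[OF f]) simp
      moreover have "a \<in> V" using a r by (simp add: V_def)
      ultimately have V: "whp M (\<lambda>n \<omega>. A n \<omega> \<in> V)" by (rule U)
      \<comment> \<open>With this exceptional probability the total error is at most
        \<open>r / 4 + 2 * K * (r / (8 * K)) = r / 2\<close>.\<close>
      have "0 < r / (8 * K)" using r K by simp
      then obtain N where N: "\<forall>n\<ge>N. \<exists>E\<in>sets M. measure M E \<le> r / (8 * K) \<and> (\<forall>\<omega>\<in>space M - E. A n \<omega> \<in> V)"
        using whpD[OF V, of "r / (8 * K)"] unfolding eventually_sequentially by blast
      have "norm (outer_expectation M (\<lambda>\<omega>. f (A n \<omega>)) - f a) < r" if n: "n \<ge> N" for n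
      proof -
        obtain E where E: "E \<in> sets M" "measure M E \<le> r / (8 * K)" "\<forall>\<omega>\<in>space M - E. A n \<omega> \<in> V"
          using N n by blast
        have "\<bar>outer_expectation M (\<lambda>\<omega>. f (A n \<omega>)) - f a\<bar> \<le> r / 4 + 2 * K * (r / (8 * K))"
        proof (rule outer_expectation_close[OF _ _ E(1,2)])
          fix \<omega> assume "\<omega> \<in> space M - E"
          then have "A n \<omega> \<in> V" using E by blast
          then have "dist (f a) (f (A n \<omega>)) < r / 4" by (simp add: V_def)
          then show "\<bar>f (A n \<omega>) - f a\<bar> \<le> r / 4" unfolding dist_real_def by linarith
        qed (use K A a r in auto)
        also have "\<dots> < r" using r K by simp
        finally show ?thesis by simp
      qed
      then show "\<exists>N. \<forall>n\<ge>N. norm (outer_expectation M (\<lambda>\<omega>. f (A n \<omega>)) - f a) < r" by blast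
    qed
  qed
  show ?thesis
    unfolding converges_weakly_def
    using A lim by (auto simp: sp a intro!: prob_space_return)
qed

end

subsection \<open>Approximate zeros of gradients and minimizers\<close>

text \<open>
  Below \<open>F\<close> plays the role of a gradient of \<open>f\<close>; only the subgradient inequality is used, so
  nothing has to be differentiated under an integral sign.
\<close>

lemma approx_gradient_at_minimizer:
  fixes A :: "real ^ 'd ^ 'd" and F :: "real ^ 'd \<Rightarrow> real ^ 'd"
  assumes sub: "\<And>u v. norm u \<le> R \<Longrightarrow> v \<in> S \<Longrightarrow> f v \<ge> f u + F u \<bullet> (v - u)"
    and lin: "\<And>u. norm u \<le> R \<Longrightarrow> norm (F u - (A *v u + b)) \<le> e"
    and ball: "cball 0 R \<subseteq> S"
    and u: "norm u < R" and min: "\<And>v. v \<in> S \<Longrightarrow> f u \<le> f v"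
  shows "norm (A *v u + b) \<le> e"
proof -
  \<comment> \<open>The descent direction of the linear model at u. The subgradient inequality is
    used at the displaced point \<open>u + t *\<^sub>R w\<close>, not at u: minimality of u forces
    \<open>F ?v \<bullet> w\<close> to be nonnegative, while the linear model makes it close to
    minus the squared norm of w.\<close>
  define w where "w = - (A *v u + b)"
  have uS: "u \<in> S" using u ball by auto
  have ev: "\<forall>\<^sub>F t in at_right 0. (norm w)\<^sup>2 \<le> e * norm w + t * (w \<bullet> (A *v w))"
  proof -
    have "((\<lambda>t. norm (u + t *\<^sub>R w)) \<longlongrightarrow> norm (u + 0 *\<^sub>R w)) (at_right 0)"
      by (intro tendsto_intros)
    then have "\<forall>\<^sub>F t in at_right 0. norm (u + t *\<^sub>R w) < R"
      by (rule order_tendstoD(2)) (use u in simp)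
    then show ?thesis
      using eventually_at_right_less[of 0]
    proof eventually_elim
      case (elim t)
      let ?v = "u + t *\<^sub>R w"
      have "f u \<ge> f ?v + F ?v \<bullet> (u - ?v)"
        using sub[of ?v u] elim uS by simp
      moreover have "f u \<le> f ?v" using elim ball by (intro min) auto
      ultimately have "0 \<le> t * (F ?v \<bullet> w)" by simp
      then have pos: "0 \<le> F ?v \<bullet> w" using elim by (simp add: zero_le_mult_iff)
      have "F ?v \<bullet> w - (A *v ?v + b) \<bullet> w \<le> e * norm w"
      proof -
        have "(F ?v - (A *v ?v + b)) \<bullet> w \<le> norm (F ?v - (A *v ?v + b)) * norm w"
          by (rule norm_cauchy_schwarz)
        also have "\<dots> \<le> e * norm w" using elim by (intro mult_right_mono lin) auto
        finally show ?thesis by (simp add: inner_diff_left)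
      qed
      moreover have "(A *v ?v + b) \<bullet> w = - (norm w)\<^sup>2 + t * (w \<bullet> (A *v w))"
      proof -
        have "A *v ?v + b = t *\<^sub>R (A *v w) - w"
          by (simp add: w_def matrix_vector_right_distrib matrix_vector_mult_scaleR)
        then show ?thesis
          by (simp add: inner_diff_left inner_diff_right dot_square_norm inner_commute)
      qed
      ultimately show ?case using pos by linarith
    qed
  qed
  have "((\<lambda>t. e * norm w + t * (w \<bullet> (A *v w))) \<longlongrightarrow> e * norm w + 0 * (w \<bullet> (A *v w))) (at_right 0)"
    by (intro tendsto_intros)
  from tendsto_lowerbound[OF this ev] have "(norm w)\<^sup>2 \<le> e * norm w" by simp
  then have "norm w * norm w \<le> e * norm w" by (simp add: power2_eq_square)
  moreover have "0 \<le> e" using lin[of u] u norm_ge_zero order_trans by (metis less_imp_le)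
  ultimately have "norm w \<le> e" by (cases "norm w = 0") auto
  then show ?thesis unfolding w_def norm_minus_cancel .
qed

text \<open>Along any ray from \<open>u0\<close> the slope is at least \<open>- e\<close> at the
  start and at least \<open>c * r / 2 - e\<close> at distance \<open>r / 2\<close>. Convexity
  propagates the latter outwards, so under \<open>4 * e < c * r\<close> every point of S at distance
  r or more is worse than \<open>u0\<close>. A minimum over the compact ball around
  \<open>u0\<close> is then a minimum over S.\<close>

lemma minimizer_near_approx_zero:
  fixes A :: "real ^ 'd ^ 'd" and F :: "real ^ 'd \<Rightarrow> real ^ 'd"
  assumes sub: "\<And>u v. norm u \<le> R \<Longrightarrow> v \<in> S \<Longrightarrow> f v \<ge> f u + F u \<bullet> (v - u)"
    and lin: "\<And>u. norm u \<le> R \<Longrightarrow> norm (F u - (A *v u + b)) \<le> e"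
    and ball: "cball 0 R \<subseteq> S"
    and pd: "\<And>v. c * (norm v)\<^sup>2 \<le> v \<bullet> (A *v v)"
    and zero: "A *v u0 + b = 0" and r: "0 < r" "norm u0 + r \<le> R" and e: "4 * e < c * r"
  shows "\<exists>u\<in>S. \<forall>v\<in>S. f u \<le> f v"
    and "\<And>u. u \<in> S \<Longrightarrow> (\<And>v. v \<in> S \<Longrightarrow> f u \<le> f v) \<Longrightarrow> norm (u - u0) < r"
proof -
  have far: "f u0 < f v" if v: "v \<in> S" "r \<le> norm (v - u0)" for v
  proof -
    define s where "s = norm (v - u0)"
    define d where "d = (v - u0) /\<^sub>R s"
    have s: "r \<le> s" "0 < s" using v r by (auto simp: s_def)
    have d: "norm d = 1" and vd: "v - u0 = s *\<^sub>R d"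
      using s by (auto simp: d_def s_def)
    \<comment> \<open>The midpoint balances the two estimates: at most \<open>(r / 2) * e\<close> is
      lost up to m, and at least \<open>(r / 2) * (c * r / 2 - e)\<close> is gained from m to
      v.\<close>
    define m where "m = u0 + (r / 2) *\<^sub>R d"
    have nm: "norm m \<le> R"
      using norm_triangle_ineq[of u0 "(r / 2) *\<^sub>R d"] d r by (simp add: m_def)
    have n0: "norm u0 \<le> R" using r by simp
    have Fm: "c * r / 2 - e \<le> F m \<bullet> d"
    proof -
      have "A *v m + b = (r / 2) *\<^sub>R (A *v d)"
        using zero by (simp add: m_def matrix_vector_right_distrib matrix_vector_mult_scaleR add.commute add.left_commute)
      then have "(A *v m + b) \<bullet> d = (r / 2) * (d \<bullet> (A *v d))" by (simp add: inner_commute)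
      moreover have "c \<le> d \<bullet> (A *v d)" using pd[of d] d by simp
      then have "r / 2 * c \<le> (r / 2) * (d \<bullet> (A *v d))" using r by (intro mult_left_mono) auto
      moreover have "\<bar>(F m - (A *v m + b)) \<bullet> d\<bar> \<le> e"
        using Cauchy_Schwarz_ineq2[of "F m - (A *v m + b)" d] d lin[OF nm] by simp
      then have "(A *v m + b) \<bullet> d - e \<le> F m \<bullet> d" by (simp add: inner_diff_left)
      ultimately show ?thesis by (simp add: mult.commute)
    qed
    have F0: "- e \<le> F u0 \<bullet> d"
      using Cauchy_Schwarz_ineq2[of "F u0" d] d lin[OF n0] zero by simp
    have "f v \<ge> f m + F m \<bullet> (v - m)" by (rule sub[OF nm v(1)])
    moreover have "v - m = (v - u0) - (r / 2) *\<^sub>R d" by (simp add: m_def)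
    then have "F m \<bullet> (v - m) = (s - r / 2) * (F m \<bullet> d)"
      by (simp add: vd inner_diff_right left_diff_distrib)
    moreover have "(r / 2) * (c * r / 2 - e) \<le> (s - r / 2) * (F m \<bullet> d)"
    proof (rule mult_mono)
      have "0 \<le> e" using norm_ge_zero lin[OF n0] by (rule order_trans)
      then show "0 \<le> c * r / 2 - e" using e by linarith
    qed (use Fm s r in linarith)+
    moreover have "f m \<ge> f u0 + F u0 \<bullet> (m - u0)"
      using nm ball by (intro sub[OF n0]) auto
    moreover have "(r / 2) * (- e) \<le> (r / 2) * (F u0 \<bullet> d)"
      using F0 r by (intro mult_left_mono) auto
    then have "F u0 \<bullet> (m - u0) \<ge> (r / 2) * (- e)" by (simp add: m_def)
    moreover have "0 < (r / 2) * (c * r / 2 - 2 * e)" using r e by (intro mult_pos_pos) linarith+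
    ultimately show ?thesis by (simp add: algebra_simps)
  qed
  have sub0: "cball u0 r \<subseteq> cball 0 R"
  proof
    fix x assume "x \<in> cball u0 r"
    then show "x \<in> cball 0 R"
      using norm_triangle_ineq[of u0 "x - u0"] r by (simp add: dist_norm norm_minus_commute)
  qed
  \<comment> \<open>Bounded subgradients make f Lipschitz on the ball, which supplies the continuity
    for attaining a minimum.\<close>
  obtain G where G: "\<And>u. norm u \<le> R \<Longrightarrow> norm (F u) \<le> G" "0 \<le> G"
  proof
    fix u :: "real ^ 'd" assume u: "norm u \<le> R"
    have "norm (F u) \<le> norm (F u - (A *v u + b)) + (norm (A *v u) + norm b)"
      using norm_triangle_sub[of "F u" "A *v u + b"] norm_triangle_ineq[of "A *v u" b] by linarith
    also have "\<dots> \<le> e + (norm A * R + norm b)"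
      using lin[OF u] norm_mult_vec_le_norm[of A u] mult_left_mono[OF u, of "norm A"] by simp
    finally show "norm (F u) \<le> \<bar>e + (norm A * R + norm b)\<bar>" by linarith
  qed simp
  have lip: "\<bar>f u - f v\<bar> \<le> G * dist u v" if u: "norm u \<le> R" and v: "norm v \<le> R" for u v
  proof -
    have le: "f u - f v \<le> G * dist u v" if u: "norm u \<le> R" and v: "norm v \<le> R" for u v
    proof -
      have "f v \<ge> f u + F u \<bullet> (v - u)" using v ball by (intro sub[OF u]) auto
      moreover have "- (F u \<bullet> (v - u)) \<le> norm (F u) * norm (v - u)"
        using Cauchy_Schwarz_ineq2[of "F u" "v - u"] by linarith
      moreover have "norm (F u) * norm (v - u) \<le> G * norm (v - u)"
        using G u by (intro mult_right_mono) auto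
      ultimately show ?thesis by (simp add: dist_norm norm_minus_commute)
    qed
    show ?thesis using le[OF u v] le[OF v u] by (simp add: dist_commute)
  qed
  have "continuous_on (cball u0 r) f"
  proof (rule continuous_onI)
    fix x e' assume x: "x \<in> cball u0 r" and e': "(0::real) < e'"
    show "\<exists>d>0. \<forall>x'\<in>cball u0 r. dist x' x < d \<longrightarrow> dist (f x') (f x) \<le> e'"
    proof (intro exI conjI ballI impI)
      show "0 < e' / (G + 1)" using e' G by simp
      fix x' assume x': "x' \<in> cball u0 r" "dist x' x < e' / (G + 1)"
      have "\<bar>f x' - f x\<bar> \<le> G * dist x' x" using x x' sub0 by (intro lip) auto
      also have "\<dots> \<le> (G + 1) * dist x' x" by (simp add: algebra_simps)
      also have "\<dots> \<le> e'" using x' G by (simp add: field_simps)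
      finally show "dist (f x') (f x) \<le> e'" by (simp add: dist_real_def)
    qed
  qed
  moreover have "cball u0 r \<noteq> {}" using r by auto
  ultimately obtain u where u: "u \<in> cball u0 r" "\<forall>v\<in>cball u0 r. f u \<le> f v"
    using continuous_attains_inf[of "cball u0 r" f] by auto
  have "f u \<le> f v" if v: "v \<in> S" for v
  proof (cases "v \<in> cball u0 r")
    case True
    then show ?thesis using u by blast
  next
    case False
    then have "f u0 < f v" using v by (intro far) (auto simp: dist_norm norm_minus_commute)
    moreover have "f u \<le> f u0" using u r by auto
    ultimately show ?thesis by simp
  qed
  then show "\<exists>u\<in>S. \<forall>v\<in>S. f u \<le> f v" using u sub0 ball by blast
  fix u assume u: "u \<in> S" "\<And>v. v \<in> S \<Longrightarrow> f u \<le> f v"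
  have "u0 \<in> S" using ball r by auto
  then have "f u \<le> f u0" by (rule u)
  then show "norm (u - u0) < r" using far[of u] u(1) by (meson not_le)
qed

section \<open>Quadratic lower bounds and solvability of linear systems\<close>

lemma pos_def_lower_bound:
  assumes "pos_def A"
  obtains c where "0 < c" "\<And>v. c * (norm v)\<^sup>2 \<le> v \<bullet> (A *v v)"
proof -
  let ?S = "sphere (0 :: real ^ 'a) 1"
  have "continuous_on ?S (\<lambda>v. v \<bullet> (A *v v))"
    by (intro continuous_intros linear_continuous_on) auto
  moreover have "?S \<noteq> {}" using vector_choose_size[of 1, where 'a="real ^ 'a"] by auto
  ultimately obtain w where w: "w \<in> ?S" "\<forall>v\<in>?S. w \<bullet> (A *v w) \<le> v \<bullet> (A *v v)"
    using continuous_attains_inf[of ?S "\<lambda>v. v \<bullet> (A *v v)"] by auto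
  show thesis
  proof
    have "w \<noteq> 0" using w by auto
    then show "0 < w \<bullet> (A *v w)" using assms by (simp add: pos_def_def)
    fix v
    show "w \<bullet> (A *v w) * (norm v)\<^sup>2 \<le> v \<bullet> (A *v v)"
    proof (cases "v = 0")
      case False
      then have "w \<bullet> (A *v w) \<le> (inverse (norm v) *\<^sub>R v) \<bullet> (A *v (inverse (norm v) *\<^sub>R v))"
        by (intro w(2)[rule_format]) simp
      also have "\<dots> = (v \<bullet> (A *v v)) / (norm v)\<^sup>2"
        unfolding matrix_vector_mult_scaleR inner_scaleR_left inner_scaleR_right
        by (simp add: power2_eq_square divide_inverse)
      finally show ?thesis using False by (simp add: field_simps)
    qed simp
  qed
qed

text \<open>Stated for a quadratic lower bound instead of \<open>pos_def\<close>, because it is also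
  applied to matrices that are merely close to the mean Hessian and may fail to be
  symmetric.\<close>

lemma solve_of_lower_bound:
  fixes A :: "real ^ 'd ^ 'd"
  assumes "0 < c" "\<And>v. c * (norm v)\<^sup>2 \<le> v \<bullet> (A *v v)"
  obtains u where "A *v u = b"
proof -
  have "inj ((*v) A)"
  proof (rule injI)
    fix v w assume "A *v v = A *v w"
    then have "A *v (v - w) = 0" by (simp add: matrix_vector_mult_diff_distrib)
    then have "c * (norm (v - w))\<^sup>2 \<le> 0" using assms(2)[of "v - w"] by simp
    then have "(norm (v - w))\<^sup>2 \<le> 0" using assms(1) by (simp only: mult_le_0_iff) auto
    then show "v = w" by simp
  qed
  then have "surj ((*v) A)" by (intro linear_injective_imp_surjective) auto
  then show thesis using that by (metis surjD)
qed

lemma norm_le_of_lower_bound: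
  fixes A :: "real ^ 'd ^ 'd"
  assumes "0 < c" "\<And>v. c * (norm v)\<^sup>2 \<le> v \<bullet> (A *v v)"
  shows "c * norm v \<le> norm (A *v v)"
proof (cases "v = 0")
  case False
  have "c * (norm v)\<^sup>2 \<le> norm v * norm (A *v v)"
    using assms(2)[of v] norm_cauchy_schwarz[of v "A *v v"] by simp
  then show ?thesis using False by (simp add: power2_eq_square mult.assoc mult.left_commute)
qed simp

subsection \<open>Calculus for the loss\<close>

lemma gradient_works:
  assumes "f differentiable F"
  shows "(f has_derivative (\<lambda>w. gradient f F \<bullet> w)) F"
proof -
  have d: "(f has_derivative frechet_derivative f F) F"
    using assms by (simp add: frechet_derivative_works)
  then have lin: "linear (frechet_derivative f F)" by (rule has_derivative_linear)
  have "frechet_derivative f F w = gradient f F \<bullet> w" for w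
  proof -
    have "frechet_derivative f F w = frechet_derivative f F (\<Sum>i\<in>UNIV. w $ i *\<^sub>R axis i 1)"
      by (simp add: basis_expansion flip: scalar_mult_eq_scaleR)
    also have "\<dots> = gradient f F \<bullet> w"
      by (simp add: linear_sum[OF lin] linear_scale[OF lin] gradient_def inner_vec_def mult.commute)
    finally show ?thesis .
  qed
  then show ?thesis using d by (metis ext)
qed

lemma gradient_at:
  assumes "(f has_derivative f') (at x)"
  shows "gradient f (at x) = (\<chi> i. f' (axis i 1))"
  using frechet_derivative_at[OF assms] by (simp add: gradient_def)

lemma has_derivative_vec_lambda:
  fixes f :: "'k::finite \<Rightarrow> 'a::real_normed_vector \<Rightarrow> real"
  assumes "\<And>i. (f i has_derivative f' i) (at a within S)"
  shows "((\<lambda>x. \<chi> i. f i x) has_derivative (\<lambda>h. \<chi> i. f' i h)) (at a within S)"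
  using assms
  by (subst has_derivative_componentwise_within) (auto simp: Basis_vec_def inner_axis)

text \<open>Convexity bounds the difference quotients on the segment from \<beta> to b by
  \<open>f b - f \<beta>\<close>; the bound passes to their limit from the right.\<close>

lemma convex_on_above_gradient:
  fixes f :: "real ^ 'k \<Rightarrow> real"
  assumes conv: "convex_on B f" and d: "(f has_derivative (\<lambda>w. g \<bullet> w)) (at \<beta>)"
    and \<beta>: "\<beta> \<in> B" and b: "b \<in> B"
  shows "f \<beta> + g \<bullet> (b - \<beta>) \<le> f b"
proof -
  let ?\<phi> = "\<lambda>t::real. f (\<beta> + t *\<^sub>R (b - \<beta>))"
  have 1: "((\<lambda>t::real. \<beta> + t *\<^sub>R (b - \<beta>)) has_derivative (\<lambda>t. t *\<^sub>R (b - \<beta>))) (at 0)"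
    by (auto intro!: derivative_eq_intros)
  have "(?\<phi> has_derivative (\<lambda>t. g \<bullet> (t *\<^sub>R (b - \<beta>)))) (at 0)"
    by (rule has_derivative_compose[OF 1]) (use d in simp)
  then have "(?\<phi> has_field_derivative (g \<bullet> (b - \<beta>))) (at 0)"
    by (simp add: has_field_derivative_def mult_commute_abs)
  then have "((\<lambda>t. (?\<phi> t - f \<beta>) / t) \<longlongrightarrow> g \<bullet> (b - \<beta>)) (at 0)"
    by (simp add: DERIV_def)
  then have lim: "((\<lambda>t. (?\<phi> t - f \<beta>) / t) \<longlongrightarrow> g \<bullet> (b - \<beta>)) (at_right 0)"
    by (rule filterlim_mono[OF _ order_refl]) (simp add: at_within_le_at)
  have "\<forall>\<^sub>F t in at_right 0. t < (1::real)" by (rule order_tendstoD(2)[OF tendsto_ident_at]) simp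
  then have "\<forall>\<^sub>F t in at_right 0. (?\<phi> t - f \<beta>) / t \<le> f b - f \<beta>"
    using eventually_at_right_less[of 0]
  proof eventually_elim
    case (elim t)
    have "\<beta> + t *\<^sub>R (b - \<beta>) = (1 - t) *\<^sub>R \<beta> + t *\<^sub>R b" by (simp add: algebra_simps)
    then have "?\<phi> t \<le> (1 - t) * f \<beta> + t * f b"
      using convex_onD[OF conv, of t \<beta> b] elim \<beta> b by simp
    then have "?\<phi> t - f \<beta> \<le> (f b - f \<beta>) * t" by (simp add: algebra_simps)
    then show ?case using elim by (simp add: pos_divide_le_eq)
  qed
  from tendsto_upperbound[OF lim this] show ?thesis by simp
qed

locale smooth_loss =
  fixes B :: "(real ^ 'd) set" and l :: "real ^ 'm \<Rightarrow> real ^ 'd \<Rightarrow> real"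
  assumes smooth: "loss_smooth_convex B l"
begin

lemma derivatives:
  "\<exists>(f' :: (real ^ 'm) \<times> (real ^ 'd) \<Rightarrow> ((real ^ 'm) \<times> (real ^ 'd)) \<Rightarrow>\<^sub>L real)
    (f'' :: (real ^ 'm) \<times> (real ^ 'd) \<Rightarrow> ((real ^ 'm) \<times> (real ^ 'd)) \<Rightarrow>\<^sub>L ((real ^ 'm) \<times> (real ^ 'd)) \<Rightarrow>\<^sub>L real).
    (\<forall>z\<in>UNIV \<times> B. ((\<lambda>(x, \<beta>). l x \<beta>) has_derivative blinfun_apply (f' z)) (at z within UNIV \<times> B)) \<and>
    (\<forall>z\<in>UNIV \<times> B. (f' has_derivative blinfun_apply (f'' z)) (at z within UNIV \<times> B)) \<and>
    continuous_on (UNIV \<times> B) f''"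
  using smooth unfolding loss_smooth_convex_def C2_on_def by (rule conjunct1)

lemma param_slice: "((\<lambda>b. (x :: real ^ 'm, b :: real ^ 'd)) has_derivative (\<lambda>w. (0, w))) (at \<beta>)"
  by (auto intro!: derivative_eq_intros)

lemma data_slice: "((\<lambda>y. (y :: real ^ 'm, \<beta> :: real ^ 'd)) has_derivative (\<lambda>v. (v, 0))) (at x)"
  by (auto intro!: derivative_eq_intros)

lemma at_within_B: "\<beta> \<in> interior B \<Longrightarrow> at \<beta> within B = at \<beta>"
  by (rule at_within_interior)

lemma at_within_UNIV_Times_B: "\<beta> \<in> interior B \<Longrightarrow> at (x, \<beta>) within UNIV \<times> B = at (x, \<beta>)"
  by (rule at_within_interior) (simp add: interior_Times)

lemma loss_has_derivative_param:
  assumes \<beta>: "\<beta> \<in> interior B"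
  shows "(l x has_derivative (\<lambda>w. dbeta l B x \<beta> \<bullet> w)) (at \<beta>)"
proof -
  from derivatives obtain f' f'' where
    f1: "\<forall>z\<in>UNIV \<times> B. ((\<lambda>(x, \<beta>). l x \<beta>) has_derivative blinfun_apply (f' z)) (at z within UNIV \<times> B)" and
    f2: "\<forall>z\<in>UNIV \<times> B. (f' has_derivative blinfun_apply (f'' z)) (at z within UNIV \<times> B)" and
    cont: "continuous_on (UNIV \<times> B) f''"
    by (elim exE conjE)
  have f': "((\<lambda>(x, \<beta>). l x \<beta>) has_derivative blinfun_apply (f' (x, \<beta>))) (at (x, \<beta>) within UNIV \<times> B)"
    and f'': "(f' has_derivative blinfun_apply (f'' (x, \<beta>))) (at (x, \<beta>) within UNIV \<times> B)"
    if "\<beta> \<in> B" for x \<beta>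
    using f1[rule_format, of "(x, \<beta>)"] f2[rule_format, of "(x, \<beta>)"] that by simp_all
  have "((\<lambda>(x, \<beta>). l x \<beta>) has_derivative blinfun_apply (f' (x, \<beta>))) (at (x, \<beta>))"
    using f'[OF subsetD[OF interior_subset \<beta>], of x] by (simp only: at_within_UNIV_Times_B[OF \<beta>])
  from has_derivative_compose[OF param_slice this]
  have "(l x has_derivative (\<lambda>w. f' (x, \<beta>) (0, w))) (at \<beta>)"
    by simp
  then have "l x differentiable at \<beta>" by (auto simp: differentiable_def)
  then show ?thesis unfolding dbeta_def at_within_B[OF \<beta>] by (rule gradient_works)
qed

lemma loss_above_tangent:
  assumes "\<beta> \<in> interior B" "b \<in> B"
  shows "l x \<beta> + dbeta l B x \<beta> \<bullet> (b - \<beta>) \<le> l x b"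
  using smooth assms interior_subset[of B] loss_has_derivative_param[OF assms(1), of x]
  by (intro convex_on_above_gradient[where B=B]) (auto simp: loss_smooth_convex_def)

text \<open>The score is the parameter part of the first derivative of the loss, so its joint
  derivative G is read off the second derivative. Continuity of G in x for fixed direction is what
  later makes \<open>dx_h\<close> continuous and thus measurable.\<close>

lemma score_derivatives:
  "\<exists>G :: (real ^ 'm) \<times> (real ^ 'd) \<Rightarrow> ((real ^ 'm) \<times> (real ^ 'd)) \<Rightarrow> real ^ 'd.
    (\<forall>x. \<forall>\<beta>\<in>interior B. ((\<lambda>(x, \<beta>). dbeta l B x \<beta>) has_derivative G (x, \<beta>)) (at (x, \<beta>))) \<and>
    (\<forall>v. \<forall>\<beta>\<in>interior B. continuous_on UNIV (\<lambda>x. G (x, \<beta>) v))"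
proof -
  from derivatives obtain f' f'' where
    f1: "\<forall>z\<in>UNIV \<times> B. ((\<lambda>(x, \<beta>). l x \<beta>) has_derivative blinfun_apply (f' z)) (at z within UNIV \<times> B)" and
    f2: "\<forall>z\<in>UNIV \<times> B. (f' has_derivative blinfun_apply (f'' z)) (at z within UNIV \<times> B)" and
    cont: "continuous_on (UNIV \<times> B) f''"
    by (elim exE conjE)
  have f': "((\<lambda>(x, \<beta>). l x \<beta>) has_derivative blinfun_apply (f' (x, \<beta>))) (at (x, \<beta>) within UNIV \<times> B)"
    and f'': "(f' has_derivative blinfun_apply (f'' (x, \<beta>))) (at (x, \<beta>) within UNIV \<times> B)"
    if "\<beta> \<in> B" for x \<beta>
    using f1[rule_format, of "(x, \<beta>)"] f2[rule_format, of "(x, \<beta>)"] that by simp_all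
  define G where "G z h = (\<chi> i. blinfun_apply (blinfun_apply (f'' z) h) (0, axis i 1))" for z h
  show ?thesis
  proof (intro exI[of _ G] conjI ballI allI)
    fix x :: "real ^ 'm" and \<beta> assume \<beta>: "\<beta> \<in> interior B"
    then have \<beta>B: "\<beta> \<in> B" using interior_subset[of B] by auto
    have dbeta: "dbeta l B y b = (\<chi> i. f' (y, b) (0, axis i 1))" if b: "b \<in> interior B" for y b
    proof -
      have "((\<lambda>(x, \<beta>). l x \<beta>) has_derivative blinfun_apply (f' (y, b))) (at (y, b))"
        using f'[OF subsetD[OF interior_subset b], of y] by (simp only: at_within_UNIV_Times_B[OF b])
      from has_derivative_compose[OF param_slice this]
      have "(l y has_derivative (\<lambda>w. f' (y, b) (0, w))) (at b)" by simp
      then show ?thesis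
        unfolding dbeta_def at_within_B[OF b] by (rule gradient_at)
    qed
    have "(f' has_derivative blinfun_apply (f'' (x, \<beta>))) (at (x, \<beta>))"
      using f''[OF \<beta>B, of x] by (simp add: at_within_UNIV_Times_B[OF \<beta>])
    then have "((\<lambda>z. blinfun_apply (f' z) (0, axis i 1)) has_derivative
        (\<lambda>h. blinfun_apply (blinfun_apply (f'' (x, \<beta>)) h) (0, axis i 1))) (at (x, \<beta>))" for i
      by (rule bounded_linear.has_derivative[OF blinfun.bounded_linear_left])
    then have "((\<lambda>z. \<chi> i. blinfun_apply (f' z) (0, axis i 1)) has_derivative G (x, \<beta>)) (at (x, \<beta>))"
      unfolding G_def by (rule has_derivative_vec_lambda)
    then show "((\<lambda>(x, \<beta>). dbeta l B x \<beta>) has_derivative G (x, \<beta>)) (at (x, \<beta>))"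
      by (rule has_derivative_transform_within_open[where s="UNIV \<times> interior B"])
         (use \<beta> in \<open>auto simp: dbeta intro!: open_Times\<close>)
  next
    fix \<beta> v assume "\<beta> \<in> interior B"
    then have "\<beta> \<in> B" using interior_subset[of B] by auto
    then have "continuous_on UNIV (\<lambda>x. f'' (x, \<beta>))"
      by (intro continuous_on_compose2[OF cont]) (auto intro!: continuous_intros)
    then show "continuous_on UNIV (\<lambda>x. G (x, \<beta>) v)"
      unfolding G_def by (intro continuous_intros)
  qed
qed

lemma score_has_derivative:
  assumes \<beta>: "\<beta> \<in> interior B"
  shows "((\<lambda>y. dbeta l B y \<beta>) has_derivative (\<lambda>v. dx_h l B x \<beta> *v v)) (at x)"
    and "(dbeta l B x has_derivative (\<lambda>v. dbeta_h l B x \<beta> *v v)) (at \<beta>)"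
proof -
  from score_derivatives obtain G where
    G0: "\<forall>x. \<forall>\<beta>\<in>interior B. ((\<lambda>(x, \<beta>). dbeta l B x \<beta>) has_derivative G (x, \<beta>)) (at (x, \<beta>))" and
    cont0: "\<forall>v. \<forall>\<beta>\<in>interior B. continuous_on UNIV (\<lambda>x. G (x, \<beta>) v)"
    by (elim exE conjE)
  note G = G0[rule_format] and cont = cont0[rule_format]
  have "((\<lambda>y. dbeta l B y \<beta>) has_derivative (\<lambda>v. G (x, \<beta>) (v, 0))) (at x)"
    using has_derivative_compose[OF data_slice G[OF \<beta>]] by simp
  then have "(\<lambda>y. dbeta l B y \<beta>) differentiable at x" by (auto simp: differentiable_def)
  then show "((\<lambda>y. dbeta l B y \<beta>) has_derivative (\<lambda>v. dx_h l B x \<beta> *v v)) (at x)"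
    unfolding dx_h_def by (simp add: jacobian_works)
  have "(dbeta l B x has_derivative (\<lambda>v. G (x, \<beta>) (0, v))) (at \<beta>)"
    using has_derivative_compose[OF param_slice G[OF \<beta>]] by simp
  then have "dbeta l B x differentiable at \<beta>" by (auto simp: differentiable_def)
  then show "(dbeta l B x has_derivative (\<lambda>v. dbeta_h l B x \<beta> *v v)) (at \<beta>)"
    unfolding dbeta_h_def at_within_B[OF \<beta>] by (simp add: jacobian_works)
qed

lemma continuous_dx_h:
  assumes \<beta>: "\<beta> \<in> interior B"
  shows "continuous_on UNIV (\<lambda>x. dx_h l B x \<beta>)"
proof -
  from score_derivatives obtain G where
    G0: "\<forall>x. \<forall>\<beta>\<in>interior B. ((\<lambda>(x, \<beta>). dbeta l B x \<beta>) has_derivative G (x, \<beta>)) (at (x, \<beta>))" and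
    cont0: "\<forall>v. \<forall>\<beta>\<in>interior B. continuous_on UNIV (\<lambda>x. G (x, \<beta>) v)"
    by (elim exE conjE)
  note G = G0[rule_format] and cont = cont0[rule_format]
  have "dx_h l B x \<beta> *v v = G (x, \<beta>) (v, 0)" for x v
  proof -
    have "((\<lambda>y. dbeta l B y \<beta>) has_derivative (\<lambda>v. G (x, \<beta>) (v, 0))) (at x)"
      using has_derivative_compose[OF data_slice G[OF \<beta>]] by simp
    from has_derivative_unique[OF score_has_derivative(1)[OF \<beta>] this] show ?thesis by metis
  qed
  then have "dx_h l B x \<beta> $ i $ j = G (x, \<beta>) (axis j 1, 0) $ i" for x i j
    by (metis matrix_vector_mul_component cart_eq_inner_axis)
  then have eq: "(\<lambda>x. dx_h l B x \<beta>) = (\<lambda>x. \<chi> i j. G (x, \<beta>) (axis j 1, 0) $ i)"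
    by (simp add: vec_eq_iff fun_eq_iff)
  show ?thesis unfolding eq by (intro continuous_intros cont \<beta>)
qed

lemma continuous_score:
  assumes "\<beta> \<in> interior B"
  shows "continuous_on UNIV (\<lambda>x. dbeta l B x \<beta>)"
  using score_has_derivative(1)[OF assms]
  by (intro has_derivative_continuous_on) (auto simp: has_derivative_at_withinI)

text \<open>A bounded second derivative in x makes the gradient Lipschitz and the loss at most
  quadratic. Hence the risk is finite under every distribution with finite second moment, for each
  \<beta> in B.\<close>

lemma loss_quadratic_growth:
  assumes \<beta>: "\<beta> \<in> B" and p: "1 \<le> p" and K: "\<And>x. mat_lp_norm p (dxx l x \<beta>) \<le> K"
  shows "\<exists>A. \<forall>x. \<bar>l x \<beta>\<bar> \<le> A * (1 + (norm x)\<^sup>2)"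
    and "continuous_on UNIV (\<lambda>x. l x \<beta>)"
proof -
  from derivatives obtain f' f'' where
    f1: "\<forall>z\<in>UNIV \<times> B. ((\<lambda>(x, \<beta>). l x \<beta>) has_derivative blinfun_apply (f' z)) (at z within UNIV \<times> B)" and
    f2: "\<forall>z\<in>UNIV \<times> B. (f' has_derivative blinfun_apply (f'' z)) (at z within UNIV \<times> B)" and
    cont: "continuous_on (UNIV \<times> B) f''"
    by (elim exE conjE)
  have f': "((\<lambda>(x, \<beta>). l x \<beta>) has_derivative blinfun_apply (f' (x, \<beta>))) (at (x, \<beta>) within UNIV \<times> B)"
    and f'': "(f' has_derivative blinfun_apply (f'' (x, \<beta>))) (at (x, \<beta>) within UNIV \<times> B)"
    if "\<beta> \<in> B" for x \<beta>
    using f1[rule_format, of "(x, \<beta>)"] f2[rule_format, of "(x, \<beta>)"] that by simp_all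
  \<comment> \<open>Here \<beta> may lie on the boundary of B, where only derivatives relative to
    \<open>UNIV \<times> B\<close> are given. Restricted to the slice with fixed \<beta>, they
    become ordinary derivatives in the observation.\<close>
  have sub: "((\<lambda>(x, \<beta>). l x \<beta>) has_derivative blinfun_apply (f' (x, \<beta>))) (at (x, \<beta>) within (\<lambda>y. (y, \<beta>)) ` UNIV)"
      "(f' has_derivative blinfun_apply (f'' (x, \<beta>))) (at (x, \<beta>) within (\<lambda>y. (y, \<beta>)) ` UNIV)" for x
    by (rule has_derivative_subset[OF f'[OF \<beta>]] has_derivative_subset[OF f''[OF \<beta>]], use \<beta> in blast)+
  have d1: "((\<lambda>y. l y \<beta>) has_derivative (\<lambda>v. f' (x, \<beta>) (v, 0))) (at x)" for x
    using has_derivative_in_compose[OF data_slice[of \<beta> x] sub(1)[of x]] by simp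
  have d2: "((\<lambda>y. f' (y, \<beta>)) has_derivative (\<lambda>v. f'' (x, \<beta>) (v, 0))) (at x)" for x
    using has_derivative_in_compose[OF data_slice[of \<beta> x] sub(2)[of x]] by simp
  have dx: "dx l y \<beta> = (\<chi> i. f' (y, \<beta>) (axis i 1, 0))" for y
    unfolding dx_def by (rule gradient_at[OF d1])
  have grad: "((\<lambda>y. l y \<beta>) has_derivative (\<lambda>v. dx l x \<beta> \<bullet> v)) (at x)" for x
    unfolding dx_def using d1 by (intro gradient_works) (auto simp: differentiable_def)
  have "((\<lambda>y. dx l y \<beta>) has_derivative (\<lambda>v. \<chi> i. f'' (x, \<beta>) (v, 0) (axis i 1, 0))) (at x)" for x
    unfolding dx
    by (rule has_derivative_vec_lambda bounded_linear.has_derivative[OF blinfun.bounded_linear_left d2])+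
  then have jac: "((\<lambda>y. dx l y \<beta>) has_derivative (\<lambda>v. dxx l x \<beta> *v v)) (at x)" for x
    unfolding dxx_def jacobian_works[symmetric] by (auto simp: differentiable_def)
  define K' where "K' = real CARD('m) * real CARD('m) * K"
  have lip: "norm (dx l x \<beta>) \<le> norm (dx l 0 \<beta>) + K' * norm x" for x
  proof -
    have "norm (dx l x \<beta> - dx l 0 \<beta>) \<le> K' * norm (x - 0)"
    proof (rule differentiable_bound[OF convex_UNIV])
      show "onorm (\<lambda>v. dxx l y \<beta> *v v) \<le> K'" for y
        unfolding K'_def by (rule onorm_le) (rule norm_mult_vec_le_mat_lp_norm[OF p K])
    qed (use jac in auto)
    then show ?thesis using norm_triangle_sub[of "dx l x \<beta>" "dx l 0 \<beta>"] by simp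
  qed
  define a where "a = norm (dx l 0 \<beta>)"
  have a: "0 \<le> a" by (simp add: a_def)
  have growth: "\<bar>l x \<beta>\<bar> \<le> \<bar>l 0 \<beta>\<bar> + (a + \<bar>K'\<bar> * norm x) * norm x" for x
  proof -
    have "norm (l x \<beta> - l 0 \<beta>) \<le> (a + \<bar>K'\<bar> * norm x) * norm (x - 0)"
    proof (rule differentiable_bound[OF convex_cball[of 0 "norm x"]])
      fix y :: "real ^ 'm" assume y: "y \<in> cball 0 (norm x)"
      show "((\<lambda>x. l x \<beta>) has_derivative (\<lambda>v. dx l y \<beta> \<bullet> v)) (at y within cball 0 (norm x))"
        by (rule has_derivative_at_withinI[OF grad])
      have "norm (dx l y \<beta> \<bullet> v) \<le> (a + \<bar>K'\<bar> * norm x) * norm v" for v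
      proof -
        have "norm (dx l y \<beta> \<bullet> v) \<le> norm (dx l y \<beta>) * norm v"
          by (simp add: Cauchy_Schwarz_ineq2)
        moreover have "K' * norm y \<le> \<bar>K'\<bar> * norm x" using y by (intro mult_mono) auto
        then have "norm (dx l y \<beta>) \<le> a + \<bar>K'\<bar> * norm x" using lip[of y] by (simp add: a_def)
        then have "norm (dx l y \<beta>) * norm v \<le> (a + \<bar>K'\<bar> * norm x) * norm v"
          by (intro mult_right_mono) auto
        ultimately show ?thesis by linarith
      qed
      then show "onorm (\<lambda>v. dx l y \<beta> \<bullet> v) \<le> a + \<bar>K'\<bar> * norm x" by (rule onorm_le)
    qed auto
    then show ?thesis by simp
  qed
  have "\<bar>l x \<beta>\<bar> \<le> (\<bar>l 0 \<beta>\<bar> + a + \<bar>K'\<bar>) * (1 + (norm x)\<^sup>2)" for x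
  proof -
    have n: "norm x \<le> 1 + (norm x)\<^sup>2"
      using zero_le_power2[of "norm x - 1"] norm_ge_zero[of x] unfolding power2_diff one_power2 mult_1_right by linarith
    have "a * norm x \<le> a * (1 + (norm x)\<^sup>2)" using n a by (intro mult_left_mono) auto
    moreover have "\<bar>K'\<bar> * (norm x)\<^sup>2 \<le> \<bar>K'\<bar> * (1 + (norm x)\<^sup>2)" by (intro mult_left_mono) auto
    moreover have "\<bar>l 0 \<beta>\<bar> * 1 \<le> \<bar>l 0 \<beta>\<bar> * (1 + (norm x)\<^sup>2)" by (intro mult_left_mono) auto
    ultimately show ?thesis
      using growth[of x] by (simp add: distrib_right power2_eq_square mult.assoc)
  qed
  then show "\<exists>A. \<forall>x. \<bar>l x \<beta>\<bar> \<le> A * (1 + (norm x)\<^sup>2)" by blast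
  show "continuous_on UNIV (\<lambda>x. l x \<beta>)"
    using grad by (intro has_derivative_continuous_on) (auto simp: has_derivative_at_withinI)
qed

end

subsection \<open>Expansion of the score\<close>

lemma square_integrable_add:
  fixes f g :: "'a \<Rightarrow> real"
  assumes [measurable]: "f \<in> borel_measurable M" "g \<in> borel_measurable M"
    and "integrable M (\<lambda>x. (f x)\<^sup>2)" "integrable M (\<lambda>x. (g x)\<^sup>2)"
  shows "integrable M (\<lambda>x. (f x + g x)\<^sup>2)"
proof (rule Bochner_Integration.integrable_bound)
  show "integrable M (\<lambda>x. 2 * (f x)\<^sup>2 + 2 * (g x)\<^sup>2)" using assms by auto
  have "(f x + g x)\<^sup>2 \<le> 2 * (f x)\<^sup>2 + 2 * (g x)\<^sup>2" for x
    using zero_le_power2[of "f x - g x"] by (simp add: power2_eq_square algebra_simps)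
  then show "AE x in M. norm ((f x + g x)\<^sup>2) \<le> norm (2 * (f x)\<^sup>2 + 2 * (g x)\<^sup>2)" by simp
qed measurable

lemma square_integrable_cmult:
  fixes f :: "'a \<Rightarrow> real"
  assumes "integrable M (\<lambda>x. (f x)\<^sup>2)"
  shows "integrable M (\<lambda>x. (c * f x)\<^sup>2)"
  using assms by (simp add: power_mult_distrib)

locale robust_loss = smooth_loss B l
  for B :: "(real ^ 'd) set" and l :: "real ^ 'm \<Rightarrow> real ^ 'd \<Rightarrow> real" +
  fixes p q :: real and P :: "(real ^ 'm) measure" and \<beta>s :: "real ^ 'd"
  assumes q: "1 < q" and pq: "1 / p + 1 / q = 1"
    and P_prob: "prob_space P" and sets_P': "sets P = sets borel"
    and second_moment: "integrable P (\<lambda>x. (norm x)\<^sup>2)"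
    and optimality: "loss_optimality p P B l \<beta>s"
    and bounds: "loss_derivative_bounds p q P B l \<beta>s"
begin

abbreviation "h \<equiv> \<lambda>x. dbeta l B x \<beta>s"
abbreviation "Dx \<equiv> \<lambda>x. dx_h l B x \<beta>s"
abbreviation "Db \<equiv> \<lambda>x. dbeta_h l B x \<beta>s"
abbreviation "C \<equiv> mean_hessian l B P \<beta>s"

lemma p: "1 < p"
  by (rule conjugate_exponent_gt_1[OF q pq])

lemma interior: "\<beta>s \<in> interior B"
  and h_square_integrable: "integrable P (\<lambda>x. (norm (h x))\<^sup>2)"
  and h_mean: "integral\<^sup>L P h = 0"
  and Db_integrable: "integrable P Db"
  and C_pos_def: "pos_def C"
  using optimality by (auto simp: loss_optimality_def)

lemma h_measurable [measurable]: "h \<in> borel_measurable borel"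
  by (intro borel_measurable_continuous_onI continuous_score interior)

lemma Dx_measurable [measurable]: "Dx \<in> borel_measurable borel"
  by (intro borel_measurable_continuous_onI continuous_dx_h interior)

lemma Db_measurable [measurable]: "Db \<in> borel_measurable borel"
  using borel_measurable_integrable[OF Db_integrable] sets_P' by (simp cong: measurable_cong_sets)

text \<open>The linear growth hypothesis in Euclidean form. It controls long displacements, and at
  \<beta>s it makes \<open>Dx\<close> square integrable.\<close>

lemma dx_h_growth:
  obtains K \<rho> where "0 \<le> K" "0 < \<rho>"
    "\<And>x \<beta> v. dist \<beta> \<beta>s < \<rho> \<Longrightarrow> norm (dx_h l B x \<beta> *v v) \<le> K * (1 + norm x) * norm v"
proof -
  obtain M' where M': "0 < M'"
    "\<forall>\<^sub>F \<beta> in nhds \<beta>s. \<forall>x. mat_lp_norm q (dx_h l B x \<beta>) \<le> M' * (1 + lp_norm q x)"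
    using bounds by (auto simp: loss_derivative_bounds_def)
  then obtain \<rho> where \<rho>: "0 < \<rho>"
    "\<And>\<beta> x. dist \<beta> \<beta>s < \<rho> \<Longrightarrow> mat_lp_norm q (dx_h l B x \<beta>) \<le> M' * (1 + lp_norm q x)"
    unfolding eventually_nhds_metric by blast
  define K where "K = real CARD('d) * real CARD('m) * (M' * real CARD('m))"
  show thesis
  proof (rule that[of K \<rho>])
    show "0 \<le> K" using M' by (simp add: K_def)
    fix x :: "real ^ 'm" and v :: "real ^ 'm" and \<beta> :: "real ^ 'd" assume "dist \<beta> \<beta>s < \<rho>"
    then have "norm (dx_h l B x \<beta> *v v) \<le> real CARD('d) * real CARD('m) * (M' * (1 + lp_norm q x)) * norm v"
      using q \<rho> by (intro norm_mult_vec_le_mat_lp_norm[of q]) auto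
    also have "\<dots> \<le> real CARD('d) * real CARD('m) * (M' * (real CARD('m) * (1 + norm x))) * norm v"
    proof (intro mult_right_mono mult_left_mono)
      have "1 \<le> real CARD('m)" by (simp add: Suc_leI)
      then show "1 + lp_norm q x \<le> real CARD('m) * (1 + norm x)"
        using lp_norm_le_norm[of q x] q unfolding distrib_left by linarith
    qed (use M' in auto)
    finally show "norm (dx_h l B x \<beta> *v v) \<le> K * (1 + norm x) * norm v"
      by (simp add: K_def mult_ac)
  qed (rule \<rho>)
qed

text \<open>Both Lipschitz hypotheses are merged into one square-integrable modulus and one
  Euclidean radius, so that later estimates carry a single \<kappa>.\<close>

lemma derivatives_lipschitz:
  "\<exists>\<kappa> \<rho>. 0 < \<rho> \<and> ball \<beta>s \<rho> \<subseteq> interior B \<and> (\<forall>x. 0 \<le> \<kappa> x) \<and>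
    \<kappa> \<in> borel_measurable borel \<and> integrable P (\<lambda>x. (\<kappa> x)\<^sup>2) \<and>
    (\<forall>x \<Delta> w v. norm \<Delta> \<le> \<rho> \<longrightarrow> norm w < \<rho> \<longrightarrow>
      norm ((dx_h l B (x + \<Delta>) (\<beta>s + w) - Dx x) *v v) \<le> \<kappa> x * (norm \<Delta> + norm w) * norm v) \<and>
    (\<forall>x w v. norm w < \<rho> \<longrightarrow>
      norm ((dbeta_h l B x (\<beta>s + w) - Db x) *v v) \<le> \<kappa> x * norm w * norm v)"
proof -
  note b = bounds[unfolded loss_derivative_bounds_def]
  from b[THEN conjunct2, THEN conjunct2, THEN conjunct1]
  obtain \<kappa>1 where \<kappa>1': "(\<forall>x. \<kappa>1 x \<ge> 0) \<and> \<kappa>1 \<in> borel_measurable borel \<and> integrable P (\<lambda>x. (\<kappa>1 x)\<^sup>2) \<and>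
      (\<forall>x \<Delta> u. lp_norm q \<Delta> + lp_norm q u \<le> 1 \<and> \<beta>s + u \<in> B \<longrightarrow>
        mat_lp_norm q (dx_h l B (x + \<Delta>) (\<beta>s + u) - Dx x) \<le> \<kappa>1 x * (lp_norm q \<Delta> + lp_norm q u))"
    by (rule exE)
  from b[THEN conjunct2, THEN conjunct2, THEN conjunct2]
  obtain \<kappa>2 where \<kappa>2': "(\<forall>x. \<kappa>2 x \<ge> 0) \<and> \<kappa>2 \<in> borel_measurable borel \<and> integrable P (\<lambda>x. (\<kappa>2 x)\<^sup>2) \<and>
      (\<forall>x \<Delta> u. lp_norm q \<Delta> + lp_norm q u \<le> 1 \<and> \<beta>s + u \<in> B \<longrightarrow>
        mat_lp_norm q (dbeta_h l B (x + \<Delta>) (\<beta>s + u) - Db x) \<le> \<kappa>2 x * (lp_norm q \<Delta> + lp_norm q u))"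
    by (rule exE)
  note \<kappa>1 = \<kappa>1'[THEN conjunct1, rule_format] \<kappa>1'[THEN conjunct2, THEN conjunct1]
    \<kappa>1'[THEN conjunct2, THEN conjunct2, THEN conjunct1]
    \<kappa>1'[THEN conjunct2, THEN conjunct2, THEN conjunct2, rule_format, OF conjI]
  note \<kappa>2 = \<kappa>2'[THEN conjunct1, rule_format] \<kappa>2'[THEN conjunct2, THEN conjunct1]
    \<kappa>2'[THEN conjunct2, THEN conjunct2, THEN conjunct1]
    \<kappa>2'[THEN conjunct2, THEN conjunct2, THEN conjunct2, rule_format, OF conjI]
  obtain \<rho>0 where \<rho>0: "0 < \<rho>0" "ball \<beta>s \<rho>0 \<subseteq> interior B"
    using interior open_interior[of B] by (meson open_contains_ball)
  define a where "a = real CARD('m) + real CARD('d)"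
  have "1 \<le> real CARD('m)" by (simp add: Suc_leI)
  then have a: "1 \<le> a" unfolding a_def by linarith
  \<comment> \<open>The first entry keeps the parameter inside B; the second makes each of the two
    increments have q-norm at most \<open>1 / 2\<close>, as the Lipschitz hypotheses ask.\<close>
  define \<rho> where "\<rho> = min \<rho>0 (1 / (2 * a))"
  have lpm: "lp_norm q \<Delta> \<le> a * norm \<Delta>" for \<Delta> :: "real ^ 'm"
    using lp_norm_le_norm[of q \<Delta>] q mult_right_mono[of "real CARD('m)" a "norm \<Delta>"] by (simp add: a_def)
  have lpd: "lp_norm q w \<le> a * norm w" for w :: "real ^ 'd"
    using lp_norm_le_norm[of q w] q mult_right_mono[of "real CARD('d)" a "norm w"] by (simp add: a_def)
  \<comment> \<open>Two factors pay for the operator norm, the third for the q-norms of the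
    increments.\<close>
  define K where "K = a * a * a"
  have "0 < a" using a by simp
  have small: "lp_norm q \<Delta> + lp_norm q w \<le> 1" if "norm \<Delta> \<le> \<rho>" "norm w < \<rho>"
    for \<Delta> :: "real ^ 'm" and w :: "real ^ 'd"
  proof -
    have "norm \<Delta> \<le> 1 / (2 * a)" "norm w \<le> 1 / (2 * a)"
      using that by (auto simp: \<rho>_def)
    then have "a * norm \<Delta> \<le> a * (1 / (2 * a))" "a * norm w \<le> a * (1 / (2 * a))"
      using \<open>0 < a\<close> by (auto intro: mult_left_mono simp del: times_divide_eq_right)
    then have "a * norm \<Delta> \<le> 1 / 2" "a * norm w \<le> 1 / 2" using \<open>0 < a\<close> by simp_all
    then show ?thesis using lpm[of \<Delta>] lpd[of w] by linarith
  qed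
  have inB: "\<beta>s + w \<in> B" if w: "norm w < \<rho>" for w
  proof -
    have "\<beta>s + w \<in> ball \<beta>s \<rho>0" using w by (simp add: \<rho>_def dist_norm)
    then show ?thesis using \<rho>0(2) interior_subset[of B] by blast
  qed
  have le_a: "real CARD('d) \<le> a" "real CARD('m) \<le> a" by (simp_all add: a_def)
  then have card: "real CARD('d) * real CARD('m) \<le> a * a" "real CARD('d) * real CARD('d) \<le> a * a"
    using \<open>0 < a\<close> by (simp_all add: mult_mono)
  have "0 < \<rho>" "ball \<beta>s \<rho> \<subseteq> interior B" using \<rho>0 \<open>0 < a\<close> by (auto simp: \<rho>_def)
  show ?thesis
  proof (intro exI[of _ \<rho>] exI[of _ "\<lambda>x. K * \<kappa>1 x + K * \<kappa>2 x"] conjI allI impI)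
    show "0 < \<rho>" "ball \<beta>s \<rho> \<subseteq> interior B" by fact+
    have "0 \<le> K" using \<open>0 < a\<close> by (simp add: K_def)
    then show "0 \<le> K * \<kappa>1 x + K * \<kappa>2 x" for x using \<kappa>1(1) \<kappa>2(1) by simp
    show "(\<lambda>x. K * \<kappa>1 x + K * \<kappa>2 x) \<in> borel_measurable borel" using \<kappa>1(2) \<kappa>2(2) by measurable
    show "integrable P (\<lambda>x. (K * \<kappa>1 x + K * \<kappa>2 x)\<^sup>2)"
      using \<kappa>1 \<kappa>2 sets_P' by (intro square_integrable_add square_integrable_cmult)
        (auto cong: measurable_cong_sets)
    {
      fix x \<Delta> v :: "real ^ 'm" and w :: "real ^ 'd" assume \<Delta>: "norm \<Delta> \<le> \<rho>" and w: "norm w < \<rho>"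
      have "norm ((dx_h l B (x + \<Delta>) (\<beta>s + w) - Dx x) *v v)
          \<le> real CARD('d) * real CARD('m) * (\<kappa>1 x * (lp_norm q \<Delta> + lp_norm q w)) * norm v"
        using q by (intro norm_mult_vec_le_mat_lp_norm[of q] \<kappa>1(4) small \<Delta> w inB) auto
      also have "\<dots> \<le> (a * a) * (\<kappa>1 x * (a * (norm \<Delta> + norm w))) * norm v"
        using lpm[of \<Delta>] lpd[of w] \<kappa>1(1)[of x] card \<open>0 < a\<close>
        by (intro mult_right_mono mult_mono le_a) (auto simp: distrib_left)
      also have "\<dots> = K * \<kappa>1 x * (norm \<Delta> + norm w) * norm v" by (simp add: K_def mult_ac)
      also have "\<dots> \<le> (K * \<kappa>1 x + K * \<kappa>2 x) * (norm \<Delta> + norm w) * norm v"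
        using \<kappa>2(1)[of x] \<open>0 \<le> K\<close> by (intro mult_right_mono) auto
      finally show "norm ((dx_h l B (x + \<Delta>) (\<beta>s + w) - Dx x) *v v)
          \<le> (K * \<kappa>1 x + K * \<kappa>2 x) * (norm \<Delta> + norm w) * norm v" .
    }
    {
      fix x :: "real ^ 'm" and v w :: "real ^ 'd" assume w: "norm w < \<rho>"
      have s0: "lp_norm q (0 :: real ^ 'm) + lp_norm q w \<le> 1"
        using small[of 0 w] w \<open>0 < \<rho>\<close> by simp
      have "mat_lp_norm q (dbeta_h l B (x + 0) (\<beta>s + w) - Db x) \<le> \<kappa>2 x * (lp_norm q (0 :: real ^ 'm) + lp_norm q w)"
        by (rule \<kappa>2(4)[OF s0 inB[OF w]])
      then have "mat_lp_norm q (dbeta_h l B x (\<beta>s + w) - Db x) \<le> \<kappa>2 x * lp_norm q w" by simp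
      then have "norm ((dbeta_h l B x (\<beta>s + w) - Db x) *v v)
          \<le> real CARD('d) * real CARD('d) * (\<kappa>2 x * lp_norm q w) * norm v"
        using q by (intro norm_mult_vec_le_mat_lp_norm[of q]) auto
      also have "\<dots> \<le> (a * a) * (\<kappa>2 x * (a * norm w)) * norm v"
        using lpd[of w] \<kappa>2(1)[of x] card \<open>0 < a\<close>
        by (intro mult_right_mono mult_mono le_a) auto
      also have "\<dots> = K * \<kappa>2 x * norm w * norm v" by (simp add: K_def mult_ac)
      also have "\<dots> \<le> (K * \<kappa>1 x + K * \<kappa>2 x) * norm w * norm v"
        using \<kappa>1(1)[of x] \<open>0 \<le> K\<close> by (intro mult_right_mono) auto
      finally show "norm ((dbeta_h l B x (\<beta>s + w) - Db x) *v v)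
          \<le> (K * \<kappa>1 x + K * \<kappa>2 x) * norm w * norm v" .
    }
  qed
qed

text \<open>
  The second bound is for increments \<open>y - x\<close> that are not small: there the Lipschitz condition on
  \<open>D\<^sub>x h\<close> gives nothing, and only its linear growth is available.
\<close>

lemma score_expansion:
  "\<exists>\<kappa> \<rho> K. 0 < \<rho> \<and> \<rho> \<le> 1 \<and> ball \<beta>s \<rho> \<subseteq> interior B \<and> (\<forall>x. 0 \<le> \<kappa> x) \<and> 0 \<le> K \<and>
    \<kappa> \<in> borel_measurable borel \<and> integrable P (\<lambda>x. (\<kappa> x)\<^sup>2) \<and>
    (\<forall>x v. norm (Dx x *v v) \<le> \<kappa> x * norm v) \<and>
    (\<forall>x y w. norm (y - x) \<le> \<rho> \<longrightarrow> norm w < \<rho> \<longrightarrow>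
      norm (dbeta l B y (\<beta>s + w) - h x - Dx x *v (y - x) - Db x *v w)
        \<le> \<kappa> x * (norm (y - x) + norm w)\<^sup>2) \<and>
    (\<forall>x y w. norm w < \<rho> \<longrightarrow>
      norm (dbeta l B y (\<beta>s + w) - h x - Dx x *v (y - x) - Db x *v w)
        \<le> \<kappa> x * (norm (y - x) + (norm w)\<^sup>2) + K * (norm (y - x))\<^sup>2)"
proof -
  obtain K \<rho>1 where K: "0 \<le> K" "0 < \<rho>1"
    "\<And>x \<beta> v. dist \<beta> \<beta>s < \<rho>1 \<Longrightarrow> norm (dx_h l B x \<beta> *v v) \<le> K * (1 + norm x) * norm v"
    by (rule dx_h_growth) blast
  from derivatives_lipschitz obtain \<kappa> \<rho>2 where \<rho>2: "0 < \<rho>2" "ball \<beta>s \<rho>2 \<subseteq> interior B" and \<kappa>0: "\<forall>x. 0 \<le> \<kappa> x"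
    "\<kappa> \<in> borel_measurable borel" "integrable P (\<lambda>x. (\<kappa> x)\<^sup>2)"
    and lipx0: "\<forall>x \<Delta> w v. norm \<Delta> \<le> \<rho>2 \<longrightarrow> norm w < \<rho>2 \<longrightarrow>
      norm ((dx_h l B (x + \<Delta>) (\<beta>s + w) - Dx x) *v v) \<le> \<kappa> x * (norm \<Delta> + norm w) * norm v"
    and lipb0: "\<forall>x w v. norm w < \<rho>2 \<longrightarrow>
      norm ((dbeta_h l B x (\<beta>s + w) - Db x) *v v) \<le> \<kappa> x * norm w * norm v"
    by (elim exE conjE)
  note \<kappa> = \<kappa>0(1)[rule_format] \<kappa>0(2,3) and lipx = lipx0[rule_format] and lipb = lipb0[rule_format]
  define \<rho> where "\<rho> = min 1 (min \<rho>1 \<rho>2)"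
  have \<rho>: "0 < \<rho>" "\<rho> \<le> 1" "\<rho> \<le> \<rho>1" "\<rho> \<le> \<rho>2" using K \<rho>2 by (auto simp: \<rho>_def)
  have int: "\<beta>s + w \<in> interior B" if "norm w < \<rho>" for w
    using that \<rho> \<rho>2(2) by (auto simp: subset_iff dist_norm)
  have param: "norm (dbeta l B x (\<beta>s + w) - h x - Db x *v w) \<le> \<kappa> x * norm w * norm w"
    if w: "norm w < \<rho>" for x w
  proof -
    \<comment> \<open>With the linear part subtracted, the derivative is a difference of Jacobians,
      which the Lipschitz modulus bounds; the mean value inequality then gives the quadratic
      remainder.\<close>
    let ?\<psi> = "\<lambda>v. dbeta l B x (\<beta>s + v) - Db x *v v"
    have "norm (?\<psi> w - ?\<psi> 0) \<le> \<kappa> x * norm w * norm (w - 0)"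
    proof (rule differentiable_bound[OF convex_cball[of 0 "norm w"]])
      fix v :: "real ^ 'd" assume v: "v \<in> cball 0 (norm w)"
      then have v\<rho>: "norm v < \<rho>" using w by simp
      have 1: "((\<lambda>v. \<beta>s + v) has_derivative (\<lambda>u. u)) (at v)"
        by (auto intro!: derivative_eq_intros)
      have "(?\<psi> has_derivative (\<lambda>u. dbeta_h l B x (\<beta>s + v) *v u - Db x *v u)) (at v)"
        by (rule has_derivative_diff[OF has_derivative_compose[OF 1 score_has_derivative(2)[OF int[OF v\<rho>]]]
              bounded_linear_imp_has_derivative[OF matrix_vector_mul_bounded_linear]])
      then show "(?\<psi> has_derivative (\<lambda>u. (dbeta_h l B x (\<beta>s + v) - Db x) *v u)) (at v within cball 0 (norm w))"
        unfolding matrix_vector_mult_diff_rdistrib by (rule has_derivative_at_withinI)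
      have "\<kappa> x * norm v \<le> \<kappa> x * norm w" using v \<kappa>(1) by (intro mult_left_mono) auto
      then have "norm ((dbeta_h l B x (\<beta>s + v) - Db x) *v u) \<le> \<kappa> x * norm w * norm u" for u
        using lipb[of v x u] v\<rho> \<rho> mult_right_mono[of "\<kappa> x * norm v" "\<kappa> x * norm w" "norm u"] by simp
      then show "onorm (\<lambda>u. (dbeta_h l B x (\<beta>s + v) - Db x) *v u) \<le> \<kappa> x * norm w"
        by (rule onorm_le)
    qed auto
    then show ?thesis by (simp add: algebra_simps)
  qed
  have data_small: "norm (dbeta l B y \<beta> - dbeta l B x \<beta> - Dx x *v (y - x))
      \<le> \<kappa> x * (norm (y - x) + norm w) * norm (y - x)"
    if w: "norm w < \<rho>" and \<beta>: "\<beta> = \<beta>s + w" and y: "norm (y - x) \<le> \<rho>" for x y w \<beta>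
  proof -
    let ?\<psi> = "\<lambda>v. dbeta l B (x + v) \<beta> - Dx x *v v"
    have "norm (?\<psi> (y - x) - ?\<psi> 0) \<le> \<kappa> x * (norm (y - x) + norm w) * norm ((y - x) - 0)"
    proof (rule differentiable_bound[OF convex_cball[of 0 "norm (y - x)"]])
      fix v :: "real ^ 'm" assume v: "v \<in> cball 0 (norm (y - x))"
      then have v\<rho>: "norm v \<le> \<rho>" using y by simp
      have 1: "((\<lambda>v. x + v) has_derivative (\<lambda>u. u)) (at v)"
        by (auto intro!: derivative_eq_intros)
      have "(?\<psi> has_derivative (\<lambda>u. dx_h l B (x + v) \<beta> *v u - Dx x *v u)) (at v)"
        unfolding \<beta>
        by (rule has_derivative_diff[OF has_derivative_compose[OF 1 score_has_derivative(1)[OF int[OF w]]]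
              bounded_linear_imp_has_derivative[OF matrix_vector_mul_bounded_linear]])
      then show "(?\<psi> has_derivative (\<lambda>u. (dx_h l B (x + v) \<beta> - Dx x) *v u)) (at v within cball 0 (norm (y - x)))"
        unfolding matrix_vector_mult_diff_rdistrib by (rule has_derivative_at_withinI)
      have "\<kappa> x * (norm v + norm w) \<le> \<kappa> x * (norm (y - x) + norm w)"
        using v \<kappa>(1) by (intro mult_left_mono) auto
      then have "norm ((dx_h l B (x + v) \<beta> - Dx x) *v u) \<le> \<kappa> x * (norm (y - x) + norm w) * norm u" for u
        using lipx[of v w x u] v\<rho> w \<rho> \<beta>
          mult_right_mono[of "\<kappa> x * (norm v + norm w)" "\<kappa> x * (norm (y - x) + norm w)" "norm u"]
        by simp
      then show "onorm (\<lambda>u. (dx_h l B (x + v) \<beta> - Dx x) *v u) \<le> \<kappa> x * (norm (y - x) + norm w)"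
        by (rule onorm_le)
    qed auto
    then show ?thesis by (simp add: algebra_simps)
  qed
  \<comment> \<open>No cancellation is available here: the increment of the score and its
    linearization are each bounded by linear growth along the segment from x to y.\<close>
  have data_large: "norm (dbeta l B y \<beta> - dbeta l B x \<beta> - Dx x *v (y - x))
      \<le> 2 * K * (1 + norm x) * norm (y - x) + K * (norm (y - x))\<^sup>2"
    if w: "norm w < \<rho>" and \<beta>: "\<beta> = \<beta>s + w" for x y w \<beta>
  proof -
    have "norm (dbeta l B y \<beta> - dbeta l B x \<beta>) \<le> K * (1 + norm x + norm (y - x)) * norm (y - x)"
    proof (rule differentiable_bound[OF convex_cball[of x "norm (y - x)"]])
      fix z assume z: "z \<in> cball x (norm (y - x))"
      show "((\<lambda>y. dbeta l B y \<beta>) has_derivative (\<lambda>u. dx_h l B z \<beta> *v u)) (at z within cball x (norm (y - x)))"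
        unfolding \<beta> by (rule has_derivative_at_withinI[OF score_has_derivative(1)[OF int[OF w]]])
      have "norm z \<le> norm x + norm (y - x)"
        using z norm_triangle_sub[of z x] by (simp add: dist_norm norm_minus_commute)
      then have "K * (1 + norm z) \<le> K * (1 + norm x + norm (y - x))"
        using K(1) by (intro mult_left_mono) auto
      then have "norm (dx_h l B z \<beta> *v u) \<le> K * (1 + norm x + norm (y - x)) * norm u" for u
        using K(3)[of \<beta> z u] w \<rho> \<beta>
          mult_right_mono[of "K * (1 + norm z)" "K * (1 + norm x + norm (y - x))" "norm u"]
        by (simp add: dist_norm)
      then show "onorm (\<lambda>u. dx_h l B z \<beta> *v u) \<le> K * (1 + norm x + norm (y - x))"
        by (rule onorm_le)
    qed (auto simp: dist_norm norm_minus_commute)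
    moreover have "norm (Dx x *v (y - x)) \<le> K * (1 + norm x) * norm (y - x)"
      using K by simp
    moreover have "norm (dbeta l B y \<beta> - dbeta l B x \<beta> - Dx x *v (y - x))
        \<le> norm (dbeta l B y \<beta> - dbeta l B x \<beta>) + norm (Dx x *v (y - x))"
      by (rule norm_triangle_ineq4)
    ultimately show ?thesis by (simp add: algebra_simps power2_eq_square)
  qed
  \<comment> \<open>The growth factor \<open>1 + norm x\<close> joins the modulus; it is square
    integrable by the second moment assumption.\<close>
  define k where "k x = \<kappa> x + (2 * K) * (1 + norm x)" for x :: "real ^ 'm"
  have k: "\<kappa> x \<le> k x" "2 * K * (1 + norm x) \<le> k x" "0 \<le> k x" for x
    using \<kappa>(1)[of x] K(1) by (auto simp: k_def)
  have split: "norm (dbeta l B y (\<beta>s + w) - h x - Dx x *v (y - x) - Db x *v w)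
    \<le> norm (dbeta l B y (\<beta>s + w) - dbeta l B x (\<beta>s + w) - Dx x *v (y - x))
      + norm (dbeta l B x (\<beta>s + w) - h x - Db x *v w)" for x y w
    using norm_triangle_ineq[of "dbeta l B y (\<beta>s + w) - dbeta l B x (\<beta>s + w) - Dx x *v (y - x)"
        "dbeta l B x (\<beta>s + w) - h x - Db x *v w"] by (simp add: algebra_simps)
  show ?thesis
  proof (rule exI[of _ k], rule exI[of _ \<rho>], rule exI[of _ K], intro conjI allI impI)
    show "ball \<beta>s \<rho> \<subseteq> interior B" using \<rho>2(2) \<rho>(4) by auto
    show "k \<in> borel_measurable borel" unfolding k_def using \<kappa>(2) by measurable
    interpret P: prob_space P by (rule P_prob)
    show "integrable P (\<lambda>x. (k x)\<^sup>2)"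
      unfolding k_def using \<kappa>(2,3) sets_P' second_moment
      by (intro square_integrable_add square_integrable_cmult)
        (auto cong: measurable_cong_sets)
    show "norm (Dx x *v v) \<le> k x * norm v" for x v
    proof -
      have "norm (Dx x *v v) \<le> K * (1 + norm x) * norm v" using K by simp
      also have "\<dots> \<le> k x * norm v"
        using k(2)[of x] K(1) by (intro mult_right_mono) (auto simp: k_def \<kappa>(1))
      finally show ?thesis .
    qed
    let ?e = "\<lambda>x y w. norm (dbeta l B y (\<beta>s + w) - h x - Dx x *v (y - x) - Db x *v w)"
    {
      fix x y :: "real ^ 'm" and w :: "real ^ 'd" assume y: "norm (y - x) \<le> \<rho>" and w: "norm w < \<rho>"
      have "?e x y w \<le> \<kappa> x * (norm (y - x) + norm w) * norm (y - x) + \<kappa> x * norm w * norm w"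
        using split[of y w x] data_small[OF w refl y] param[OF w, of x] by linarith
      also have "\<dots> \<le> \<kappa> x * (norm (y - x) + norm w)\<^sup>2"
        using \<kappa>(1)[of x] by (simp add: power2_eq_square algebra_simps)
      also have "\<dots> \<le> k x * (norm (y - x) + norm w)\<^sup>2"
        using k by (intro mult_right_mono) auto
      finally show "?e x y w \<le> k x * (norm (y - x) + norm w)\<^sup>2" .
    }
    fix x y :: "real ^ 'm" and w :: "real ^ 'd" assume w: "norm w < \<rho>"
    have "?e x y w \<le> 2 * K * (1 + norm x) * norm (y - x) + K * (norm (y - x))\<^sup>2 + \<kappa> x * norm w * norm w"
      using split[of y w x] data_large[OF w refl, of y x] param[OF w, of x] by linarith
    also have "\<dots> \<le> k x * norm (y - x) + K * (norm (y - x))\<^sup>2 + k x * norm w * norm w"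
      using k[of x] by (intro add_mono mult_right_mono) auto
    finally show "?e x y w \<le> k x * (norm (y - x) + (norm w)\<^sup>2) + K * (norm (y - x))\<^sup>2"
      by (simp add: algebra_simps power2_eq_square)
  qed (use k \<rho> K in auto)
qed

end

section \<open>Plans of cost O(1/n) starting from the empirical measure\<close>

lemma borel_measurable_matrix_vector_mult [measurable (raw)]:
  fixes f :: "'a \<Rightarrow> real ^ 'k ^ 'r"
  assumes "f \<in> borel_measurable N" "g \<in> borel_measurable N"
  shows "(\<lambda>x. f x *v g x) \<in> borel_measurable N"
  by (rule borel_measurable_continuous_Pair[OF assms])
     (auto simp: matrix_vector_mult_def intro!: continuous_intros)

text \<open>The second marginal is left free and plays the role of the perturbed distribution.
  Integrability is a separate clause because the integral of a function that is not integrable is 0,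
  which would make the bound void.\<close>

definition near_coupling :: "nat \<Rightarrow> (nat \<Rightarrow> real ^ 'm) \<Rightarrow> real \<Rightarrow> ((real ^ 'm) \<times> (real ^ 'm)) measure \<Rightarrow> bool" where
  "near_coupling n x L \<pi> \<longleftrightarrow> prob_space \<pi> \<and> sets \<pi> = sets (borel \<Otimes>\<^sub>M borel) \<and>
    distr \<pi> borel fst = empirical_measure n x \<and>
    integrable \<pi> (\<lambda>z. (norm (snd z - fst z))\<^sup>2) \<and>
    real n * (\<integral>z. (norm (snd z - fst z))\<^sup>2 \<partial>\<pi>) \<le> L"

context
  fixes n :: nat and x :: "nat \<Rightarrow> real ^ 'm" and L :: real and \<pi>
  assumes n: "n \<ge> 1" and \<pi>: "near_coupling n x L \<pi>"
begin

lemma near_coupling_measurable_cong: "borel_measurable \<pi> = borel_measurable (borel \<Otimes>\<^sub>M borel)"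
  using \<pi> by (intro measurable_cong_sets) (auto simp: near_coupling_def)

lemma near_coupling_fst:
  fixes f :: "real ^ 'm \<Rightarrow> 'b::euclidean_space"
  assumes [measurable]: "f \<in> borel_measurable borel"
  shows "integrable \<pi> (\<lambda>z. f (fst z))"
    and "(\<integral>z. f (fst z) \<partial>\<pi>) = sample_mean n x f"
proof -
  have m: "fst \<in> measurable \<pi> borel" unfolding near_coupling_measurable_cong by measurable
  have d: "distr \<pi> borel fst = empirical_measure n x" using \<pi> by (simp add: near_coupling_def)
  show "integrable \<pi> (\<lambda>z. f (fst z))"
    using integrable_empirical_measure[OF n, of f x] integrable_distr_eq[OF m, of f] by (simp add: d)
  show "(\<integral>z. f (fst z) \<partial>\<pi>) = sample_mean n x f"
    using integral_empirical_measure[OF n, of f x] integral_distr[OF m, of f] by (simp add: d)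
qed

lemma near_coupling_increment:
  "integrable \<pi> (\<lambda>z. (norm (snd z - fst z))\<^sup>2)"
  "real n * (\<integral>z. (norm (snd z - fst z))\<^sup>2 \<partial>\<pi>) \<le> L"
  using \<pi> by (auto simp: near_coupling_def)

lemma near_coupling_integrable_product:
  fixes f :: "(real ^ 'm) \<times> (real ^ 'm) \<Rightarrow> 'b::euclidean_space"
  assumes [measurable]: "f \<in> borel_measurable (borel \<Otimes>\<^sub>M borel)" "k \<in> borel_measurable borel"
    and le: "\<And>z. norm (f z) \<le> a * (norm (snd z - fst z))\<^sup>2 + k (fst z)"
  shows "integrable \<pi> f"
proof (rule Bochner_Integration.integrable_bound)
  show "integrable \<pi> (\<lambda>z. a * (norm (snd z - fst z))\<^sup>2 + k (fst z))"
    by (intro Bochner_Integration.integrable_add integrable_mult_right near_coupling_increment near_coupling_fst) simp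
  show "f \<in> borel_measurable \<pi>" unfolding near_coupling_measurable_cong by simp
  show "AE z in \<pi>. norm (f z) \<le> norm (a * (norm (snd z - fst z))\<^sup>2 + k (fst z))"
    using le by (intro AE_I2) (metis abs_ge_self order_trans real_norm_def)
qed

end

context robust_loss
begin

text \<open>The intercept of the linear expansion in the local parameter u: the rescaled empirical
  score plus the effect of moving the data along \<pi>.\<close>

definition score_shift :: "nat \<Rightarrow> (nat \<Rightarrow> real ^ 'm) \<Rightarrow> ((real ^ 'm) \<times> (real ^ 'm)) measure \<Rightarrow> real ^ 'd" where
  "score_shift n x \<pi> = sqrt (real n) *\<^sub>R sample_mean n x h +
    sqrt (real n) *\<^sub>R (\<integral>z. Dx (fst z) *v (snd z - fst z) \<partial>\<pi>)"

lemma loss_integrable: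
  assumes n: "n \<ge> 1" and \<pi>: "near_coupling n x L \<pi>" and b: "b \<in> B"
  shows "integrable \<pi> (\<lambda>z. l (snd z) b)"
    and "(\<lambda>y. l y b) \<in> borel_measurable borel"
proof -
  from bounds[unfolded loss_derivative_bounds_def, THEN conjunct1]
  obtain K where "\<forall>x. mat_lp_norm p (dxx l x b) \<le> K"
    using b by blast
  note K = this[rule_format]
  have "1 \<le> p" using p by simp
  note growth = loss_quadratic_growth[OF b this K]
  show m [measurable]: "(\<lambda>y. l y b) \<in> borel_measurable borel"
    by (rule borel_measurable_continuous_onI[OF growth(2)])
  from growth(1) obtain A where A: "\<And>y. \<bar>l y b\<bar> \<le> A * (1 + (norm y)\<^sup>2)" by blast
  have A0: "0 \<le> A" using A[of 0] by (metis abs_ge_zero add.right_neutral mult.right_neutral norm_zero order_trans power_zero_numeral)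
  show "integrable \<pi> (\<lambda>z. l (snd z) b)"
  proof (rule near_coupling_integrable_product[OF n \<pi>, of _ "\<lambda>x. A * (1 + 2 * (norm x)\<^sup>2)" "2 * A"])
    fix z :: "(real ^ 'm) \<times> (real ^ 'm)"
    have "(norm (snd z))\<^sup>2 \<le> (norm (snd z - fst z) + norm (fst z))\<^sup>2"
      using norm_triangle_ineq[of "snd z - fst z" "fst z"] by (intro power_mono) auto
    also have "\<dots> \<le> 2 * (norm (snd z - fst z))\<^sup>2 + 2 * (norm (fst z))\<^sup>2"
      using zero_le_power2[of "norm (snd z - fst z) - norm (fst z)"]
      by (simp add: power2_eq_square algebra_simps)
    finally have "A * (1 + (norm (snd z))\<^sup>2) \<le> A * (1 + (2 * (norm (snd z - fst z))\<^sup>2 + 2 * (norm (fst z))\<^sup>2))"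
      using A0 by (intro mult_left_mono) auto
    then show "norm (l (snd z) b) \<le> 2 * A * (norm (snd z - fst z))\<^sup>2 + A * (1 + 2 * (norm (fst z))\<^sup>2)"
      using A[of "snd z"] by (simp add: algebra_simps)
  qed measurable
qed

text \<open>Short and long displacements are covered by one bound with a free truncation level N.
  Where \<kappa> is at most N, everything is quadratic in the displacement; where it exceeds N, a
  linear term remains, but weighted by the tail of \<kappa>.\<close>

lemma score_error_bound:
  "\<exists>\<kappa> \<rho> K. 0 < \<rho> \<and> ball \<beta>s \<rho> \<subseteq> interior B \<and> (\<forall>x. 0 \<le> \<kappa> x) \<and> 0 \<le> K \<and>
    \<kappa> \<in> borel_measurable borel \<and> integrable P (\<lambda>x. (\<kappa> x)\<^sup>2) \<and>
    (\<forall>x v. norm (Dx x *v v) \<le> \<kappa> x * norm v) \<and>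
    (\<forall>N x y w. 0 \<le> N \<longrightarrow> norm w < \<rho> \<longrightarrow>
      norm (dbeta l B y (\<beta>s + w) - h x - Dx x *v (y - x) - Db x *v w)
        \<le> (2 * N + N / \<rho> + K) * (norm (y - x))\<^sup>2 + 2 * \<kappa> x * (norm w)\<^sup>2
          + 2 * (if N < \<kappa> x then \<kappa> x else 0) * norm (y - x))"
proof -
  from score_expansion obtain \<kappa> \<rho> K where *: "0 < \<rho>" "\<rho> \<le> 1" "ball \<beta>s \<rho> \<subseteq> interior B" "\<forall>x. 0 \<le> \<kappa> x" "0 \<le> K"
    "\<kappa> \<in> borel_measurable borel" "integrable P (\<lambda>x. (\<kappa> x)\<^sup>2)"
    "\<forall>x v. norm (Dx x *v v) \<le> \<kappa> x * norm v"
    "\<forall>x y w. norm (y - x) \<le> \<rho> \<longrightarrow> norm w < \<rho> \<longrightarrow>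
      norm (dbeta l B y (\<beta>s + w) - h x - Dx x *v (y - x) - Db x *v w)
        \<le> \<kappa> x * (norm (y - x) + norm w)\<^sup>2"
    "\<forall>x y w. norm w < \<rho> \<longrightarrow>
      norm (dbeta l B y (\<beta>s + w) - h x - Dx x *v (y - x) - Db x *v w)
        \<le> \<kappa> x * (norm (y - x) + (norm w)\<^sup>2) + K * (norm (y - x))\<^sup>2"
    by (elim exE conjE)
  note \<kappa> = *(4)[rule_format] and small = *(9)[rule_format] and large = *(10)[rule_format]
  have "norm (dbeta l B y (\<beta>s + w) - h x - Dx x *v (y - x) - Db x *v w)
        \<le> (2 * N + N / \<rho> + K) * (norm (y - x))\<^sup>2 + 2 * \<kappa> x * (norm w)\<^sup>2
          + 2 * (if N < \<kappa> x then \<kappa> x else 0) * norm (y - x)" (is "?e \<le> _")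
    if N: "0 \<le> N" and w: "norm w < \<rho>" for N x y w
  proof -
    define d where "d = norm (y - x)"
    define t where "t = (if N < \<kappa> x then \<kappa> x else 0)"
    have d: "0 \<le> d" by (simp add: d_def)
    have t: "0 \<le> t" using \<kappa> by (simp add: t_def)
    have k0: "0 \<le> \<kappa> x * (norm w)\<^sup>2" using \<kappa> by simp
    have split: "\<kappa> x * a \<le> N * a + t * a" if "0 \<le> a" for a
    proof -
      have "\<kappa> x \<le> N + t" using N by (auto simp: t_def)
      then have "\<kappa> x * a \<le> (N + t) * a" using that by (intro mult_right_mono)
      then show ?thesis by (simp add: distrib_right)
    qed
    have nn: "0 \<le> N * d\<^sup>2" "0 \<le> N * d\<^sup>2 / \<rho>" "0 \<le> K * d\<^sup>2" "0 \<le> t * d"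
      using N *(1,5) t d by auto
    show ?thesis
    proof (cases "d \<le> \<rho>")
      case True
      then have "?e \<le> \<kappa> x * (d + norm w)\<^sup>2"
        using small w unfolding d_def by blast
      also have "\<dots> \<le> \<kappa> x * (2 * d\<^sup>2 + 2 * (norm w)\<^sup>2)"
        using \<kappa> zero_le_power2[of "d - norm w"]
        by (intro mult_left_mono) (auto simp: power2_eq_square algebra_simps)
      also have "\<dots> = \<kappa> x * (2 * d\<^sup>2) + 2 * \<kappa> x * (norm w)\<^sup>2" by (simp add: algebra_simps)
      also have "\<kappa> x * (2 * d\<^sup>2) \<le> N * (2 * d\<^sup>2) + t * (2 * d\<^sup>2)" by (rule split) simp
      also have "t * (2 * d\<^sup>2) \<le> t * (2 * d)"
      proof -
        have "d * d \<le> d * 1" using True *(2) d by (intro mult_left_mono) auto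
        then show ?thesis using t by (intro mult_left_mono) (auto simp: power2_eq_square)
      qed
      finally show ?thesis
        using nn unfolding d_def[symmetric] t_def[symmetric] by (simp add: algebra_simps)
    next
      case False
      have "?e \<le> \<kappa> x * (d + (norm w)\<^sup>2) + K * d\<^sup>2"
        using large[OF w, of y x] unfolding d_def .
      also have "\<dots> = \<kappa> x * d + \<kappa> x * (norm w)\<^sup>2 + K * d\<^sup>2" by (simp add: algebra_simps)
      also have "\<kappa> x * d \<le> N * d + t * d" by (rule split[OF d])
      \<comment> \<open>A displacement longer than \<rho> is at most its square divided by \<rho>;
        this is the origin of \<open>N / \<rho>\<close> in the bound.\<close>
      also have "N * d \<le> N * d\<^sup>2 / \<rho>"
      proof -
        have "d * \<rho> \<le> d * d" using False d by (intro mult_left_mono) auto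
        then have "N * (d * \<rho>) \<le> N * d\<^sup>2" using N by (intro mult_left_mono) (auto simp: power2_eq_square)
        then show ?thesis using *(1) by (simp add: field_simps)
      qed
      finally show ?thesis
        using nn k0 unfolding d_def[symmetric] t_def[symmetric] by (simp add: algebra_simps)
    qed
  qed
  with * show ?thesis by blast
qed

end

lemma lim_const_over_sqrt: "(\<lambda>n. c / sqrt (real n)) \<longlonglongrightarrow> (0 :: real)"
  by (intro tendsto_divide_0[OF tendsto_const] filterlim_at_top_imp_at_infinity
      filterlim_compose[OF sqrt_at_top] filterlim_real_sequentially)

locale robust_sample = iid_sample M X P + robust_loss B l p q P \<beta>s
  for M :: "'w measure" and X :: "nat \<Rightarrow> 'w \<Rightarrow> real ^ 'm" and P
    and B :: "(real ^ 'd) set" and l :: "real ^ 'm \<Rightarrow> real ^ 'd \<Rightarrow> real" and p q \<beta>s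
begin

text \<open>After multiplication by \<open>sqrt n\<close> the quadratic terms are O(1 /
  \<open>sqrt n\<close>), by the cost bound and the size of
  \<open>u /\<^sub>R sqrt (real n)\<close>. The tail term is split by Young's inequality into s
  times the rescaled cost and a sample mean of the squared tail divided by s. The good event
  concerns sample means only, hence the uniformity in \<pi> and u.\<close>

lemma score_expansion_integral:
  assumes L: "0 \<le> L" and R: "0 \<le> R" and e: "0 < e"
  shows "whp M (\<lambda>n \<omega>. \<forall>\<pi> u. near_coupling n (\<lambda>i. X i \<omega>) L \<pi> \<longrightarrow> norm u \<le> R \<longrightarrow>
    integrable \<pi> (\<lambda>z. dbeta l B (snd z) (\<beta>s + u /\<^sub>R sqrt (real n))) \<and>
    norm (sqrt (real n) *\<^sub>R (\<integral>z. dbeta l B (snd z) (\<beta>s + u /\<^sub>R sqrt (real n)) \<partial>\<pi>)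
      - (C *v u + score_shift n (\<lambda>i. X i \<omega>) \<pi>)) \<le> e)"
proof -
  from score_error_bound obtain \<kappa> \<rho> K where \<rho>: "0 < \<rho>" "ball \<beta>s \<rho> \<subseteq> interior B" and \<kappa>0: "\<forall>x. 0 \<le> \<kappa> x"
    and K: "0 \<le> K"
    and \<kappa>m [measurable]: "\<kappa> \<in> borel_measurable borel" and \<kappa>2: "integrable P (\<lambda>x. (\<kappa> x)\<^sup>2)"
    and DxK0: "\<forall>x v. norm (Dx x *v v) \<le> \<kappa> x * norm v"
    and bound0: "\<forall>N x y w. 0 \<le> N \<longrightarrow> norm w < \<rho> \<longrightarrow>
      norm (dbeta l B y (\<beta>s + w) - h x - Dx x *v (y - x) - Db x *v w)
        \<le> (2 * N + N / \<rho> + K) * (norm (y - x))\<^sup>2 + 2 * \<kappa> x * (norm w)\<^sup>2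
          + 2 * (if N < \<kappa> x then \<kappa> x else 0) * norm (y - x)"
    by (elim exE conjE)
  note \<kappa> = \<kappa>0[rule_format] and DxK = DxK0[rule_format] and bound = bound0[rule_format]
  interpret P: prob_space P by (rule P_prob)
  have \<kappa>1: "integrable P \<kappa>"
    by (rule P.square_integrable_imp_integrable[OF _ \<kappa>2]) simp
  \<comment> \<open>The order of choices matters: s is small relative to the cost bound L, and then
    N is so large that the tail stays small after division by s.\<close>
  define s where "s = e / (8 * (L + 1))"
  have s: "0 < s" "s * L \<le> e / 8"
    using e L by (auto simp: s_def field_simps)
  have es: "0 < e * s / 8" using e s by simp
  obtain N :: nat where N: "\<bar>\<integral>x. (if \<kappa> x > real N then (\<kappa> x)\<^sup>2 else 0) \<partial>P\<bar> < e * s / 8"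
    using integral_tail_small[OF \<kappa>2 _ es, of \<kappa>] by auto
  define t where "t x = (if real N < \<kappa> x then \<kappa> x else 0)" for x
  have [measurable]: "t \<in> borel_measurable borel" unfolding t_def by measurable
  have t2: "(t x)\<^sup>2 = (if real N < \<kappa> x then (\<kappa> x)\<^sup>2 else 0)" for x by (simp add: t_def)
  have t2_int: "integrable P (\<lambda>x. (t x)\<^sup>2)"
    by (rule Bochner_Integration.integrable_bound[OF \<kappa>2]) (auto simp: t2)
  define A where "A = 2 * real N + real N / \<rho> + K"
  have A: "0 \<le> A" using \<rho> K by (simp add: A_def)
  define \<delta> where "\<delta> = e / (4 * (R + 1))"
  have \<delta>: "0 < \<delta>" "\<delta> * R \<le> e / 4" using e R by (auto simp: \<delta>_def field_simps)
  define k1 where "k1 = integral\<^sup>L P \<kappa> + 1"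
  let ?m = "\<lambda>n \<omega>. sample_mean n (\<lambda>i. X i \<omega>)"
  have good: "whp M (\<lambda>n \<omega>. \<bar>?m n \<omega> \<kappa> - integral\<^sup>L P \<kappa>\<bar> < 1 \<and>
      \<bar>?m n \<omega> (\<lambda>x. (t x)\<^sup>2) - (\<integral>x. (t x)\<^sup>2 \<partial>P)\<bar> < e * s / 8 \<and>
      norm (?m n \<omega> Db - integral\<^sup>L P Db) < \<delta>)"
    by (intro whp_conj weak_law_real weak_law \<kappa>1 t2_int Db_integrable es \<delta> zero_less_one)
  have ev: "\<forall>\<^sub>F n in sequentially. R / sqrt (real n) < \<rho> \<and> (A * L) / sqrt (real n) < e / 8 \<and>
      (2 * R\<^sup>2 * k1) / sqrt (real n) < e / 8 \<and> 1 \<le> n"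
    using \<rho>(1) e
    by (intro eventually_conj order_tendstoD(2)[OF lim_const_over_sqrt] eventually_ge_at_top) auto
  show ?thesis
  proof (rule whp_mono[OF good ev], intro allI impI, goal_cases)
    case (1 n \<omega> \<pi> u)
    have elim: "R / sqrt (real n) < \<rho>" "(A * L) / sqrt (real n) < e / 8"
      "(2 * R\<^sup>2 * k1) / sqrt (real n) < e / 8" "1 \<le> n"
      using 1(1) by auto
    note * = 1(3) and \<pi> = 1(4) and u = 1(5)
    have n: "n \<ge> 1" and rn: "0 < sqrt (real n)" using elim by auto
    let ?x = "\<lambda>i. X i \<omega>" and ?r = "sqrt (real n)"
    define w where "w = u /\<^sub>R sqrt (real n)"
    have w_le: "norm w \<le> R / ?r" using u rn by (simp add: w_def field_simps)
    then have w: "norm w < \<rho>" using elim by simp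
    have w_int: "\<beta>s + w \<in> interior B" using w \<rho>(2) by (auto simp: subset_iff dist_norm)
    have score_m [measurable]: "(\<lambda>y. dbeta l B y (\<beta>s + w)) \<in> borel_measurable borel"
      by (intro borel_measurable_continuous_onI continuous_score w_int)
    let ?D = "\<lambda>z. norm (snd z - fst z)"
    define E where "E z = dbeta l B (snd z) (\<beta>s + w) - h (fst z) - Dx (fst z) *v (snd z - fst z) - Db (fst z) *v w"
      for z
    have E_m [measurable]: "E \<in> borel_measurable (borel \<Otimes>\<^sub>M borel)"
      unfolding E_def by measurable
    have E_le: "norm (E z) \<le> A * (?D z)\<^sup>2 + 2 * \<kappa> (fst z) * (norm w)\<^sup>2 + 2 * t (fst z) * ?D z" for z
      using bound[of "real N" w "snd z" "fst z"] w by (simp add: E_def A_def t_def)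
    \<comment> \<open>The weight c is left free: 1 suffices for integrability, while the estimate
      takes \<open>s * sqrt n\<close>, which balances a displacement of order 1 /
      \<open>sqrt n\<close>.\<close>
    have young: "2 * t x * d \<le> c * d\<^sup>2 + (t x)\<^sup>2 / c" if "0 < c" for x d c
    proof -
      have "0 \<le> (c * d - t x)\<^sup>2 / c" using that by simp
      also have "\<dots> = c * d\<^sup>2 + (t x)\<^sup>2 / c - 2 * t x * d"
        using that by (simp add: power2_eq_square field_simps)
      finally show ?thesis by simp
    qed
    have E_le': "norm (E z) \<le> (A + c) * (?D z)\<^sup>2 + (2 * \<kappa> (fst z) * (norm w)\<^sup>2 + (t (fst z))\<^sup>2 / c)" if "0 < c" for z c
      using E_le[of z] young[OF that, of "fst z" "?D z"] by (simp add: algebra_simps)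
    have E_int: "integrable \<pi> E"
      by (rule near_coupling_integrable_product[OF n \<pi>, of _ "\<lambda>x. 2 * \<kappa> x * (norm w)\<^sup>2 + (t x)\<^sup>2 / 1" "A + 1"])
         (use E_le'[of 1] in auto)
    have Dx_int: "integrable \<pi> (\<lambda>z. Dx (fst z) *v (snd z - fst z))"
    proof (rule near_coupling_integrable_product[OF n \<pi>, of _ "\<lambda>x. (\<kappa> x)\<^sup>2" 1])
      fix z :: "(real ^ 'm) \<times> (real ^ 'm)"
      have "\<kappa> (fst z) * ?D z \<le> 1 * (?D z)\<^sup>2 + (\<kappa> (fst z))\<^sup>2"
        using zero_le_power2[of "\<kappa> (fst z) - ?D z"] \<kappa>[of "fst z"]
          mult_nonneg_nonneg[OF \<kappa>[of "fst z"] norm_ge_zero[of "snd z - fst z"]]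
        unfolding power2_diff by linarith
      then show "norm (Dx (fst z) *v (snd z - fst z)) \<le> 1 * (?D z)\<^sup>2 + (\<kappa> (fst z))\<^sup>2"
        using DxK[of "fst z" "snd z - fst z"] by linarith
    qed measurable
    note h_int = near_coupling_fst[OF n \<pi> h_measurable]
    have Dbw_m: "(\<lambda>x. Db x *v w) \<in> borel_measurable borel" by measurable
    note Db_int = near_coupling_fst[OF n \<pi> Dbw_m]
    have decomp: "dbeta l B (snd z) (\<beta>s + w) = E z + h (fst z) + Dx (fst z) *v (snd z - fst z) + Db (fst z) *v w" for z
      by (simp add: E_def)
    have int: "integrable \<pi> (\<lambda>z. dbeta l B (snd z) (\<beta>s + w))"
      unfolding decomp by (intro Bochner_Integration.integrable_add E_int h_int Dx_int Db_int)
    have val: "(\<integral>z. dbeta l B (snd z) (\<beta>s + w) \<partial>\<pi>) = integral\<^sup>L \<pi> E + ?m n \<omega> h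
        + (\<integral>z. Dx (fst z) *v (snd z - fst z) \<partial>\<pi>) + ?m n \<omega> (\<lambda>x. Db x *v w)"
      unfolding decomp
      by (simp add: E_int h_int Dx_int Db_int Bochner_Integration.integrable_add)
    have Dbw: "?r *\<^sub>R ?m n \<omega> (\<lambda>x. Db x *v w) = ?m n \<omega> Db *v u"
    proof -
      have lin: "linear (\<lambda>A :: real ^ 'd ^ 'd. A *v w)"
        by (intro linearI) (simp_all add: matrix_vector_mult_add_rdistrib scaleR_matrix_vector_assoc)
      have "?m n \<omega> (\<lambda>x. Db x *v w) = ?m n \<omega> Db *v w"
        unfolding sample_mean_def
        by (simp add: linear_sum[OF lin] linear_scale[OF lin])
      moreover have "?r *\<^sub>R w = u" using rn by (simp add: w_def)
      ultimately show ?thesis by (metis matrix_vector_mult_scaleR)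
    qed
    have "?r *\<^sub>R (\<integral>z. dbeta l B (snd z) (\<beta>s + w) \<partial>\<pi>) - (C *v u + score_shift n ?x \<pi>)
        = ?r *\<^sub>R integral\<^sup>L \<pi> E + (?m n \<omega> Db - C) *v u"
      unfolding val score_shift_def
      by (simp add: scaleR_add_right Dbw matrix_vector_mult_diff_rdistrib)
    also have "norm \<dots> \<le> ?r * norm (integral\<^sup>L \<pi> E) + norm ((?m n \<omega> Db - C) *v u)"
      using norm_triangle_ineq[of "?r *\<^sub>R integral\<^sup>L \<pi> E" "(?m n \<omega> Db - C) *v u"] rn by simp
    also have "norm ((?m n \<omega> Db - C) *v u) \<le> e / 4"
    proof -
      have "norm ((?m n \<omega> Db - C) *v u) \<le> norm (?m n \<omega> Db - C) * norm u"
        by (rule norm_mult_vec_le_norm)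
      also have "\<dots> \<le> \<delta> * R"
        using * u \<delta> by (intro mult_mono) (auto simp: mean_hessian_def less_imp_le)
      finally show ?thesis using \<delta> by simp
    qed
    also have "?r * norm (integral\<^sup>L \<pi> E) \<le> 5 * e / 8"
    proof -
      have c: "0 < s * ?r" using s rn by simp
      let ?G = "\<lambda>z. (A + s * ?r) * (?D z)\<^sup>2 + (2 * \<kappa> (fst z) * (norm w)\<^sup>2 + (t (fst z))\<^sup>2 / (s * ?r))"
      note D_int = near_coupling_increment[OF n \<pi>]
      have f_m: "(\<lambda>x. 2 * \<kappa> x * (norm w)\<^sup>2 + (t x)\<^sup>2 / (s * ?r)) \<in> borel_measurable borel"
        by measurable
      note f_int = near_coupling_fst[OF n \<pi> f_m]
      have "norm (integral\<^sup>L \<pi> E) \<le> (\<integral>z. norm (E z) \<partial>\<pi>)" by (rule integral_norm_bound)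
      also have "\<dots> \<le> (\<integral>z. ?G z \<partial>\<pi>)"
        using E_int D_int f_int by (intro integral_mono E_le'[OF c]) auto
      also have "\<dots> = (A + s * ?r) * (\<integral>z. (?D z)\<^sup>2 \<partial>\<pi>)
          + ?m n \<omega> (\<lambda>x. 2 * \<kappa> x * (norm w)\<^sup>2 + (t x)\<^sup>2 / (s * ?r))"
        using D_int f_int by simp
      also have "?m n \<omega> (\<lambda>x. 2 * \<kappa> x * (norm w)\<^sup>2 + (t x)\<^sup>2 / (s * ?r))
          = 2 * (norm w)\<^sup>2 * ?m n \<omega> \<kappa> + ?m n \<omega> (\<lambda>x. (t x)\<^sup>2) / (s * ?r)"
        by (simp add: sample_mean_def sum.distrib algebra_simps
              flip: sum_distrib_left sum_distrib_right sum_divide_distrib)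
      finally have "?r * norm (integral\<^sup>L \<pi> E) \<le> ?r * ((A + s * ?r) * (\<integral>z. (?D z)\<^sup>2 \<partial>\<pi>)
          + (2 * (norm w)\<^sup>2 * ?m n \<omega> \<kappa> + ?m n \<omega> (\<lambda>x. (t x)\<^sup>2) / (s * ?r)))"
        using rn by (intro mult_left_mono) auto
      also have "\<dots> = (A / ?r + s) * (real n * (\<integral>z. (?D z)\<^sup>2 \<partial>\<pi>))
          + 2 * (?r * (norm w)\<^sup>2) * ?m n \<omega> \<kappa> + ?m n \<omega> (\<lambda>x. (t x)\<^sup>2) / s"
      proof -
        have eq: "r * ((A + s * r) * I + (2 * W * k + T / (s * r)))
            = (A / r + s) * ((r * r) * I) + 2 * (r * W) * k + T / s" if "0 < r" for r I W k T :: real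
          using that s(1) by (simp add: field_simps)
        show ?thesis using eq[OF rn] by simp
      qed
      \<comment> \<open>The summands are, in order, the cost terms, the quadratic term of the
        parameter and the tail; with \<open>e / 4\<close> for the Hessian average the total stays
        below e.\<close>
      also have "\<dots> \<le> e / 4 + e / 8 + e / 4"
      proof (intro add_mono)
        have "(A / ?r + s) * (real n * (\<integral>z. (?D z)\<^sup>2 \<partial>\<pi>)) \<le> (A / ?r + s) * L"
          using D_int A s rn by (intro mult_left_mono) auto
        also have "\<dots> = (A * L) / ?r + s * L" by (simp add: algebra_simps)
        also have "\<dots> \<le> e / 4" using elim(2) s(2) by linarith
        finally show "(A / ?r + s) * (real n * (\<integral>z. (?D z)\<^sup>2 \<partial>\<pi>)) \<le> e / 4" .
        have "(norm w)\<^sup>2 \<le> (R / ?r)\<^sup>2" using w_le by (intro power_mono) auto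
        then have "?r * (norm w)\<^sup>2 \<le> ?r * (R / ?r)\<^sup>2" using rn by (intro mult_left_mono) auto
        also have "\<dots> = R\<^sup>2 / ?r" using rn by (simp add: power2_eq_square field_simps)
        finally have rw: "?r * (norm w)\<^sup>2 \<le> R\<^sup>2 / ?r" .
        have mk: "?m n \<omega> \<kappa> \<le> k1" "0 \<le> ?m n \<omega> \<kappa>"
          using * \<kappa> by (auto simp: k1_def sample_mean_def intro!: mult_nonneg_nonneg sum_nonneg)
        have "2 * (?r * (norm w)\<^sup>2) * ?m n \<omega> \<kappa> \<le> 2 * (R\<^sup>2 / ?r) * k1"
          using rw mk rn by (intro mult_mono) auto
        also have "\<dots> \<le> e / 8" using elim by (simp add: mult.assoc)
        finally show "2 * (?r * (norm w)\<^sup>2) * ?m n \<omega> \<kappa> \<le> e / 8" .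
        have "?m n \<omega> (\<lambda>x. (t x)\<^sup>2) \<le> e * s / 4" using * N[folded t2] by linarith
        then show "?m n \<omega> (\<lambda>x. (t x)\<^sup>2) / s \<le> e / 4" using s(1) by (simp add: field_simps)
      qed
      finally show ?thesis by simp
    qed
    finally have "norm (?r *\<^sub>R (\<integral>z. dbeta l B (snd z) (\<beta>s + w) \<partial>\<pi>) - (C *v u + score_shift n ?x \<pi>)) \<le> e"
      using e by simp
    with int show ?case by (simp add: w_def)
  qed
qed

end

subsection \<open>Location of risk minimizers\<close>

lemma risk_minimizers_iff:
  "\<beta> \<in> risk_minimizers l B Q \<longleftrightarrow> \<beta> \<in> B \<and> (\<forall>b\<in>B. (\<integral>x. l x \<beta> \<partial>Q) \<le> (\<integral>x. l x b \<partial>Q))"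
  by (auto simp: risk_minimizers_def is_arg_min_def not_less)

context robust_loss
begin

lemma risk_snd:
  assumes n: "n \<ge> 1" and \<pi>: "near_coupling n x L \<pi>" and b: "b \<in> B"
  shows "(\<integral>y. l y b \<partial>(distr \<pi> borel snd)) = (\<integral>z. l (snd z) b \<partial>\<pi>)"
proof -
  have "snd \<in> measurable \<pi> borel" unfolding near_coupling_measurable_cong[OF n \<pi>] by measurable
  from integral_distr[OF this loss_integrable(2)[OF n \<pi> b]] show ?thesis .
qed

text \<open>In the local parameter u the risk is multiplied by n, so that its subgradient is
  \<open>sqrt n\<close> times the mean score and its curvature is of order one.\<close>

lemma risk_minimizers_rescale:
  assumes n: "n \<ge> 1" and \<pi>: "near_coupling n x L \<pi>"
  defines "f \<equiv> \<lambda>u. real n * (\<integral>z. l (snd z) (\<beta>s + u /\<^sub>R sqrt (real n)) \<partial>\<pi>)"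
  shows "\<beta>s + u /\<^sub>R sqrt (real n) \<in> risk_minimizers l B (distr \<pi> borel snd) \<longleftrightarrow>
    \<beta>s + u /\<^sub>R sqrt (real n) \<in> B \<and> (\<forall>v. \<beta>s + v /\<^sub>R sqrt (real n) \<in> B \<longrightarrow> f u \<le> f v)"
proof -
  have all: "(\<forall>b\<in>B. Q b) \<longleftrightarrow> (\<forall>v. \<beta>s + v /\<^sub>R sqrt (real n) \<in> B \<longrightarrow> Q (\<beta>s + v /\<^sub>R sqrt (real n)))" for Q
  proof
    assume *: "\<forall>v. \<beta>s + v /\<^sub>R sqrt (real n) \<in> B \<longrightarrow> Q (\<beta>s + v /\<^sub>R sqrt (real n))"
    show "\<forall>b\<in>B. Q b"
    proof
      fix b assume "b \<in> B"
      then show "Q b" using *[rule_format, of "sqrt (real n) *\<^sub>R (b - \<beta>s)"] n by simp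
    qed
  qed auto
  show ?thesis
    unfolding risk_minimizers_iff all f_def
    using n by (auto simp: risk_snd[OF n \<pi>])
qed

lemma risk_subgradient:
  assumes n: "n \<ge> 1" and \<pi>: "near_coupling n x L \<pi>"
    and int: "integrable \<pi> (\<lambda>z. dbeta l B (snd z) (\<beta>s + u /\<^sub>R sqrt (real n)))"
    and u: "\<beta>s + u /\<^sub>R sqrt (real n) \<in> interior B" and v: "\<beta>s + v /\<^sub>R sqrt (real n) \<in> B"
  defines "f \<equiv> \<lambda>u. real n * (\<integral>z. l (snd z) (\<beta>s + u /\<^sub>R sqrt (real n)) \<partial>\<pi>)"
  shows "f v \<ge> f u + (sqrt (real n) *\<^sub>R (\<integral>z. dbeta l B (snd z) (\<beta>s + u /\<^sub>R sqrt (real n)) \<partial>\<pi>)) \<bullet> (v - u)"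
proof -
  let ?b = "\<lambda>u. \<beta>s + u /\<^sub>R sqrt (real n)"
  have uB: "?b u \<in> B" using u interior_subset by blast
  note li = loss_integrable(1)[OF n \<pi> uB] loss_integrable(1)[OF n \<pi> v]
  have "(\<integral>z. l (snd z) (?b u) + dbeta l B (snd z) (?b u) \<bullet> (?b v - ?b u) \<partial>\<pi>) \<le> (\<integral>z. l (snd z) (?b v) \<partial>\<pi>)"
    using li int by (intro integral_mono loss_above_tangent u v) auto
  then have le: "(\<integral>z. l (snd z) (?b u) \<partial>\<pi>) + (\<integral>z. dbeta l B (snd z) (?b u) \<partial>\<pi>) \<bullet> (?b v - ?b u)
      \<le> (\<integral>z. l (snd z) (?b v) \<partial>\<pi>)"
    using li int by simp
  have "real n * ((\<integral>z. dbeta l B (snd z) (?b u) \<partial>\<pi>) \<bullet> (?b v - ?b u))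
      = (sqrt (real n) *\<^sub>R (\<integral>z. dbeta l B (snd z) (?b u) \<partial>\<pi>)) \<bullet> (v - u)"
  proof -
    have "?b v - ?b u = (v - u) /\<^sub>R sqrt (real n)" by (simp add: scaleR_diff_right)
    moreover have "real n * inverse (sqrt (real n)) = sqrt (real n)"
      using n by (simp add: real_div_sqrt flip: divide_inverse)
    ultimately show ?thesis by (simp add: mult.assoc[symmetric])
  qed
  with mult_left_mono[OF le, of "real n"] show ?thesis
    by (simp add: f_def distrib_left)
qed

end

context robust_sample
begin

lemma eventually_local_parameter:
  assumes "0 \<le> R"
  shows "\<forall>\<^sub>F n in sequentially. \<forall>u. norm u \<le> R \<longrightarrow> \<beta>s + u /\<^sub>R sqrt (real n) \<in> interior B"
proof -
  obtain \<rho> where \<rho>: "0 < \<rho>" "ball \<beta>s \<rho> \<subseteq> interior B"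
    using interior open_interior[of B] by (meson open_contains_ball)
  have "\<forall>\<^sub>F n in sequentially. R / sqrt (real n) < \<rho>"
    by (rule order_tendstoD(2)[OF lim_const_over_sqrt \<rho>(1)])
  then show ?thesis
    using eventually_ge_at_top[of 1]
  proof eventually_elim
    case (elim n)
    show ?case
    proof (intro allI impI)
      fix u :: "real ^ 'd" assume u: "norm u \<le> R"
      have "norm (u /\<^sub>R sqrt (real n)) \<le> R / sqrt (real n)"
        using u elim by (simp add: field_simps)
      then have "\<beta>s + u /\<^sub>R sqrt (real n) \<in> ball \<beta>s \<rho>" using elim by (simp add: dist_norm)
      then show "\<beta>s + u /\<^sub>R sqrt (real n) \<in> interior B" using \<rho> by blast
    qed
  qed
qed

text \<open>The necessary half of the optimality condition, for the miss direction: any compatible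
  parameter in the local ball approximately solves the linear equation of its own plan, on an event
  common to all plans.\<close>

lemma minimizer_score_equation:
  assumes L: "0 \<le> L" and R: "0 \<le> R" and e: "0 < e"
  shows "whp M (\<lambda>n \<omega>. \<forall>\<pi> u. near_coupling n (\<lambda>i. X i \<omega>) L \<pi> \<longrightarrow> norm u < R \<longrightarrow>
    \<beta>s + u /\<^sub>R sqrt (real n) \<in> risk_minimizers l B (distr \<pi> borel snd) \<longrightarrow>
    norm (C *v u + score_shift n (\<lambda>i. X i \<omega>) \<pi>) \<le> e)"
proof (rule whp_mono[OF score_expansion_integral[OF L R e]
      eventually_conj[OF eventually_local_parameter[OF R] eventually_ge_at_top[of 1]]],
    intro allI impI, goal_cases)
  case (1 n \<omega> \<pi> u)
  note * = 1(3) and \<pi> = 1(4) and u = 1(5) and min = 1(6)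
  have n: "n \<ge> 1" using 1(1) by simp
  note exp = *[rule_format, OF \<pi>]
  note int = 1(1)[THEN conjunct1, rule_format]
  let ?S = "{v. \<beta>s + v /\<^sub>R sqrt (real n) \<in> B}"
  show "norm (C *v u + score_shift n (\<lambda>i. X i \<omega>) \<pi>) \<le> e"
  proof (rule approx_gradient_at_minimizer[where R=R and S="?S" and u=u and
        f="\<lambda>u. real n * (\<integral>z. l (snd z) (\<beta>s + u /\<^sub>R sqrt (real n)) \<partial>\<pi>)" and
        F="\<lambda>u. sqrt (real n) *\<^sub>R (\<integral>z. dbeta l B (snd z) (\<beta>s + u /\<^sub>R sqrt (real n)) \<partial>\<pi>)"])
    fix u v :: "real ^ 'd" assume u: "norm u \<le> R" and v: "v \<in> ?S"
    show "real n * (\<integral>z. l (snd z) (\<beta>s + u /\<^sub>R sqrt (real n)) \<partial>\<pi>)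
        + (sqrt (real n) *\<^sub>R (\<integral>z. dbeta l B (snd z) (\<beta>s + u /\<^sub>R sqrt (real n)) \<partial>\<pi>)) \<bullet> (v - u)
        \<le> real n * (\<integral>z. l (snd z) (\<beta>s + v /\<^sub>R sqrt (real n)) \<partial>\<pi>)"
      using v by (intro risk_subgradient[OF n \<pi>] int u exp[THEN conjunct1]) simp
  next
    show "cball 0 R \<subseteq> ?S" using int interior_subset[of B] by auto
  next
    fix v assume "v \<in> ?S"
    then show "real n * (\<integral>z. l (snd z) (\<beta>s + u /\<^sub>R sqrt (real n)) \<partial>\<pi>)
        \<le> real n * (\<integral>z. l (snd z) (\<beta>s + v /\<^sub>R sqrt (real n)) \<partial>\<pi>)"
      using min unfolding risk_minimizers_rescale[OF n \<pi>] by blast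
  qed (use exp u in auto)
qed

text \<open>The sufficient half, for the hit direction and for the empirical minimizer: near the
  solution of the linear equation a minimizer exists, and every minimizer over B, however far away a
  priori, lies there.\<close>

lemma minimizer_location:
  assumes L: "0 \<le> L" and H: "0 \<le> H" and e: "0 < e"
  shows "whp M (\<lambda>n \<omega>. \<forall>\<pi> u. near_coupling n (\<lambda>i. X i \<omega>) L \<pi> \<longrightarrow>
    C *v u + score_shift n (\<lambda>i. X i \<omega>) \<pi> = 0 \<longrightarrow> norm (score_shift n (\<lambda>i. X i \<omega>) \<pi>) \<le> H \<longrightarrow>
    risk_minimizers l B (distr \<pi> borel snd) \<noteq> {} \<and>
    (\<forall>\<beta>\<in>risk_minimizers l B (distr \<pi> borel snd). norm (sqrt (real n) *\<^sub>R (\<beta> - \<beta>s) - u) < e))"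
proof -
  obtain c where c: "0 < c" "\<And>v. c * (norm v)\<^sup>2 \<le> v \<bullet> (C *v v)"
    using pos_def_lower_bound[OF C_pos_def] by blast
  \<comment> \<open>The solution of the linear equation has norm at most \<open>H / c\<close>, and
    the search ball around it has radius e.\<close>
  define R where "R = H / c + e"
  have R: "0 \<le> R" using H c e by (simp add: R_def)
  define e' where "e' = c * e / 8"
  have e': "0 < e'" "4 * e' < c * e" using c e by (auto simp: e'_def)
  show ?thesis
  proof (rule whp_mono[OF score_expansion_integral[OF L R e'(1)]
        eventually_conj[OF eventually_local_parameter[OF R] eventually_ge_at_top[of 1]]],
      intro allI impI, goal_cases)
    case (1 n \<omega> \<pi> u0)
    note * = 1(3) and \<pi> = 1(4) and u0 = 1(5) and H = 1(6)
    have n: "n \<ge> 1" using 1(1) by simp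
    note exp = *[rule_format, OF \<pi>]
    note int = 1(1)[THEN conjunct1, rule_format]
    let ?S = "{v. \<beta>s + v /\<^sub>R sqrt (real n) \<in> B}"
    let ?f = "\<lambda>u. real n * (\<integral>z. l (snd z) (\<beta>s + u /\<^sub>R sqrt (real n)) \<partial>\<pi>)"
    let ?F = "\<lambda>u. sqrt (real n) *\<^sub>R (\<integral>z. dbeta l B (snd z) (\<beta>s + u /\<^sub>R sqrt (real n)) \<partial>\<pi>)"
    have sub: "?f u + ?F u \<bullet> (v - u) \<le> ?f v" if "norm u \<le> R" "v \<in> ?S" for u v
      using that by (intro risk_subgradient[OF n \<pi>] int exp[THEN conjunct1]) auto
    have lin: "norm (?F u - (C *v u + score_shift n (\<lambda>i. X i \<omega>) \<pi>)) \<le> e'" if "norm u \<le> R" for u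
      using exp that by blast
    have ball: "cball 0 R \<subseteq> ?S" using int interior_subset[of B] by auto
    have "c * norm u0 \<le> norm (C *v u0)" by (rule norm_le_of_lower_bound[OF c])
    also have "C *v u0 = - score_shift n (\<lambda>i. X i \<omega>) \<pi>"
      using u0 by (simp add: eq_neg_iff_add_eq_0)
    finally have "c * norm u0 \<le> H" using H by simp
    then have "norm u0 \<le> H / c" using c by (simp add: field_simps)
    then have r: "norm u0 + e \<le> R" by (simp add: R_def)
    note min = minimizer_near_approx_zero[where R=R and S="?S" and f="?f" and F="?F",
        OF _ _ ball c(2) u0 e r e'(2)]
    show "risk_minimizers l B (distr \<pi> borel snd) \<noteq> {} \<and>
      (\<forall>\<beta>\<in>risk_minimizers l B (distr \<pi> borel snd). norm (sqrt (real n) *\<^sub>R (\<beta> - \<beta>s) - u0) < e)"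
    proof
      have "\<exists>u\<in>?S. \<forall>v\<in>?S. ?f u \<le> ?f v"
        by (rule min(1); (rule sub lin; assumption))
      then obtain u where "u \<in> ?S" "\<forall>v\<in>?S. ?f u \<le> ?f v" by blast
      then have "\<beta>s + u /\<^sub>R sqrt (real n) \<in> risk_minimizers l B (distr \<pi> borel snd)"
        unfolding risk_minimizers_rescale[OF n \<pi>] by blast
      then show "risk_minimizers l B (distr \<pi> borel snd) \<noteq> {}" by blast
      show "\<forall>\<beta>\<in>risk_minimizers l B (distr \<pi> borel snd). norm (sqrt (real n) *\<^sub>R (\<beta> - \<beta>s) - u0) < e"
      proof
        fix \<beta> assume \<beta>: "\<beta> \<in> risk_minimizers l B (distr \<pi> borel snd)"
        define u where "u = sqrt (real n) *\<^sub>R (\<beta> - \<beta>s)"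
        have "\<beta> = \<beta>s + u /\<^sub>R sqrt (real n)" using n by (simp add: u_def)
        with \<beta> have "\<beta>s + u /\<^sub>R sqrt (real n) \<in> risk_minimizers l B (distr \<pi> borel snd)" by simp
        then have u: "u \<in> ?S" "\<And>v. v \<in> ?S \<Longrightarrow> ?f u \<le> ?f v"
          unfolding risk_minimizers_rescale[OF n \<pi>] by blast+
        show "norm (sqrt (real n) *\<^sub>R (\<beta> - \<beta>s) - u0) < e"
          unfolding u_def[symmetric] by (rule min(2); (rule u(1) | rule sub lin u(2); assumption))
      qed
    qed
  qed
qed

end

subsection \<open>Conjugate sublevel sets and transport neighbourhoods\<close>

lemma inner_matrix_vector_mult_transpose:
  fixes A :: "real ^ 'k ^ 'r"
  shows "\<xi> \<bullet> (A *v v) = (transpose A *v \<xi>) \<bullet> v"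
  by (simp add: dot_lmul_matrix[symmetric] transpose_matrix_vector)

lemma mem_conjugate_sublevel:
  "u \<in> conjugate_sublevel f A \<eta> \<longleftrightarrow> (\<forall>\<xi>. \<xi> \<bullet> (A *v u) - f \<xi> \<le> \<eta>)"
  by (simp add: conjugate_sublevel_def convex_conjugate_def SUP_le_iff)

lemma closed_conjugate_sublevel: "closed (conjugate_sublevel f A \<eta>)"
proof -
  have "conjugate_sublevel f A \<eta> = (\<Inter>\<xi>. {u. \<xi> \<bullet> (A *v u) \<le> \<eta> + f \<xi>})"
    by (auto simp: mem_conjugate_sublevel diff_le_eq)
  moreover have "closed {u. \<xi> \<bullet> (A *v u) \<le> \<eta> + f \<xi>}" for \<xi>
    by (intro closed_Collect_le continuous_intros linear_continuous_on) auto
  ultimately show ?thesis by auto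
qed

text \<open>Each point of K violates one of the defining inequalities with a margin, and this
  persists nearby. A finite subcover leaves finitely many \<xi> and a common margin, so pointwise
  laws of large numbers for the quadratic forms suffice.\<close>

lemma compact_miss_conjugate_sublevel:
  assumes K: "compact K" "conjugate_sublevel f A \<eta> \<inter> K = {}"
  obtains \<Xi> \<gamma> where "finite \<Xi>" "0 < \<gamma>" "\<And>u. u \<in> K \<Longrightarrow> \<exists>\<xi>\<in>\<Xi>. \<eta> + \<gamma> < \<xi> \<bullet> (A *v u) - f \<xi>"
proof -
  let ?U = "\<lambda>(\<xi>, k :: nat). {u. \<eta> + 1 / (real k + 1) < \<xi> \<bullet> (A *v u) - f \<xi>}"
  have cont: "continuous_on UNIV ((*v) A)" by (rule linear_continuous_on) simp
  have op: "open (?U c)" for c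
    unfolding case_prod_beta by (intro open_Collect_less continuous_intros cont)
  have cover: "K \<subseteq> (\<Union>c\<in>UNIV. ?U c)"
  proof
    fix u assume "u \<in> K"
    then have "u \<notin> conjugate_sublevel f A \<eta>" using K by blast
    then obtain \<xi> where "\<eta> < \<xi> \<bullet> (A *v u) - f \<xi>" by (auto simp: mem_conjugate_sublevel not_le)
    then have "0 < \<xi> \<bullet> (A *v u) - f \<xi> - \<eta>" by simp
    then obtain k :: nat where "inverse (real (Suc k)) < \<xi> \<bullet> (A *v u) - f \<xi> - \<eta>"
      using reals_Archimedean by blast
    then have "u \<in> ?U (\<xi>, k)" by (simp add: inverse_eq_divide add.commute)
    then show "u \<in> (\<Union>c\<in>UNIV. ?U c)" by blast
  qed
  obtain D where D: "D \<subseteq> UNIV" "finite D" "K \<subseteq> (\<Union>c\<in>D. ?U c)"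
    by (rule compactE_image[OF K(1) op cover])
  \<comment> \<open>The largest index gives the smallest margin; the inserted 0 covers an empty
    D.\<close>
  define m where "m = Max (insert 0 (snd ` D))"
  show thesis
  proof (rule that[of "fst ` D" "1 / (real m + 1)"])
    fix u assume "u \<in> K"
    then obtain \<xi> k where k: "(\<xi>, k) \<in> D" "\<eta> + 1 / (real k + 1) < \<xi> \<bullet> (A *v u) - f \<xi>"
      using D(3) by force
    then have "k \<le> m" using D(2) by (force simp: m_def intro!: Max_ge)
    then have "1 / (real m + 1) \<le> 1 / (real k + 1)" by (simp add: frac_le)
    then have "\<eta> + 1 / (real m + 1) < \<xi> \<bullet> (A *v u) - f \<xi>" using k by linarith
    then show "\<exists>\<xi>\<in>fst ` D. \<eta> + 1 / (real m + 1) < \<xi> \<bullet> (A *v u) - f \<xi>"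
      using k(1) by force
  qed (use D in auto)
qed

section \<open>Wasserstein balls in terms of plans\<close>

lemma ambiguity_set_mono:
  assumes "\<delta> \<le> \<delta>'"
  shows "ambiguity_set c \<delta> Q \<subseteq> ambiguity_set c \<delta>' Q"
  using assms
  by (auto simp: ambiguity_set_def intro: order_trans[OF _ ennreal_leI[OF real_sqrt_le_mono]])

text \<open>\<open>enn2real\<close> sends infinity to 0, so finiteness of the cost has to be secured
  before the square root can be undone.\<close>

lemma ambiguity_set_transport_cost:
  assumes "Q \<in> ambiguity_set c \<delta> P" "0 \<le> \<delta>"
  shows "transport_cost c P Q \<le> ennreal \<delta>"
proof -
  have w: "wasserstein c P Q \<le> ennreal (sqrt \<delta>)" using assms by (simp add: ambiguity_set_def)
  then have fin: "transport_cost c P Q \<noteq> \<top>" by (auto simp: wasserstein_def top_unique)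
  then have "sqrt (enn2real (transport_cost c P Q)) \<le> sqrt \<delta>"
    using w assms(2) by (simp add: wasserstein_def)
  then have "enn2real (transport_cost c P Q) \<le> \<delta>" by simp
  then have "ennreal (enn2real (transport_cost c P Q)) \<le> ennreal \<delta>" by (rule ennreal_leI)
  with fin show ?thesis by (simp add: ennreal_enn2real_if)
qed

lemma ambiguity_setI:
  assumes "prob_space Q" "sets Q = sets borel" "0 \<le> \<delta>" "transport_cost c P Q \<le> ennreal \<delta>"
  shows "Q \<in> ambiguity_set c \<delta> P"
proof -
  have fin: "transport_cost c P Q \<noteq> \<top>" using assms(4) by (auto simp: top_unique)
  have "enn2real (transport_cost c P Q) \<le> \<delta>"
    using enn2real_mono[OF assms(4)] assms(3) by simp
  then show ?thesis
    using assms fin by (simp add: ambiguity_set_def wasserstein_def ennreal_leI)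
qed

text \<open>The cost is an infimum; the slack between \<delta> and \<delta>' pays for choosing an
  actual plan. The cardinality in L converts the q-norm of the cost into the Euclidean norm of
  \<open>near_coupling\<close>.\<close>

lemma ambiguity_set_near_coupling:
  fixes x :: "nat \<Rightarrow> real ^ 'm" and c :: "real ^ 'm \<Rightarrow> real ^ 'm \<Rightarrow> real"
  assumes q: "1 < q" and c: "\<And>u w. c u w = (lp_norm q (u - w))\<^sup>2"
    and n: "n \<ge> 1" and Q: "Q \<in> ambiguity_set c \<delta> (empirical_measure n x)"
    and \<delta>: "0 \<le> \<delta>" "\<delta> < \<delta>'" and L: "(real CARD('m))\<^sup>2 * (real n * \<delta>') \<le> L"
  shows "\<exists>\<pi>. near_coupling n x L \<pi> \<and> distr \<pi> borel snd = Q \<and>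
    integrable \<pi> (\<lambda>z. (lp_norm q (snd z - fst z))\<^sup>2) \<and>
    (\<integral>z. (lp_norm q (snd z - fst z))\<^sup>2 \<partial>\<pi>) \<le> \<delta>'"
proof -
  have "transport_cost c (empirical_measure n x) Q < ennreal \<delta>'"
    using ambiguity_set_transport_cost[OF Q \<delta>(1)] \<delta> by (auto simp: ennreal_less_iff intro: le_less_trans)
  then obtain \<pi> where \<pi>: "\<pi> \<in> couplings (empirical_measure n x) Q"
    and cost: "(\<integral>\<^sup>+ (x, y). ennreal (c x y) \<partial>\<pi>) < ennreal \<delta>'"
    unfolding transport_cost_def by (auto simp: INF_less_iff)
  have sets: "sets \<pi> = sets (borel \<Otimes>\<^sub>M borel)" using \<pi> by (simp add: couplings_def)
  then have meas: "borel_measurable \<pi> = borel_measurable (borel \<Otimes>\<^sub>M borel)"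
    by (intro measurable_cong_sets) auto
  let ?g = "\<lambda>z. (lp_norm q (snd z - fst z))\<^sup>2"
  have g_m: "?g \<in> borel_measurable \<pi>" unfolding meas by measurable
  have g_nn: "(\<integral>\<^sup>+ z. ennreal (?g z) \<partial>\<pi>) < ennreal \<delta>'"
    using cost by (simp add: c lp_norm_minus_commute case_prod_unfold)
  have g_int: "integrable \<pi> ?g"
  proof (rule integrableI_nonneg[OF g_m])
    show "(\<integral>\<^sup>+ z. ennreal (?g z) \<partial>\<pi>) < \<infinity>"
      using less_trans[OF g_nn ennreal_less_top] by simp
  qed simp
  have g_le: "integral\<^sup>L \<pi> ?g \<le> \<delta>'"
  proof -
    have "(\<integral>\<^sup>+ z. ennreal (?g z) \<partial>\<pi>) = ennreal (integral\<^sup>L \<pi> ?g)"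
      by (rule nn_integral_eq_integral[OF g_int]) simp
    then show ?thesis using g_nn \<delta> by (simp add: ennreal_less_iff)
  qed
  have norm_le: "(norm (snd z - fst z))\<^sup>2 \<le> (real CARD('m))\<^sup>2 * ?g z" for z :: "(real ^ 'm) \<times> (real ^ 'm)"
    unfolding power_mult_distrib[symmetric]
    using norm_le_lp_norm[of q "snd z - fst z"] q by (intro power_mono) auto
  have int: "integrable \<pi> (\<lambda>z. (norm (snd z - fst z))\<^sup>2)"
  proof (rule Bochner_Integration.integrable_bound)
    show "integrable \<pi> (\<lambda>z. (real CARD('m))\<^sup>2 * ?g z)" using g_int by simp
    show "(\<lambda>z. (norm (snd z - fst z))\<^sup>2) \<in> borel_measurable \<pi>" unfolding meas by measurable
    show "AE z in \<pi>. norm ((norm (snd z - fst z))\<^sup>2) \<le> norm ((real CARD('m))\<^sup>2 * ?g z)"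
      using norm_le by (intro AE_I2) simp
  qed
  have "(\<integral>z. (norm (snd z - fst z))\<^sup>2 \<partial>\<pi>) \<le> (\<integral>z. (real CARD('m))\<^sup>2 * ?g z \<partial>\<pi>)"
    using int g_int norm_le by (intro integral_mono) auto
  also have "\<dots> \<le> (real CARD('m))\<^sup>2 * \<delta>'" using g_le by (simp add: mult_left_mono)
  finally have "real n * (\<integral>z. (norm (snd z - fst z))\<^sup>2 \<partial>\<pi>) \<le> real n * ((real CARD('m))\<^sup>2 * \<delta>')"
    by (intro mult_left_mono) auto
  also have "\<dots> \<le> L" using L by (simp add: mult_ac)
  finally have "near_coupling n x L \<pi>"
    using \<pi> int sets by (simp add: near_coupling_def couplings_def)
  with \<pi> g_int g_le show ?thesis by (auto simp: couplings_def)
qed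

text \<open>The plan induced by a displacement field. With step 1 / \<open>sqrt n\<close> its cost
  is the sample mean of the squared q-norm of v divided by n, which matches the radius
  \<eta>/n.\<close>

definition shift_coupling :: "nat \<Rightarrow> (nat \<Rightarrow> real ^ 'm) \<Rightarrow> (real ^ 'm \<Rightarrow> real ^ 'm) \<Rightarrow>
    ((real ^ 'm) \<times> (real ^ 'm)) measure" where
  "shift_coupling n x v =
    distr (empirical_measure n x) (borel \<Otimes>\<^sub>M borel) (\<lambda>y. (y, y + v y /\<^sub>R sqrt (real n)))"

lemma sample_mean_mono:
  assumes "\<And>y. f y \<le> (g y :: real)"
  shows "sample_mean n x f \<le> sample_mean n x g"
  unfolding sample_mean_def by (intro scaleR_left_mono sum_mono assms) auto

lemma sample_mean_cmult: "sample_mean n x (\<lambda>y. a * f y) = a * sample_mean n x (f :: _ \<Rightarrow> real)"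
  by (simp add: sample_mean_def sum_distrib_left mult.left_commute)

lemma sample_mean_scaleR: "sample_mean n x (\<lambda>y. a *\<^sub>R f y) = a *\<^sub>R sample_mean n x f"
  by (simp add: sample_mean_def scaleR_sum_right mult.commute)

context
  fixes n :: nat and x :: "nat \<Rightarrow> real ^ 'm" and v :: "real ^ 'm \<Rightarrow> real ^ 'm"
  assumes n: "n \<ge> 1" and v [measurable]: "v \<in> borel_measurable borel"
begin

lemma shift_measurable:
  "(\<lambda>y. (y, y + v y /\<^sub>R sqrt (real n))) \<in> measurable (empirical_measure n x) (borel \<Otimes>\<^sub>M borel)"
  by measurable

lemma integral_shift_coupling:
  fixes f :: "(real ^ 'm) \<times> (real ^ 'm) \<Rightarrow> 'b::euclidean_space"
  assumes f [measurable]: "f \<in> borel_measurable (borel \<Otimes>\<^sub>M borel)"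
  shows "integrable (shift_coupling n x v) f"
    and "integral\<^sup>L (shift_coupling n x v) f = sample_mean n x (\<lambda>y. f (y, y + v y /\<^sub>R sqrt (real n)))"
proof -
  have m: "(\<lambda>y. f (y, y + v y /\<^sub>R sqrt (real n))) \<in> borel_measurable borel" by measurable
  show "integrable (shift_coupling n x v) f"
    unfolding shift_coupling_def integrable_distr_eq[OF shift_measurable f]
    by (rule integrable_empirical_measure[OF n m])
  show "integral\<^sup>L (shift_coupling n x v) f = sample_mean n x (\<lambda>y. f (y, y + v y /\<^sub>R sqrt (real n)))"
    unfolding shift_coupling_def integral_distr[OF shift_measurable f]
    by (rule integral_empirical_measure[OF n m])
qed

lemma shift_coupling_couplings:
  "shift_coupling n x v \<in> couplings (empirical_measure n x)
    (distr (empirical_measure n x) borel (\<lambda>y. y + v y /\<^sub>R sqrt (real n)))"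
proof -
  have "distr (shift_coupling n x v) borel fst = distr (empirical_measure n x) borel (\<lambda>y. y)"
    unfolding shift_coupling_def by (subst distr_distr[OF _ shift_measurable]) (auto simp: comp_def)
  also have "\<dots> = empirical_measure n x" by (rule distr_id2) simp
  finally have 1: "distr (shift_coupling n x v) borel fst = empirical_measure n x" .
  have 2: "distr (shift_coupling n x v) borel snd = distr (empirical_measure n x) borel (\<lambda>y. y + v y /\<^sub>R sqrt (real n))"
    unfolding shift_coupling_def by (subst distr_distr[OF _ shift_measurable]) (auto simp: comp_def)
  have "prob_space (shift_coupling n x v)"
    unfolding shift_coupling_def
    by (rule prob_space.prob_space_distr[OF prob_space_empirical_measure[OF n] shift_measurable])
  then show ?thesis
    using 1 2 by (simp add: couplings_def shift_coupling_def)
qed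

lemma real_n_scaled_square: "real n * (a * inverse (sqrt (real n)))\<^sup>2 = a\<^sup>2"
  using n by (simp add: power_mult_distrib power_inverse)

lemma near_coupling_shift:
  assumes "sample_mean n x (\<lambda>y. (norm (v y))\<^sup>2) \<le> L"
  shows "near_coupling n x L (shift_coupling n x v)"
proof -
  have f: "(\<lambda>z :: (real ^ 'm) \<times> (real ^ 'm). (norm (snd z - fst z))\<^sup>2) \<in> borel_measurable (borel \<Otimes>\<^sub>M borel)"
    by measurable
  have "real n * (\<integral>z. (norm (snd z - fst z))\<^sup>2 \<partial>shift_coupling n x v) = sample_mean n x (\<lambda>y. (norm (v y))\<^sup>2)"
    unfolding integral_shift_coupling(2)[OF f] sample_mean_cmult[symmetric]
    using real_n_scaled_square[of "norm (v _)"] by (simp add: mult.commute)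
  then show ?thesis
    using assms integral_shift_coupling(1)[OF f] shift_coupling_couplings
    by (simp add: near_coupling_def couplings_def)
qed

lemma shift_coupling_ambiguity_set:
  fixes c :: "real ^ 'm \<Rightarrow> real ^ 'm \<Rightarrow> real"
  assumes q: "1 < q" and c: "\<And>u w. c u w = (lp_norm q (u - w))\<^sup>2"
    and \<eta>: "sample_mean n x (\<lambda>y. (lp_norm q (v y))\<^sup>2) \<le> \<eta>" "0 \<le> \<eta>"
  shows "distr (shift_coupling n x v) borel snd \<in> ambiguity_set c (\<eta> / real n) (empirical_measure n x)"
proof (rule ambiguity_setI)
  note \<pi> = shift_coupling_couplings
  let ?Q = "distr (empirical_measure n x) borel (\<lambda>y. y + v y /\<^sub>R sqrt (real n))"
  have Q: "distr (shift_coupling n x v) borel snd = ?Q" using \<pi> by (simp add: couplings_def)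
  show "prob_space (distr (shift_coupling n x v) borel snd)"
    unfolding Q by (rule prob_space.prob_space_distr[OF prob_space_empirical_measure[OF n]]) measurable
  show "0 \<le> \<eta> / real n" using \<eta> by simp
  have f: "(\<lambda>z :: (real ^ 'm) \<times> (real ^ 'm). (lp_norm q (fst z - snd z))\<^sup>2) \<in> borel_measurable (borel \<Otimes>\<^sub>M borel)"
    by measurable
  have eq: "(lp_norm q (y - (y + v y /\<^sub>R sqrt (real n))))\<^sup>2 = (inverse (sqrt (real n)))\<^sup>2 * (lp_norm q (v y))\<^sup>2" for y
    using q by (simp add: lp_norm_scaleR power_mult_distrib)
  have inv: "(inverse (sqrt (real n)))\<^sup>2 = 1 / real n" by (simp add: power_divide inverse_eq_divide)
  have "(\<integral>\<^sup>+ (x, y). ennreal (c x y) \<partial>shift_coupling n x v)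
      = (\<integral>\<^sup>+ z. ennreal ((lp_norm q (fst z - snd z))\<^sup>2) \<partial>shift_coupling n x v)"
    by (simp add: c case_prod_unfold)
  also have "\<dots> = ennreal (\<integral>z. (lp_norm q (fst z - snd z))\<^sup>2 \<partial>shift_coupling n x v)"
    by (rule nn_integral_eq_integral[OF integral_shift_coupling(1)[OF f]]) simp
  also have "(\<integral>z. (lp_norm q (fst z - snd z))\<^sup>2 \<partial>shift_coupling n x v)
      = (1 / real n) * sample_mean n x (\<lambda>y. (lp_norm q (v y))\<^sup>2)"
    unfolding integral_shift_coupling(2)[OF f] fst_conv snd_conv eq inv by (rule sample_mean_cmult)
  also have "ennreal \<dots> \<le> ennreal (\<eta> / real n)"
    using \<eta> by (intro ennreal_leI) (simp add: divide_right_mono)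
  finally show "transport_cost c (empirical_measure n x) (distr (shift_coupling n x v) borel snd) \<le> ennreal (\<eta> / real n)"
    unfolding transport_cost_def Q using \<pi> by (rule INF_lower2[rotated])
qed simp

end

text \<open>The zero field exhibits the empirical measure as its own perturbation, so the empirical
  minimizer falls under the general location result.\<close>

lemma shift_coupling_zero:
  assumes "n \<ge> 1"
  shows "distr (shift_coupling n x (\<lambda>_. 0)) borel snd = empirical_measure n x"
  using shift_coupling_couplings[OF assms, of "\<lambda>_. 0" x]
  by (simp add: couplings_def distr_id2)

subsection \<open>Duality for the linearized transport problem\<close>

lemma empirical_form_eq:
  "empirical_form p l B n x \<beta>s \<xi> =
    1 / 4 * sample_mean n x (\<lambda>y. (lp_norm p (transpose (dx_h l B y \<beta>s) *v \<xi>))\<^sup>2)"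
  by (simp add: empirical_form_def sample_mean_def inverse_eq_divide)

declare transpose_matrix_vector [simp del]

text \<open>The weight \<open>1 / 4\<close> is the one in \<open>limit_form\<close>: it is what
  makes the square of the displacement appear with coefficient 1.\<close>

lemma young_square: "a * b \<le> a\<^sup>2 / 4 + b\<^sup>2" for a b :: real
  using zero_le_power2[of "a / 2 - b"] by (simp add: power2_diff power_divide)

lemma mult_le_sum_squares: "a * b \<le> a\<^sup>2 + b\<^sup>2" for a b :: real
proof -
  have "2 * (a * b) \<le> a\<^sup>2 + b\<^sup>2" using sum_squares_bound[of a b] by (simp add: mult.assoc)
  moreover have "0 \<le> a\<^sup>2 + b\<^sup>2" by simp
  ultimately show ?thesis by linarith
qed

lemma convex_combination_square_le:
  fixes a b s t :: real
  assumes "0 \<le> s" "0 \<le> t" "s + t = 1"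
  shows "(s * a + t * b)\<^sup>2 \<le> s * a\<^sup>2 + t * b\<^sup>2"
proof -
  have s: "s = 1 - t" using assms by simp
  have "s * a\<^sup>2 + t * b\<^sup>2 - (s * a + t * b)\<^sup>2 = s * t * (a - b)\<^sup>2"
    unfolding s by (simp add: power2_eq_square algebra_simps)
  moreover have "0 \<le> s * t * (a - b)\<^sup>2" using assms by simp
  ultimately show ?thesis by linarith
qed

context robust_loss
begin

lemma borel_measurable_P: "borel_measurable P = borel_measurable borel"
  by (rule measurable_cong_sets[OF sets_P' refl])

abbreviation "\<phi> \<equiv> limit_form p l B P \<beta>s"

abbreviation "a \<equiv> \<lambda>\<xi> x. lp_norm p (transpose (Dx x) *v \<xi>)"

lemma Dx_bound:
  "\<exists>\<kappa>. \<kappa> \<in> borel_measurable borel \<and> integrable P (\<lambda>x. (\<kappa> x)\<^sup>2) \<and> (\<forall>x. 0 \<le> \<kappa> x) \<and>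
    (\<forall>x v. norm (Dx x *v v) \<le> \<kappa> x * norm v) \<and> (\<forall>x \<xi>. a \<xi> x \<le> \<kappa> x * norm \<xi>)"
proof -
  obtain K \<rho> where K: "0 \<le> K" "0 < \<rho>"
    "\<And>x \<beta> v. dist \<beta> \<beta>s < \<rho> \<Longrightarrow> norm (dx_h l B x \<beta> *v v) \<le> K * (1 + norm x) * norm v"
    by (rule dx_h_growth) blast
  interpret P: prob_space P by (rule P_prob)
  define \<kappa> where "\<kappa> x = real CARD('m) * K * (1 + norm x)" for x :: "real ^ 'm"
  have m1: "1 \<le> real CARD('m)" by (simp add: Suc_leI)
  have Dx: "norm (Dx x *v v) \<le> K * (1 + norm x) * norm v" for x v using K by simp
  \<comment> \<open>The growth bound passes to the transpose by testing against its own image: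
    \<open>norm ?t * norm ?t\<close> equals \<open>\<xi> \<bullet> (Dx x *v ?t)\<close>, and one
    factor cancels.\<close>
  have tr: "norm (transpose (Dx x) *v \<xi>) \<le> K * (1 + norm x) * norm \<xi>" for x \<xi>
  proof (cases "transpose (Dx x) *v \<xi> = 0")
    case True
    then show ?thesis using K(1) by simp
  next
    case False
    let ?t = "transpose (Dx x) *v \<xi>"
    have "norm ?t * norm ?t = \<xi> \<bullet> (Dx x *v ?t)"
      by (simp only: inner_matrix_vector_mult_transpose[of \<xi>] dot_square_norm power2_eq_square)
    also have "\<dots> \<le> norm \<xi> * norm (Dx x *v ?t)" by (rule norm_cauchy_schwarz)
    also have "\<dots> \<le> norm \<xi> * (K * (1 + norm x) * norm ?t)" by (intro mult_left_mono Dx) simp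
    also have "\<dots> = (K * (1 + norm x) * norm \<xi>) * norm ?t" by (simp add: mult_ac)
    finally show ?thesis using False by (simp only: mult_le_cancel_right) auto
  qed
  have scale: "K * (1 + norm x) \<le> \<kappa> x" for x
    using mult_right_mono[OF m1, of "K * (1 + norm x)"] K(1) by (simp add: \<kappa>_def mult_ac)
  show ?thesis
  proof (intro exI[of _ \<kappa>] conjI allI)
    show "\<kappa> \<in> borel_measurable borel" unfolding \<kappa>_def by measurable
    show "integrable P (\<lambda>x. (\<kappa> x)\<^sup>2)"
      unfolding \<kappa>_def using sets_P' second_moment
      by (intro square_integrable_add square_integrable_cmult)
        (auto cong: measurable_cong_sets)
    show "0 \<le> \<kappa> x" for x using K(1) by (simp add: \<kappa>_def)
    show "norm (Dx x *v v) \<le> \<kappa> x * norm v" for x v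
      using Dx[of x v] mult_right_mono[OF scale[of x], of "norm v"] by simp
    show "a \<xi> x \<le> \<kappa> x * norm \<xi>" for x \<xi>
    proof -
      have "a \<xi> x \<le> CARD('m) * norm (transpose (Dx x) *v \<xi>)"
        using p by (intro lp_norm_le_norm) simp
      also have "\<dots> \<le> CARD('m) * (K * (1 + norm x) * norm \<xi>)" by (intro mult_left_mono tr) simp
      finally show ?thesis by (simp add: \<kappa>_def mult_ac)
    qed
  qed
qed

lemma a_measurable [measurable]: "a \<xi> \<in> borel_measurable borel"
proof -
  have "(\<lambda>x. transpose (Dx x)) \<in> borel_measurable borel"
    by (rule borel_measurable_continuous_onI)
       (auto simp: transpose_def intro!: continuous_intros continuous_dx_h interior)
  then show ?thesis by measurable
qed

lemma a_square_integrable: "integrable P (\<lambda>x. (a \<xi> x)\<^sup>2)"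
proof -
  from Dx_bound obtain \<kappa> where \<kappa>: "\<kappa> \<in> borel_measurable borel" "integrable P (\<lambda>x. (\<kappa> x)\<^sup>2)"
    "\<forall>x \<xi>. a \<xi> x \<le> \<kappa> x * norm \<xi>" by (elim exE conjE)
  show ?thesis
  proof (rule Bochner_Integration.integrable_bound)
    show "integrable P (\<lambda>x. (norm \<xi> * \<kappa> x)\<^sup>2)" using \<kappa> by (intro square_integrable_cmult)
    show "(\<lambda>x. (a \<xi> x)\<^sup>2) \<in> borel_measurable P"
      unfolding borel_measurable_P by measurable
    show "AE x in P. norm ((a \<xi> x)\<^sup>2) \<le> norm ((norm \<xi> * \<kappa> x)\<^sup>2)"
      using \<kappa>(3) by (intro AE_I2) (simp add: power_mono mult.commute)
  qed
qed

lemma \<phi>_eq: "\<phi> \<xi> = 1 / 4 * (\<integral>x. (a \<xi> x)\<^sup>2 \<partial>P)"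
  by (simp add: limit_form_def)

lemma \<phi>_nonneg: "0 \<le> \<phi> \<xi>"
  by (simp add: \<phi>_eq)

lemma \<phi>_scaleR: "\<phi> (t *\<^sub>R \<xi>) = t\<^sup>2 * \<phi> \<xi>"
proof -
  have "a (t *\<^sub>R \<xi>) x = \<bar>t\<bar> * a \<xi> x" for x
    using p by (simp add: matrix_vector_mult_scaleR lp_norm_scaleR)
  then show ?thesis by (simp add: \<phi>_eq power_mult_distrib)
qed

lemma inner_Dx_le: "\<xi> \<bullet> (Dx x *v v) \<le> a \<xi> x * lp_norm q v"
  unfolding inner_matrix_vector_mult_transpose by (rule lp_norm_Holder[OF q pq])

text \<open>The displacement fields of finite mean energy, over which the linearized transport
  problem is posed.\<close>

definition admissible :: "(real ^ 'm \<Rightarrow> real ^ 'm) \<Rightarrow> bool" where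
  "admissible v \<longleftrightarrow> v \<in> borel_measurable borel \<and> integrable P (\<lambda>x. (lp_norm q (v x))\<^sup>2)"

lemma admissible_measurable: "admissible v \<Longrightarrow> v \<in> borel_measurable borel"
  and admissible_integrable: "admissible v \<Longrightarrow> integrable P (\<lambda>x. (lp_norm q (v x))\<^sup>2)"
  by (auto simp: admissible_def)

lemma norm_square_le_lp_norm: "(norm v)\<^sup>2 \<le> (real CARD('m))\<^sup>2 * (lp_norm q v)\<^sup>2" for v :: "real ^ 'm"
  unfolding power_mult_distrib[symmetric]
  using norm_le_lp_norm[of q v] q by (intro power_mono) auto

lemma admissible_Dx_integrable:
  assumes "admissible v"
  shows "integrable P (\<lambda>x. Dx x *v v x)"
proof -
  have [measurable]: "v \<in> borel_measurable borel" by (rule admissible_measurable[OF assms])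
  from Dx_bound obtain \<kappa> where \<kappa>: "\<kappa> \<in> borel_measurable borel" "integrable P (\<lambda>x. (\<kappa> x)\<^sup>2)"
    "\<forall>x. 0 \<le> \<kappa> x" "\<forall>x v. norm (Dx x *v v) \<le> \<kappa> x * norm v" by (elim exE conjE)
  show ?thesis
  proof (rule Bochner_Integration.integrable_bound)
    show "integrable P (\<lambda>x. (\<kappa> x)\<^sup>2 + (real CARD('m))\<^sup>2 * (lp_norm q (v x))\<^sup>2)"
      using \<kappa> admissible_integrable[OF assms] by simp
    show "(\<lambda>x. Dx x *v v x) \<in> borel_measurable P"
      unfolding borel_measurable_P by measurable
    show "AE x in P. norm (Dx x *v v x) \<le> norm ((\<kappa> x)\<^sup>2 + (real CARD('m))\<^sup>2 * (lp_norm q (v x))\<^sup>2)"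
    proof (intro AE_I2)
      fix x
      have "norm (Dx x *v v x) \<le> \<kappa> x * norm (v x)" using \<kappa> by blast
      also have "\<dots> \<le> (\<kappa> x)\<^sup>2 + (norm (v x))\<^sup>2"
        by (rule mult_le_sum_squares)
      also have "\<dots> \<le> (\<kappa> x)\<^sup>2 + (real CARD('m))\<^sup>2 * (lp_norm q (v x))\<^sup>2"
        using norm_square_le_lp_norm[of "v x"] by simp
      finally show "norm (Dx x *v v x) \<le> norm ((\<kappa> x)\<^sup>2 + (real CARD('m))\<^sup>2 * (lp_norm q (v x))\<^sup>2)"
        by simp
    qed
  qed
qed

text \<open>Convexity of the energy, from Minkowski's inequality and convexity of the square; it
  makes the set of attainable shifts in \<open>dual_witness\<close> convex.\<close>

lemma admissible_convex:
  assumes v: "admissible v" and w: "admissible w" and t: "0 \<le> s" "0 \<le> t" "s + t = 1"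
  shows "admissible (\<lambda>x. s *\<^sub>R v x + t *\<^sub>R w x)"
    and "(\<integral>x. (lp_norm q (s *\<^sub>R v x + t *\<^sub>R w x))\<^sup>2 \<partial>P)
      \<le> s * (\<integral>x. (lp_norm q (v x))\<^sup>2 \<partial>P) + t * (\<integral>x. (lp_norm q (w x))\<^sup>2 \<partial>P)"
proof -
  have [measurable]: "v \<in> borel_measurable borel" "w \<in> borel_measurable borel"
    using v w by (auto intro: admissible_measurable)
  have le: "(lp_norm q (s *\<^sub>R v x + t *\<^sub>R w x))\<^sup>2 \<le> s * (lp_norm q (v x))\<^sup>2 + t * (lp_norm q (w x))\<^sup>2" for x
  proof -
    have "lp_norm q (s *\<^sub>R v x + t *\<^sub>R w x) \<le> s * lp_norm q (v x) + t * lp_norm q (w x)"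
      using lp_norm_triangle[OF q, of "s *\<^sub>R v x" "t *\<^sub>R w x"] q t by (simp add: lp_norm_scaleR)
    then have "(lp_norm q (s *\<^sub>R v x + t *\<^sub>R w x))\<^sup>2 \<le> (s * lp_norm q (v x) + t * lp_norm q (w x))\<^sup>2"
      by (intro power_mono) auto
    also have "\<dots> \<le> s * (lp_norm q (v x))\<^sup>2 + t * (lp_norm q (w x))\<^sup>2"
      by (rule convex_combination_square_le[OF t])
    finally show ?thesis .
  qed
  have int: "integrable P (\<lambda>x. s * (lp_norm q (v x))\<^sup>2 + t * (lp_norm q (w x))\<^sup>2)"
    by (intro Bochner_Integration.integrable_add integrable_mult_right admissible_integrable v w)
  have i: "integrable P (\<lambda>x. (lp_norm q (s *\<^sub>R v x + t *\<^sub>R w x))\<^sup>2)"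
  proof (rule Bochner_Integration.integrable_bound[OF int])
    show "(\<lambda>x. (lp_norm q (s *\<^sub>R v x + t *\<^sub>R w x))\<^sup>2) \<in> borel_measurable P"
      unfolding borel_measurable_P by measurable
    show "AE x in P. norm ((lp_norm q (s *\<^sub>R v x + t *\<^sub>R w x))\<^sup>2)
        \<le> norm (s * (lp_norm q (v x))\<^sup>2 + t * (lp_norm q (w x))\<^sup>2)"
    proof (intro AE_I2)
      fix x
      show "norm ((lp_norm q (s *\<^sub>R v x + t *\<^sub>R w x))\<^sup>2)
          \<le> norm (s * (lp_norm q (v x))\<^sup>2 + t * (lp_norm q (w x))\<^sup>2)"
        using le[of x] by simp
    qed
  qed
  then show "admissible (\<lambda>x. s *\<^sub>R v x + t *\<^sub>R w x)" by (simp add: admissible_def)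
  have "(\<integral>x. (lp_norm q (s *\<^sub>R v x + t *\<^sub>R w x))\<^sup>2 \<partial>P)
      \<le> (\<integral>x. s * (lp_norm q (v x))\<^sup>2 + t * (lp_norm q (w x))\<^sup>2 \<partial>P)"
    by (intro integral_mono i int le)
  then show "(\<integral>x. (lp_norm q (s *\<^sub>R v x + t *\<^sub>R w x))\<^sup>2 \<partial>P)
      \<le> s * (\<integral>x. (lp_norm q (v x))\<^sup>2 \<partial>P) + t * (\<integral>x. (lp_norm q (w x))\<^sup>2 \<partial>P)"
    using v w by (simp add: admissible_integrable)
qed

text \<open>
  Strong duality for the transport problem linearized at \<open>\<beta>s\<close>, obtained by separating a point from
  the convex set of attainable shifts; the dual direction of each score derivative contradicts the
  separation.
\<close>

lemma dual_witness:
  assumes \<zeta>: "\<And>\<xi>. \<xi> \<bullet> \<zeta> - \<phi> \<xi> \<le> \<eta>" and \<eta>: "0 < \<eta>" and e: "0 < e"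
  obtains v where "admissible v" "(\<integral>x. (lp_norm q (v x))\<^sup>2 \<partial>P) < \<eta>"
    "norm ((\<integral>x. Dx x *v v x \<partial>P) - \<zeta>) < e"
proof -
  \<comment> \<open>The strict inequality is deliberate: it leaves room for the sample version of
    the energy to exceed its expectation. Only the closure of S has to contain \<zeta>.\<close>
  define S where "S = {(\<integral>x. Dx x *v v x \<partial>P) | v. admissible v \<and> (\<integral>x. (lp_norm q (v x))\<^sup>2 \<partial>P) < \<eta>}"
  have "convex S"
  proof (rule convexI)
    fix y z and s t :: real assume y: "y \<in> S" and z: "z \<in> S" and st: "0 \<le> s" "0 \<le> t" "s + t = 1"
    obtain v where v: "admissible v" "(\<integral>x. (lp_norm q (v x))\<^sup>2 \<partial>P) < \<eta>" "y = (\<integral>x. Dx x *v v x \<partial>P)"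
      using y unfolding S_def by blast
    obtain w where w: "admissible w" "(\<integral>x. (lp_norm q (w x))\<^sup>2 \<partial>P) < \<eta>" "z = (\<integral>x. Dx x *v w x \<partial>P)"
      using z unfolding S_def by blast
    have "(\<integral>x. (lp_norm q (s *\<^sub>R v x + t *\<^sub>R w x))\<^sup>2 \<partial>P)
        \<le> s * (\<integral>x. (lp_norm q (v x))\<^sup>2 \<partial>P) + t * (\<integral>x. (lp_norm q (w x))\<^sup>2 \<partial>P)"
      by (rule admissible_convex(2)[OF v(1) w(1) st])
    also have "\<dots> < \<eta>" using convex_bound_lt[OF v(2) w(2) st] .
    finally have "(\<integral>x. (lp_norm q (s *\<^sub>R v x + t *\<^sub>R w x))\<^sup>2 \<partial>P) < \<eta>" .
    moreover have "s *\<^sub>R y + t *\<^sub>R z = (\<integral>x. Dx x *v (s *\<^sub>R v x + t *\<^sub>R w x) \<partial>P)"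
      using v w by (simp add: matrix_vector_right_distrib matrix_vector_mult_scaleR admissible_Dx_integrable)
    ultimately show "s *\<^sub>R y + t *\<^sub>R z \<in> S"
      unfolding S_def mem_Collect_eq using admissible_convex(1)[OF v(1) w(1) st]
      by (intro exI[of _ "\<lambda>x. s *\<^sub>R v x + t *\<^sub>R w x"] conjI)
  qed
  have "\<zeta> \<in> closure S"
  proof (rule ccontr)
    assume "\<zeta> \<notin> closure S"
    then obtain d b where db: "d \<bullet> \<zeta> < b" "\<forall>s\<in>closure S. b < d \<bullet> s"
      using separating_hyperplane_closed_point[of "closure S" \<zeta>] \<open>convex S\<close>
      by (auto simp: convex_closure)
    \<comment> \<open>The sign makes \<xi> bounded above on S, as the conjugate asks for a
      supremum.\<close>
    define \<xi> where "\<xi> = - d"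
    define Z where "Z = \<xi> \<bullet> \<zeta>"
    have Z: "- b < Z" and S: "\<And>s. s \<in> S \<Longrightarrow> \<xi> \<bullet> s < - b"
      using db closure_subset[of S] by (auto simp: \<xi>_def Z_def)
    have a2: "(\<integral>x. (a \<xi> x)\<^sup>2 \<partial>P) = 4 * \<phi> \<xi>" by (simp add: \<phi>_eq)
    \<comment> \<open>Multiples of the dual direction attain equality in Hoelder's inequality: at
      scale t the energy is \<open>t\<^sup>2 * (4 * \<phi> \<xi>)\<close> and the pairing with \<xi>
      is \<open>t * (4 * \<phi> \<xi>)\<close>.\<close>
    have test: "t * (4 * \<phi> \<xi>) < - b" if t: "t\<^sup>2 * (4 * \<phi> \<xi>) < \<eta>" for t
    proof -
      define v where "v x = t *\<^sub>R lp_dual p (transpose (Dx x) *v \<xi>)" for x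
      have lp: "(lp_norm q (v x))\<^sup>2 = t\<^sup>2 * (a \<xi> x)\<^sup>2" for x
        using q p by (simp add: v_def lp_norm_scaleR lp_norm_lp_dual[OF q pq p] power_mult_distrib)
      have dot: "\<xi> \<bullet> (Dx x *v v x) = t * (a \<xi> x)\<^sup>2" for x
        unfolding inner_matrix_vector_mult_transpose v_def using p by (simp add: inner_lp_dual)
      have vm: "v \<in> borel_measurable borel"
      proof -
        have 1: "(\<lambda>x. transpose (Dx x) *v \<xi>) \<in> borel_measurable borel"
          by (rule borel_measurable_continuous_onI)
             (auto simp: transpose_def matrix_vector_mult_def intro!: continuous_intros continuous_dx_h interior)
        have 2: "(lp_dual p :: real ^ 'm \<Rightarrow> _) \<in> borel_measurable borel"
          by (rule borel_measurable_lp_dual)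
        show ?thesis unfolding v_def using measurable_compose[OF 1 2] by measurable
      qed
      have v: "admissible v"
        using vm a_square_integrable[of \<xi>] by (simp add: admissible_def lp)
      have "(\<integral>x. (lp_norm q (v x))\<^sup>2 \<partial>P) < \<eta>" using t by (simp only: lp integral_mult_right_zero a2)
      then have "(\<integral>x. Dx x *v v x \<partial>P) \<in> S"
        unfolding S_def mem_Collect_eq using v by (intro exI[of _ v] conjI refl)
      then have "\<xi> \<bullet> (\<integral>x. Dx x *v v x \<partial>P) < - b" by (rule S)
      also have "\<xi> \<bullet> (\<integral>x. Dx x *v v x \<partial>P) = (\<integral>x. \<xi> \<bullet> (Dx x *v v x) \<partial>P)"
        by (rule integral_inner_right[symmetric]) (rule admissible_Dx_integrable[OF v])
      also have "\<dots> = t * (4 * \<phi> \<xi>)" by (simp add: dot a2)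
      finally show ?thesis .
    qed
    \<comment> \<open>The zero field is admissible with energy below \<eta>, so 0 lies in S.\<close>
    have b: "0 < - b" using test[of 0] \<eta> by simp
    have Z\<phi>: "t * Z - t\<^sup>2 * \<phi> \<xi> \<le> \<eta>" for t
      using \<zeta>[of "t *\<^sub>R \<xi>"] by (simp add: \<phi>_scaleR Z_def)
    have "0 < Z" using b Z by simp
    show False
    proof (cases "\<phi> \<xi> = 0")
      case True
      \<comment> \<open>With vanishing form the assumption on \<zeta> is linear along the ray of
        \<xi>; this multiple violates it by a factor of 2.\<close>
      then have "(2 * \<eta> / Z) * Z \<le> \<eta>" using Z\<phi>[of "2 * \<eta> / Z"] by simp
      then show False using \<open>0 < Z\<close> \<eta> by simp
    next
      case False
      then have pos: "0 < \<phi> \<xi>" using \<phi>_nonneg[of \<xi>] by simp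
      \<comment> \<open>At this scale the pairing would equal \<open>- b\<close>, which
        \<open>test\<close> forbids; so the energy must already be at least \<eta>.\<close>
      have "\<eta> \<le> (- b / (4 * \<phi> \<xi>))\<^sup>2 * (4 * \<phi> \<xi>)"
      proof (rule ccontr)
        assume "\<not> ?thesis"
        then have "(- b / (4 * \<phi> \<xi>)) * (4 * \<phi> \<xi>) < - b" by (intro test) simp
        then show False using pos by simp
      qed
      also have "\<dots> = (- b)\<^sup>2 / (4 * \<phi> \<xi>)" using pos by (simp add: power2_eq_square field_simps)
      also have "\<dots> < Z\<^sup>2 / (4 * \<phi> \<xi>)"
        using pos Z b by (intro divide_strict_right_mono power_strict_mono) auto
      \<comment> \<open>\<open>Z / (2 * \<phi> \<xi>)\<close> maximizes
        \<open>t * Z - t\<^sup>2 * \<phi> \<xi>\<close>, so the assumption on \<zeta> is used at its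
        sharpest.\<close>
      also have "\<dots> = Z / (2 * \<phi> \<xi>) * Z - (Z / (2 * \<phi> \<xi>))\<^sup>2 * \<phi> \<xi>"
        using pos by (simp add: power2_eq_square field_simps)
      also have "\<dots> \<le> \<eta>" by (rule Z\<phi>)
      finally show False by simp
    qed
  qed
  then obtain s where "s \<in> S" "dist s \<zeta> < e" using e closure_approachable by blast
  then obtain v where "s = (\<integral>x. Dx x *v v x \<partial>P)" "admissible v" "(\<integral>x. (lp_norm q (v x))\<^sup>2 \<partial>P) < \<eta>"
    unfolding S_def by blast
  with \<open>dist s \<zeta> < e\<close> show thesis by (intro that[of v]) (simp_all add: dist_norm)
qed

text \<open>Hoelder's inequality followed by \<open>young_square\<close>, pointwise and then
  integrated over the plan. It holds for any plan, hence for one obtained from an arbitrary Q in the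
  transport ball.\<close>

lemma coupling_weak_duality:
  assumes n: "n \<ge> 1" and \<pi>: "near_coupling n x L \<pi>"
    and c: "integrable \<pi> (\<lambda>z. (lp_norm q (snd z - fst z))\<^sup>2)"
  shows "sqrt (real n) * (\<xi> \<bullet> (\<integral>z. Dx (fst z) *v (snd z - fst z) \<partial>\<pi>))
    \<le> empirical_form p l B n x \<beta>s \<xi> + real n * (\<integral>z. (lp_norm q (snd z - fst z))\<^sup>2 \<partial>\<pi>)"
proof -
  have a2: "(\<lambda>y. (a \<xi> y)\<^sup>2) \<in> borel_measurable borel" by measurable
  note fa = near_coupling_fst[OF n \<pi> a2]
  let ?D = "\<lambda>z. Dx (fst z) *v (snd z - fst z)"
  have le: "sqrt (real n) * (\<xi> \<bullet> ?D z) \<le> (a \<xi> (fst z))\<^sup>2 / 4 + real n * (lp_norm q (snd z - fst z))\<^sup>2" for z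
  proof -
    have "sqrt (real n) * (\<xi> \<bullet> ?D z) \<le> sqrt (real n) * (a \<xi> (fst z) * lp_norm q (snd z - fst z))"
      by (intro mult_left_mono inner_Dx_le) simp
    also have "\<dots> = a \<xi> (fst z) * (sqrt (real n) * lp_norm q (snd z - fst z))" by (simp add: mult_ac)
    also have "\<dots> \<le> (a \<xi> (fst z))\<^sup>2 / 4 + (sqrt (real n) * lp_norm q (snd z - fst z))\<^sup>2"
      by (rule young_square)
    finally show ?thesis by (simp add: power_mult_distrib)
  qed
  have D: "integrable \<pi> ?D"
  proof -
    from Dx_bound obtain \<kappa> where \<kappa>: "\<kappa> \<in> borel_measurable borel"
      "\<forall>x. 0 \<le> \<kappa> x" "\<forall>x v. norm (Dx x *v v) \<le> \<kappa> x * norm v" by (elim exE conjE)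
    note \<kappa>m [measurable] = \<kappa>(1)
    show ?thesis
    proof (rule near_coupling_integrable_product[OF n \<pi>, of _ "\<lambda>x. (\<kappa> x)\<^sup>2" 1])
      fix z :: "(real ^ 'm) \<times> (real ^ 'm)"
      have "norm (?D z) \<le> \<kappa> (fst z) * norm (snd z - fst z)" using \<kappa> by blast
      also have "\<dots> \<le> 1 * (norm (snd z - fst z))\<^sup>2 + (\<kappa> (fst z))\<^sup>2"
        using mult_le_sum_squares[of "\<kappa> (fst z)" "norm (snd z - fst z)"] by simp
      finally show "norm (?D z) \<le> 1 * (norm (snd z - fst z))\<^sup>2 + (\<kappa> (fst z))\<^sup>2" .
    qed measurable
  qed
  have "sqrt (real n) * (\<xi> \<bullet> integral\<^sup>L \<pi> ?D) = (\<integral>z. sqrt (real n) * (\<xi> \<bullet> ?D z) \<partial>\<pi>)"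
    using D by simp
  also have "\<dots> \<le> (\<integral>z. (a \<xi> (fst z))\<^sup>2 / 4 + real n * (lp_norm q (snd z - fst z))\<^sup>2 \<partial>\<pi>)"
    using D fa c by (intro integral_mono le) auto
  also have "\<dots> = (\<integral>z. (a \<xi> (fst z))\<^sup>2 \<partial>\<pi>) / 4 + real n * (\<integral>z. (lp_norm q (snd z - fst z))\<^sup>2 \<partial>\<pi>)"
    using fa c by simp
  also have "(\<integral>z. (a \<xi> (fst z))\<^sup>2 \<partial>\<pi>) / 4 = empirical_form p l B n x \<beta>s \<xi>"
    unfolding fa(2) empirical_form_eq by simp
  finally show ?thesis .
qed

text \<open>Certifies membership in an empirical sublevel set: an averaged shift produced by a field
  of sample energy at most some level satisfies every defining inequality at that level.\<close>

lemma empirical_weak_duality: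
  "\<xi> \<bullet> sample_mean n x (\<lambda>y. Dx y *v v y)
    \<le> empirical_form p l B n x \<beta>s \<xi> + sample_mean n x (\<lambda>y. (lp_norm q (v y))\<^sup>2)"
proof -
  have "\<xi> \<bullet> sample_mean n x (\<lambda>y. Dx y *v v y) = sample_mean n x (\<lambda>y. \<xi> \<bullet> (Dx y *v v y))"
    by (simp add: sample_mean_def inner_sum_right)
  also have "\<dots> \<le> sample_mean n x (\<lambda>y. 1 / 4 * (a \<xi> y)\<^sup>2 + (lp_norm q (v y))\<^sup>2)"
  proof (rule sample_mean_mono)
    fix y
    show "\<xi> \<bullet> (Dx y *v v y) \<le> 1 / 4 * (a \<xi> y)\<^sup>2 + (lp_norm q (v y))\<^sup>2"
      using inner_Dx_le[of \<xi> y "v y"] young_square[of "a \<xi> y" "lp_norm q (v y)"] by simp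
  qed
  also have "\<dots> = 1 / 4 * sample_mean n x (\<lambda>y. (a \<xi> y)\<^sup>2) + sample_mean n x (\<lambda>y. (lp_norm q (v y))\<^sup>2)"
    unfolding sample_mean_cmult[symmetric] by (simp add: sample_mean_def sum.distrib distrib_left)
  finally show ?thesis unfolding empirical_form_eq .
qed

end

subsection \<open>Convergence of the confidence regions\<close>

context robust_sample
begin

abbreviation scaled_score :: "nat \<Rightarrow> 'w \<Rightarrow> real ^ 'd" where
  "scaled_score n \<omega> \<equiv> sqrt (real n) *\<^sub>R sample_mean n (\<lambda>i. X i \<omega>) h"

lemma scaled_score_tight:
  "0 < \<tau> \<Longrightarrow> \<exists>L. \<forall>n\<ge>1. \<exists>E\<in>sets M. measure M E \<le> \<tau> \<and> (\<forall>\<omega>\<in>space M - E. norm (scaled_score n \<omega>) \<le> L)"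
  by (rule sqrt_n_sample_mean_tight[OF h_measurable h_square_integrable h_mean])

lemma score_shift_shift_coupling:
  assumes n: "n \<ge> 1" and v: "v \<in> borel_measurable borel"
  shows "score_shift n x (shift_coupling n x v)
    = sqrt (real n) *\<^sub>R sample_mean n x h + sample_mean n x (\<lambda>y. Dx y *v v y)"
proof -
  have f: "(\<lambda>z. Dx (fst z) *v (snd z - fst z)) \<in> borel_measurable (borel \<Otimes>\<^sub>M borel)"
    by measurable
  have "(\<integral>z. Dx (fst z) *v (snd z - fst z) \<partial>shift_coupling n x v)
      = inverse (sqrt (real n)) *\<^sub>R sample_mean n x (\<lambda>y. Dx y *v v y)"
    unfolding integral_shift_coupling(2)[OF n v f] sample_mean_scaleR[symmetric]
    by (simp add: matrix_vector_mult_scaleR)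
  then show ?thesis using n by (simp add: score_shift_def)
qed

lemma empirical_form_weak_law:
  assumes "0 < e"
  shows "whp M (\<lambda>n \<omega>. \<bar>empirical_form p l B n (\<lambda>i. X i \<omega>) \<beta>s \<xi> - \<phi> \<xi>\<bar> < e)"
proof -
  have "whp M (\<lambda>n \<omega>. \<bar>sample_mean n (\<lambda>i. X i \<omega>) (\<lambda>y. (a \<xi> y)\<^sup>2) - (\<integral>x. (a \<xi> x)\<^sup>2 \<partial>P)\<bar> < e)"
    by (rule weak_law_real[OF a_square_integrable assms])
  then show ?thesis
    by (rule whp_mono') (simp add: empirical_form_eq \<phi>_eq)
qed

text \<open>The case of zero displacement, with cost bound 0 and intercept H_n. Nonemptiness of the
  set of minimizers is part of the conclusion.\<close>

lemma empirical_minimizer_location: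
  assumes H: "0 \<le> H" and e: "0 < e"
  shows "whp M (\<lambda>n \<omega>. \<forall>u. C *v u + scaled_score n \<omega> = 0 \<longrightarrow> norm (scaled_score n \<omega>) \<le> H \<longrightarrow>
    risk_minimizers l B (empirical_measure n (\<lambda>i. X i \<omega>)) \<noteq> {} \<and>
    (\<forall>\<beta>\<in>risk_minimizers l B (empirical_measure n (\<lambda>i. X i \<omega>)). norm (sqrt (real n) *\<^sub>R (\<beta> - \<beta>s) - u) < e))"
proof (rule whp_mono'[OF minimizer_location[OF order_refl H e]], goal_cases)
  case (1 n \<omega>)
  note n = 1(1) and * = 1(3)
  let ?x = "\<lambda>i. X i \<omega>"
  have m: "(\<lambda>_ :: real ^ 'm. 0 :: real ^ 'm) \<in> borel_measurable borel" by simp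
  have nc: "near_coupling n ?x 0 (shift_coupling n ?x (\<lambda>_. 0))"
    by (rule near_coupling_shift[OF n m]) (simp add: sample_mean_def)
  have ss: "score_shift n ?x (shift_coupling n ?x (\<lambda>_. 0)) = scaled_score n \<omega>"
    by (subst score_shift_shift_coupling[OF n m]) (simp add: sample_mean_def)
  show ?case
    using *[rule_format, OF nc] unfolding ss shift_coupling_zero[OF n] by blast
qed

text \<open>The shift of the data enters the score equation with a minus sign; evenness of \<phi>
  absorbs it in both directions.\<close>

lemma \<phi>_minus: "\<phi> (- \<xi>) = \<phi> \<xi>"
  using \<phi>_scaleR[of "-1" \<xi>] by simp

text \<open>At a point of K some \<xi> of the finite set fails by \<gamma>. The errors of the form,
  of the matrix and of the level cost at most \<open>\<gamma> / 4\<close> each, so the empirical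
  inequality fails as well.\<close>

lemma empirical_conjugate_sublevel_miss:
  assumes K: "compact K" "conjugate_sublevel \<phi> C \<eta> \<inter> K = {}"
    and \<eta>n: "\<eta>n \<longlonglongrightarrow> \<eta>" and Cn: "\<And>e. 0 < e \<Longrightarrow> whp M (\<lambda>n \<omega>. norm (Cn n \<omega> - C) < e)"
  shows "whp M (\<lambda>n \<omega>. conjugate_sublevel (empirical_form p l B n (\<lambda>i. X i \<omega>) \<beta>s) (Cn n \<omega>) (\<eta>n n) \<inter> K = {})"
proof -
  obtain \<Xi> \<gamma> where \<Xi>: "finite \<Xi>" and \<gamma>: "0 < \<gamma>"
    and sep: "\<And>u. u \<in> K \<Longrightarrow> \<exists>\<xi>\<in>\<Xi>. \<eta> + \<gamma> < \<xi> \<bullet> (C *v u) - \<phi> \<xi>"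
    by (rule compact_miss_conjugate_sublevel[OF K]) blast
  obtain k where k: "0 < k" "\<And>u. u \<in> K \<Longrightarrow> norm u \<le> k"
    using compact_imp_bounded[OF K(1)] by (auto simp: bounded_pos)
  define x where "x = Max (insert 0 (norm ` \<Xi>))"
  have x: "0 \<le> x" "\<And>\<xi>. \<xi> \<in> \<Xi> \<Longrightarrow> norm \<xi> \<le> x" using \<Xi> by (auto simp: x_def intro: Max_ge)
  \<comment> \<open>A positive bound for the norms of the \<xi>, so that it may stand in the
    denominator of e.\<close>
  define y where "y = x + 1"
  have y: "0 < y" "x \<le> y" using x by (simp_all add: y_def)
  define e where "e = \<gamma> / (4 * y * k)"
  have e: "0 < e" using \<gamma> k y by (simp add: e_def)
  have xek: "x * (e * k) \<le> \<gamma> / 4"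
  proof -
    have "x * (e * k) \<le> y * (e * k)" using e k y by (intro mult_right_mono) auto
    also have "\<dots> = \<gamma> / 4" using k y by (simp add: e_def)
    finally show ?thesis .
  qed
  have \<gamma>4: "0 < \<gamma> / 4" using \<gamma> by simp
  have good: "whp M (\<lambda>n \<omega>. norm (Cn n \<omega> - C) < e \<and>
      (\<forall>\<xi>\<in>\<Xi>. \<bar>empirical_form p l B n (\<lambda>i. X i \<omega>) \<beta>s \<xi> - \<phi> \<xi>\<bar> < \<gamma> / 4))"
    by (intro whp_conj whp_ball \<Xi> Cn e empirical_form_weak_law \<gamma>4)
  have ev: "\<forall>\<^sub>F n in sequentially. \<eta>n n < \<eta> + \<gamma> / 4"
    using \<gamma> by (intro order_tendstoD(2)[OF \<eta>n]) simp
  show ?thesis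
  proof (rule whp_mono[OF good ev], goal_cases)
    case (1 n \<omega>)
    note elim = 1(1) and * = 1(3)
    let ?f = "empirical_form p l B n (\<lambda>i. X i \<omega>) \<beta>s"
    have False if u: "u \<in> K" "u \<in> conjugate_sublevel ?f (Cn n \<omega>) (\<eta>n n)" for u
    proof -
      obtain \<xi> where \<xi>: "\<xi> \<in> \<Xi>" "\<eta> + \<gamma> < \<xi> \<bullet> (C *v u) - \<phi> \<xi>" using sep[OF u(1)] by blast
      have "\<xi> \<bullet> (Cn n \<omega> *v u) - ?f \<xi> \<le> \<eta>n n" using u(2) by (simp add: mem_conjugate_sublevel)
      moreover have "\<bar>?f \<xi> - \<phi> \<xi>\<bar> < \<gamma> / 4" using * \<xi> by blast
      moreover have "\<bar>\<xi> \<bullet> ((Cn n \<omega> - C) *v u)\<bar> \<le> \<gamma> / 4"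
      proof -
        have "\<bar>\<xi> \<bullet> ((Cn n \<omega> - C) *v u)\<bar> \<le> norm \<xi> * norm ((Cn n \<omega> - C) *v u)"
          by (rule Cauchy_Schwarz_ineq2)
        also have "\<dots> \<le> x * (e * k)"
        proof (rule mult_mono)
          have "norm ((Cn n \<omega> - C) *v u) \<le> norm (Cn n \<omega> - C) * norm u" by (rule norm_mult_vec_le_norm)
          also have "\<dots> \<le> e * k" using * k(2)[OF u(1)] e by (intro mult_mono) auto
          finally show "norm ((Cn n \<omega> - C) *v u) \<le> e * k" .
        qed (use x \<xi> in auto)
        finally show ?thesis using xek by simp
      qed
      moreover have "\<xi> \<bullet> ((Cn n \<omega> - C) *v u) = \<xi> \<bullet> (Cn n \<omega> *v u) - \<xi> \<bullet> (C *v u)"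
        by (simp add: matrix_vector_mult_diff_rdistrib inner_diff_right)
      ultimately show False using \<xi>(2) elim by linarith
    qed
    then show ?case by blast
  qed
qed

text \<open>For a limit point u, a fixed field v with mean shift close to \<open>C *v u\<close> is
  taken. The solution w of the empirical system with the sample mean shift on the right belongs to
  the empirical set by weak duality and is close to u by invertibility.\<close>

lemma empirical_conjugate_sublevel_hit:
  assumes G: "open G" "conjugate_sublevel \<phi> C \<eta> \<inter> G \<noteq> {}" and \<eta>: "0 < \<eta>"
    and \<eta>n: "\<eta>n \<longlonglongrightarrow> \<eta>" and Cn: "\<And>e. 0 < e \<Longrightarrow> whp M (\<lambda>n \<omega>. norm (Cn n \<omega> - C) < e)"
  shows "whp M (\<lambda>n \<omega>. conjugate_sublevel (empirical_form p l B n (\<lambda>i. X i \<omega>) \<beta>s) (Cn n \<omega>) (\<eta>n n) \<inter> G \<noteq> {})"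
proof -
  obtain c where c: "0 < c" "\<And>v. c * (norm v)\<^sup>2 \<le> v \<bullet> (C *v v)"
    using pos_def_lower_bound[OF C_pos_def] by blast
  obtain u where u: "u \<in> conjugate_sublevel \<phi> C \<eta>" "u \<in> G" using G by blast
  obtain r where r: "0 < r" "ball u r \<subseteq> G" using G(1) u(2) by (meson open_contains_ball)
  \<comment> \<open>Three errors of size e enter \<open>?C *v (w - u)\<close>, whose lower bound is
    \<open>c / 2\<close>; \<open>3 * e\<close> is below \<open>c / 2 * r\<close>.\<close>
  define e where "e = c * r / 8"
  have e: "0 < e" using c r by (simp add: e_def)
  obtain v where v: "admissible v" "(\<integral>x. (lp_norm q (v x))\<^sup>2 \<partial>P) < \<eta>"
    "norm ((\<integral>x. Dx x *v v x \<partial>P) - C *v u) < e"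
    by (rule dual_witness[of "C *v u" \<eta> e]) (use u \<eta> e in \<open>auto simp: mem_conjugate_sublevel\<close>)
  \<comment> \<open>Half of the energy gap is granted to the sample mean, the other half to the
    level \<open>\<eta>n n\<close>.\<close>
  define \<delta> where "\<delta> = (\<eta> - (\<integral>x. (lp_norm q (v x))\<^sup>2 \<partial>P)) / 2"
  have \<delta>: "0 < \<delta>" using v by (simp add: \<delta>_def)
  define U where "U = norm u + 1"
  have U: "0 < U" "norm u \<le> U" using norm_ge_zero[of u] unfolding U_def by linarith+
  \<comment> \<open>The first entry preserves half of the quadratic lower bound of C; the second
    keeps the matrix error applied to u below e.\<close>
  define e' where "e' = min (c / 2) (c * r / (8 * U))"
  have e': "0 < e'" "e' \<le> c / 2" "e' * norm u \<le> e"
  proof -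
    show "0 < e'" using c r U by (simp add: e'_def)
    have "e' * norm u \<le> (c * r / (8 * U)) * U"
      using c r U by (intro mult_mono) (auto simp: e'_def)
    also have "\<dots> = e" using U by (simp add: e_def)
    finally show "e' * norm u \<le> e" .
  qed (simp add: e'_def)
  let ?m = "\<lambda>n \<omega>. sample_mean n (\<lambda>i. X i \<omega>)"
  have good: "whp M (\<lambda>n \<omega>. norm (Cn n \<omega> - C) < e' \<and>
      norm (?m n \<omega> (\<lambda>y. Dx y *v v y) - (\<integral>x. Dx x *v v x \<partial>P)) < e \<and>
      \<bar>?m n \<omega> (\<lambda>y. (lp_norm q (v y))\<^sup>2) - (\<integral>x. (lp_norm q (v x))\<^sup>2 \<partial>P)\<bar> < \<delta>)"
    by (intro whp_conj Cn e' weak_law weak_law_real e \<delta> admissible_Dx_integrable admissible_integrable v)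
  have ev: "\<forall>\<^sub>F n in sequentially. \<eta> - \<delta> < \<eta>n n"
    using \<delta> by (intro order_tendstoD(1)[OF \<eta>n]) simp
  show ?thesis
  proof (rule whp_mono[OF good ev], goal_cases)
    case (1 n \<omega>)
    note elim = 1(1) and * = 1(3)
    let ?C = "Cn n \<omega>" and ?s = "?m n \<omega> (\<lambda>y. Dx y *v v y)"
    have c2: "0 < c / 2" using c by simp
    have lower: "c / 2 * (norm w)\<^sup>2 \<le> w \<bullet> (?C *v w)" for w
    proof -
      have "\<bar>w \<bullet> ((?C - C) *v w)\<bar> \<le> norm w * norm ((?C - C) *v w)"
        by (rule Cauchy_Schwarz_ineq2)
      also have "\<dots> \<le> norm w * (norm (?C - C) * norm w)"
        by (intro mult_left_mono norm_mult_vec_le_norm) simp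
      also have "\<dots> \<le> norm w * (c / 2 * norm w)"
        using * e' by (intro mult_left_mono mult_right_mono) auto
      finally have "\<bar>w \<bullet> ((?C - C) *v w)\<bar> \<le> c / 2 * (norm w)\<^sup>2"
        by (simp add: power2_eq_square mult_ac)
      moreover have "w \<bullet> ((?C - C) *v w) = w \<bullet> (?C *v w) - w \<bullet> (C *v w)"
        by (simp add: matrix_vector_mult_diff_rdistrib inner_diff_right)
      moreover have "c / 2 * (norm w)\<^sup>2 + c / 2 * (norm w)\<^sup>2 = c * (norm w)\<^sup>2" by simp
      ultimately show ?thesis using c(2)[of w] by linarith
    qed
    obtain w where w: "?C *v w = ?s" by (rule solve_of_lower_bound[OF c2 lower])
    have "w \<in> conjugate_sublevel (empirical_form p l B n (\<lambda>i. X i \<omega>) \<beta>s) ?C (\<eta>n n)"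
      unfolding mem_conjugate_sublevel w
    proof
      fix \<xi>
      have "?m n \<omega> (\<lambda>y. (lp_norm q (v y))\<^sup>2) \<le> \<eta>n n"
      proof -
        have key: "m \<le> y" if "\<bar>m - I\<bar> < d" "\<eta> - d < y" "2 * d = \<eta> - I" for m I d y :: real
          using that by linarith
        show ?thesis
          by (rule key[OF *[THEN conjunct2, THEN conjunct2] elim]) (simp add: \<delta>_def)
      qed
      then show "\<xi> \<bullet> ?s - empirical_form p l B n (\<lambda>i. X i \<omega>) \<beta>s \<xi> \<le> \<eta>n n"
        using empirical_weak_duality[of \<xi> n "\<lambda>i. X i \<omega>" v] by linarith
    qed
    moreover have "w \<in> G"
    proof -
      have "c / 2 * norm (w - u) \<le> norm (?C *v (w - u))"
        by (rule norm_le_of_lower_bound[OF c2 lower])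
      also have "?C *v (w - u) = (?s - (\<integral>x. Dx x *v v x \<partial>P)) + ((\<integral>x. Dx x *v v x \<partial>P) - C *v u) - (?C - C) *v u"
        by (simp add: w matrix_vector_mult_diff_distrib matrix_vector_mult_diff_rdistrib)
      also have "norm \<dots> \<le> norm (?s - (\<integral>x. Dx x *v v x \<partial>P)) + norm ((\<integral>x. Dx x *v v x \<partial>P) - C *v u)
          + norm ((?C - C) *v u)"
        by (meson add_mono norm_triangle_ineq norm_triangle_ineq4 order_refl order_trans)
      also have "\<dots> < e + e + e"
      proof -
        have "norm ((?C - C) *v u) \<le> norm (?C - C) * norm u" by (rule norm_mult_vec_le_norm)
        also have "\<dots> \<le> e' * norm u" using * by (intro mult_right_mono) auto
        also have "\<dots> \<le> e" by (rule e')
        finally show ?thesis using * v(3) by linarith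
      qed
      finally have "c / 2 * norm (w - u) < c / 2 * r"
        using c r by (simp add: e_def)
      then have "norm (w - u) < r" using c by simp
      then show ?thesis using r(2) by (auto simp: dist_norm norm_minus_commute)
    qed
    ultimately show ?case by blast
  qed
qed

end

text \<open>The estimator is constrained only where an empirical minimizer exists; that one exists
  with probability tending to 1 is derived, not assumed.\<close>

locale robust_erm = robust_sample M X P B l p q \<beta>s
  for M :: "'w measure" and X :: "nat \<Rightarrow> 'w \<Rightarrow> real ^ 'm" and P
    and B :: "(real ^ 'd) set" and l :: "real ^ 'm \<Rightarrow> real ^ 'd \<Rightarrow> real" and p q \<beta>s +
  fixes c :: "real ^ 'm \<Rightarrow> real ^ 'm \<Rightarrow> real" and \<beta>ERM :: "nat \<Rightarrow> 'w \<Rightarrow> real ^ 'd" and \<eta> :: real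
  assumes cost: "c u w = (lp_norm q (u - w))\<^sup>2"
    and ERM: "n \<ge> 1 \<Longrightarrow> \<omega> \<in> space M \<Longrightarrow>
      risk_minimizers l B (empirical_measure n (\<lambda>i. X i \<omega>)) \<noteq> {} \<Longrightarrow>
      \<beta>ERM n \<omega> \<in> risk_minimizers l B (empirical_measure n (\<lambda>i. X i \<omega>))"
    and \<eta>: "0 < \<eta>"
begin

abbreviation "empirical n \<omega> \<equiv> empirical_measure n (\<lambda>i. X i \<omega>)"

definition confidence_region :: "nat \<Rightarrow> 'w \<Rightarrow> (real ^ 'd) set" where
  "confidence_region n \<omega> = (\<lambda>\<beta>. sqrt (real n) *\<^sub>R (\<beta> - \<beta>ERM n \<omega>)) `
    compatible_set_plus c l B (\<eta> / real n) (empirical n \<omega>)"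

abbreviation limit_set :: "(real ^ 'd) set" where
  "limit_set \<equiv> conjugate_sublevel \<phi> C \<eta>"

lemma closed_confidence_region: "closed (confidence_region n \<omega>)"
proof (cases "n = 0")
  case True
  \<comment> \<open>For \<open>n = 0\<close> the scaling factor is 0 and the image
    collapses.\<close>
  then have "confidence_region n \<omega> \<subseteq> {0}" by (auto simp: confidence_region_def)
  then have "finite (confidence_region n \<omega>)" by (rule finite_subset) simp
  then show ?thesis by (rule finite_imp_closed)
next
  case False
  have "closed ((\<lambda>z. sqrt (real n) *\<^sub>R z) ` ((+) (- \<beta>ERM n \<omega>) `
      compatible_set_plus c l B (\<eta> / real n) (empirical n \<omega>)))"
    unfolding compatible_set_plus_def by (intro closed_scaling closed_translation closed_closure)
  then show ?thesis
    by (simp add: confidence_region_def image_image)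
qed

lemma erm_location:
  assumes H: "0 \<le> H" and e: "0 < e"
  shows "whp M (\<lambda>n \<omega>. \<forall>u. C *v u + scaled_score n \<omega> = 0 \<longrightarrow> norm (scaled_score n \<omega>) \<le> H \<longrightarrow>
    norm (sqrt (real n) *\<^sub>R (\<beta>ERM n \<omega> - \<beta>s) - u) < e)"
  by (rule whp_mono'[OF empirical_minimizer_location[OF H e]]) (use ERM in blast)

text \<open>A witness field for \<open>- (C *v u)\<close> moves the sample inside the transport
  ball. The minimizer of the moved sample and the empirical minimizer solve linear equations that
  differ by the averaged shift, so their rescaled difference is close to u.\<close>

lemma confidence_region_hit:
  assumes G: "open G" "limit_set \<inter> G \<noteq> {}"
  shows "whp M (\<lambda>n \<omega>. confidence_region n \<omega> \<inter> G \<noteq> {})"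
proof (rule whp_of_tight[OF scaled_score_tight])
  fix H0 :: real
  define H where "H = \<bar>H0\<bar>"
  have H: "0 \<le> H" by (simp add: H_def)
  obtain b where b: "0 < b" "\<And>v. b * (norm v)\<^sup>2 \<le> v \<bullet> (C *v v)"
    using pos_def_lower_bound[OF C_pos_def] by blast
  obtain u where u: "u \<in> limit_set" "u \<in> G" using G by blast
  obtain r where r: "0 < r" "ball u r \<subseteq> G" using G(1) u(2) by (meson open_contains_ball)
  \<comment> \<open>The bound 1 enters the size \<open>H2\<close> of the intercept;
    \<open>b * r / 8\<close>, used twice, yields the error \<open>r / 4\<close> after inversion of
    C.\<close>
  define e where "e = min 1 (b * r / 8)"
  have e: "0 < e" "e \<le> 1" "e \<le> b * r / 8" using b r by (auto simp: e_def)
  have "\<xi> \<bullet> (- (C *v u)) - \<phi> \<xi> \<le> \<eta>" for \<xi>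
    using u(1)[unfolded mem_conjugate_sublevel, rule_format, of "- \<xi>"] by (simp add: \<phi>_minus)
  from dual_witness[OF this \<eta> e(1)]
  obtain v where v: "admissible v" "(\<integral>x. (lp_norm q (v x))\<^sup>2 \<partial>P) < \<eta>"
    "norm ((\<integral>x. Dx x *v v x \<partial>P) - (- (C *v u))) < e"
    by blast
  have vm: "v \<in> borel_measurable borel" by (rule admissible_measurable[OF v(1)])
  define \<delta> where "\<delta> = \<eta> - (\<integral>x. (lp_norm q (v x))\<^sup>2 \<partial>P)"
  have \<delta>: "0 < \<delta>" using v by (simp add: \<delta>_def)
  define L where "L = (real CARD('m))\<^sup>2 * \<eta>"
  have L: "0 \<le> L" using \<eta> by (simp add: L_def)
  define H2 where "H2 = H + norm (\<integral>x. Dx x *v v x \<partial>P) + 1"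
  have H2: "0 \<le> H2" using H norm_ge_zero[of "\<integral>x. Dx x *v v x \<partial>P"] unfolding H2_def by linarith
  have r4: "0 < r / 4" using r by simp
  let ?x = "\<lambda>\<omega> i. X i \<omega>"
  let ?m = "\<lambda>n \<omega>. sample_mean n (\<lambda>i. X i \<omega>)"
  have good: "whp M (\<lambda>n \<omega>. norm (?m n \<omega> (\<lambda>y. Dx y *v v y) - (\<integral>x. Dx x *v v x \<partial>P)) < e \<and>
      \<bar>?m n \<omega> (\<lambda>y. (lp_norm q (v y))\<^sup>2) - (\<integral>x. (lp_norm q (v x))\<^sup>2 \<partial>P)\<bar> < \<delta> \<and>
      (\<forall>u. C *v u + scaled_score n \<omega> = 0 \<longrightarrow> norm (scaled_score n \<omega>) \<le> H \<longrightarrow>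
        norm (sqrt (real n) *\<^sub>R (\<beta>ERM n \<omega> - \<beta>s) - u) < r / 4) \<and>
      (\<forall>\<pi> u. near_coupling n (?x \<omega>) L \<pi> \<longrightarrow>
        C *v u + score_shift n (?x \<omega>) \<pi> = 0 \<longrightarrow> norm (score_shift n (?x \<omega>) \<pi>) \<le> H2 \<longrightarrow>
        risk_minimizers l B (distr \<pi> borel snd) \<noteq> {} \<and>
        (\<forall>\<beta>\<in>risk_minimizers l B (distr \<pi> borel snd). norm (sqrt (real n) *\<^sub>R (\<beta> - \<beta>s) - u) < r / 4)))"
    by (intro whp_conj weak_law weak_law_real e \<delta> admissible_Dx_integrable admissible_integrable v
          erm_location minimizer_location H H2 L r4)
  show "whp M (\<lambda>n \<omega>. norm (scaled_score n \<omega>) \<le> H0 \<longrightarrow> confidence_region n \<omega> \<inter> G \<noteq> {})"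
  proof (rule whp_mono'[OF good], intro impI, goal_cases)
    case (1 n \<omega>)
    note n = 1(1) and * = 1(3) and sc = 1(4)
    note ev1 = *[THEN conjunct1] and ev2 = *[THEN conjunct2, THEN conjunct1]
      and ev3 = *[THEN conjunct2, THEN conjunct2, THEN conjunct1, rule_format]
      and ev4 = *[THEN conjunct2, THEN conjunct2, THEN conjunct2, rule_format]
    let ?s = "?m n \<omega> (\<lambda>y. Dx y *v v y)" and ?I = "\<integral>x. Dx x *v v x \<partial>P"
    let ?\<pi> = "shift_coupling n (?x \<omega>) v"
    have mean: "?m n \<omega> (\<lambda>y. (lp_norm q (v y))\<^sup>2) \<le> \<eta>"
      using ev2 unfolding \<delta>_def by linarith
    have scH: "norm (scaled_score n \<omega>) \<le> H" using sc by (simp add: H_def)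
    have "?m n \<omega> (\<lambda>y. (norm (v y))\<^sup>2) \<le> ?m n \<omega> (\<lambda>y. (real CARD('m))\<^sup>2 * (lp_norm q (v y))\<^sup>2)"
      by (intro sample_mean_mono norm_square_le_lp_norm)
    also have "\<dots> \<le> L" unfolding sample_mean_cmult L_def using mean by (intro mult_left_mono) auto
    finally have nc: "near_coupling n (?x \<omega>) L ?\<pi>" by (rule near_coupling_shift[OF n vm])
    have ss: "score_shift n (?x \<omega>) ?\<pi> = scaled_score n \<omega> + ?s"
      by (rule score_shift_shift_coupling[OF n vm])
    obtain u0 where u0: "C *v u0 = - scaled_score n \<omega>" by (rule solve_of_lower_bound[OF b])
    obtain w0 where w0: "C *v w0 = - (scaled_score n \<omega> + ?s)" by (rule solve_of_lower_bound[OF b])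
    have "norm (scaled_score n \<omega> + ?s) \<le> norm (scaled_score n \<omega>) + (norm ?I + norm (?s - ?I))"
      using norm_triangle_ineq[of "scaled_score n \<omega>" ?s] norm_triangle_sub[of ?s ?I] by linarith
    also have "\<dots> \<le> H2" using scH ev1 e unfolding H2_def by linarith
    finally have ssH: "norm (score_shift n (?x \<omega>) ?\<pi>) \<le> H2" unfolding ss .
    have w0': "C *v w0 + score_shift n (?x \<omega>) ?\<pi> = 0" unfolding ss w0 by simp
    from ev4[OF nc w0' ssH] obtain \<beta> where \<beta>: "\<beta> \<in> risk_minimizers l B (distr ?\<pi> borel snd)"
      "norm (sqrt (real n) *\<^sub>R (\<beta> - \<beta>s) - w0) < r / 4" by blast
    have erm: "norm (sqrt (real n) *\<^sub>R (\<beta>ERM n \<omega> - \<beta>s) - u0) < r / 4"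
      using scH by (intro ev3) (simp_all add: u0)
    \<comment> \<open>Subtracting the equations of \<open>w0\<close> and \<open>u0\<close> removes
      the random score, and only sampling and duality errors remain.\<close>
    have "b * norm (w0 - u0 - u) \<le> norm (C *v (w0 - u0 - u))" by (rule norm_le_of_lower_bound[OF b])
    also have "C *v (w0 - u0 - u) = - ((?s - ?I) + (?I - (- (C *v u))))"
      by (simp add: matrix_vector_mult_diff_distrib u0 w0)
    also have "norm \<dots> \<le> norm (?s - ?I) + norm (?I - (- (C *v u)))"
      unfolding norm_minus_cancel by (rule norm_triangle_ineq)
    also have "\<dots> \<le> b * r / 8 + b * r / 8" using ev1 v(3) e by linarith
    finally have "b * norm (w0 - u0 - u) \<le> b * (r / 4)" by simp
    then have w0u: "norm (w0 - u0 - u) \<le> r / 4" using b(1) by simp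
    let ?z = "sqrt (real n) *\<^sub>R (\<beta> - \<beta>ERM n \<omega>)"
    have "?z - u = (sqrt (real n) *\<^sub>R (\<beta> - \<beta>s) - w0) - (sqrt (real n) *\<^sub>R (\<beta>ERM n \<omega> - \<beta>s) - u0) + (w0 - u0 - u)"
      by (simp add: scaleR_diff_right)
    also have "norm \<dots> \<le> norm (sqrt (real n) *\<^sub>R (\<beta> - \<beta>s) - w0)
        + norm (sqrt (real n) *\<^sub>R (\<beta>ERM n \<omega> - \<beta>s) - u0) + norm (w0 - u0 - u)"
      by (meson add_mono norm_triangle_ineq norm_triangle_ineq4 order_refl order_trans)
    also have "\<dots> < r" using \<beta>(2) erm w0u r by linarith
    finally have "?z \<in> ball u r" by (simp add: dist_norm norm_minus_commute)
    then have zG: "?z \<in> G" using r by blast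
    have "distr ?\<pi> borel snd \<in> ambiguity_set c (\<eta> / real n) (empirical n \<omega>)"
      by (rule shift_coupling_ambiguity_set[OF n vm q cost mean]) (use \<eta> in simp)
    \<comment> \<open>One distribution lies in the ball of radius exactly \<eta>/n, hence in all
      larger ones; so the same \<beta> belongs to every set of the intersection.\<close>
    then have "distr ?\<pi> borel snd \<in> ambiguity_set c (\<eta> / real n + \<epsilon>) (empirical n \<omega>)" if "0 < \<epsilon>" for \<epsilon>
      using ambiguity_set_mono[of "\<eta> / real n" "\<eta> / real n + \<epsilon>" c "empirical n \<omega>"] that by auto
    then have "\<beta> \<in> (\<Inter>\<epsilon>\<in>{0<..}. compatible_set c l B (\<eta> / real n + \<epsilon>) (empirical n \<omega>))"
      using \<beta>(1) unfolding compatible_set_def by blast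
    then have "\<beta> \<in> compatible_set_plus c l B (\<eta> / real n) (empirical n \<omega>)"
      unfolding compatible_set_plus_def using closure_subset by blast
    then have "?z \<in> confidence_region n \<omega>" unfolding confidence_region_def by blast
    with zG show ?case by blast
  qed
qed

text \<open>A point of the region in K would come from a plan of cost barely above \<eta>/n, and
  weak duality would bound \<open>\<xi> \<bullet> (C *v u) - \<phi> \<xi>\<close> by \<eta> plus
  small errors, against the uniform margin \<gamma>.\<close>

lemma confidence_region_miss:
  assumes K: "compact K" "limit_set \<inter> K = {}"
  shows "whp M (\<lambda>n \<omega>. confidence_region n \<omega> \<inter> K = {})"
proof (rule whp_of_tight[OF scaled_score_tight])
  fix H0 :: real
  define H where "H = \<bar>H0\<bar>"
  have H: "0 \<le> H" by (simp add: H_def)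
  obtain b where b: "0 < b" "\<And>v. b * (norm v)\<^sup>2 \<le> v \<bullet> (C *v v)"
    using pos_def_lower_bound[OF C_pos_def] by blast
  obtain \<Xi> \<gamma> where \<Xi>: "finite \<Xi>" and \<gamma>: "0 < \<gamma>"
    and sep: "\<And>u. u \<in> K \<Longrightarrow> \<exists>\<xi>\<in>\<Xi>. \<eta> + \<gamma> < \<xi> \<bullet> (C *v u) - \<phi> \<xi>"
    by (rule compact_miss_conjugate_sublevel[OF K]) blast
  obtain k where k: "0 < k" "\<And>u. u \<in> K \<Longrightarrow> norm u \<le> k"
    using compact_imp_bounded[OF K(1)] by (auto simp: bounded_pos)
  define t where "t = Max (insert 0 (norm ` \<Xi>))"
  have t: "0 \<le> t" "\<And>\<xi>. \<xi> \<in> \<Xi> \<Longrightarrow> norm \<xi> \<le> t" using \<Xi> by (auto simp: t_def intro: Max_ge)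
  define N where "N = norm C + 1"
  have N: "0 < N" "norm C \<le> N" using norm_ge_zero[of C] unfolding N_def by linarith+
  define T where "T = t + 1"
  have T: "0 < T" "t \<le> T" using t by (simp_all add: T_def)
  \<comment> \<open>The margin is spent as follows: \<open>\<gamma> / 16\<close> for each of two
    score equations, \<open>\<gamma> / 8\<close> for the closure, \<open>\<gamma> / 8\<close> for
    the empirical form and \<open>\<gamma> / 4\<close> for the excess radius, in total
    \<open>5 * \<gamma> / 8\<close>.\<close>
  define e1 where "e1 = \<gamma> / (16 * T)"
  define e2 where "e2 = e1 / N"
  define r where "r = \<gamma> / (8 * T * N)"
  have e1_pos: "0 < e1" and r_pos: "0 < r" using \<gamma> T N by (simp_all add: e1_def r_def)
  have "t * e1 \<le> T * e1" "t * (N * r) \<le> T * (N * r)"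
    using T e1_pos r_pos N by (auto intro!: mult_right_mono)
  moreover have "T * e1 = \<gamma> / 16" "T * (N * r) = \<gamma> / 8" using T N by (simp_all add: e1_def r_def)
  ultimately have e1: "0 < e1" "t * e1 \<le> \<gamma> / 16" and r: "0 < r" "t * (N * r) \<le> \<gamma> / 8"
    using e1_pos r_pos by linarith+
  have e2: "0 < e2" "N * e2 = e1" using e1 N by (auto simp: e2_def)
  define L where "L = (real CARD('m))\<^sup>2 * (\<eta> + \<gamma> / 4)"
  have L: "0 \<le> L" using \<eta> \<gamma> by (simp add: L_def)
  \<comment> \<open>Bounds the local parameter of any candidate: at most \<open>k + r\<close> from
    the region and \<open>H / b + e2\<close> from the empirical minimizer, plus 1 for strictness.
    The score equation can thus be invoked.\<close>
  define R where "R = k + r + e2 + H / b + 1"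
  have R: "0 \<le> R" using k r e2 H b by (simp add: R_def)
  have \<gamma>8: "0 < \<gamma> / 8" using \<gamma> by simp
  let ?x = "\<lambda>\<omega> i. X i \<omega>"
  have good: "whp M (\<lambda>n \<omega>. (\<forall>\<xi>\<in>\<Xi>. \<bar>empirical_form p l B n (?x \<omega>) \<beta>s (- \<xi>) - \<phi> (- \<xi>)\<bar> < \<gamma> / 8) \<and>
      (\<forall>u. C *v u + scaled_score n \<omega> = 0 \<longrightarrow> norm (scaled_score n \<omega>) \<le> H \<longrightarrow>
        norm (sqrt (real n) *\<^sub>R (\<beta>ERM n \<omega> - \<beta>s) - u) < e2) \<and>
      (\<forall>\<pi> u. near_coupling n (?x \<omega>) L \<pi> \<longrightarrow> norm u < R \<longrightarrow>
        \<beta>s + u /\<^sub>R sqrt (real n) \<in> risk_minimizers l B (distr \<pi> borel snd) \<longrightarrow>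
        norm (C *v u + score_shift n (?x \<omega>) \<pi>) \<le> e1))"
    by (intro whp_conj whp_ball \<Xi> empirical_form_weak_law \<gamma>8 erm_location minimizer_score_equation H e1 e2 L R)
  show "whp M (\<lambda>n \<omega>. norm (scaled_score n \<omega>) \<le> H0 \<longrightarrow> confidence_region n \<omega> \<inter> K = {})"
  proof (rule whp_mono'[OF good], intro impI, goal_cases)
    case (1 n \<omega>)
    note n = 1(1) and * = 1(3) and sc = 1(4)
    note ev1 = *[THEN conjunct1, rule_format] and ev2 = *[THEN conjunct2, THEN conjunct1, rule_format]
      and ev3 = *[THEN conjunct2, THEN conjunct2, rule_format]
    have rn: "0 < sqrt (real n)" using n by simp
    have scH: "norm (scaled_score n \<omega>) \<le> H" using sc by (simp add: H_def)
    have False if u: "u \<in> confidence_region n \<omega>" "u \<in> K" for u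
    proof -
      obtain \<beta>0 where \<beta>0: "\<beta>0 \<in> closure (\<Inter>\<epsilon>\<in>{0<..}. compatible_set c l B (\<eta> / real n + \<epsilon>) (empirical n \<omega>))"
        "u = sqrt (real n) *\<^sub>R (\<beta>0 - \<beta>ERM n \<omega>)"
        using u(1) unfolding confidence_region_def compatible_set_plus_def by blast
      have "0 < r / sqrt (real n)" using r rn by simp
      with \<beta>0(1) obtain \<beta> where \<beta>: "\<beta> \<in> (\<Inter>\<epsilon>\<in>{0<..}. compatible_set c l B (\<eta> / real n + \<epsilon>) (empirical n \<omega>))"
        "dist \<beta> \<beta>0 < r / sqrt (real n)"
        unfolding closure_approachable by blast
      \<comment> \<open>The enlargement of the radius is taken of order 1/n, so that its rescaled
        effect on the cost stays a fixed fraction of \<gamma>.\<close>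
      have "0 < \<gamma> / (8 * real n)" using \<gamma> n by simp
      then obtain Q where Q: "Q \<in> ambiguity_set c (\<eta> / real n + \<gamma> / (8 * real n)) (empirical n \<omega>)"
        "\<beta> \<in> risk_minimizers l B Q"
        using \<beta>(1) unfolding compatible_set_def by blast
      have \<delta>: "0 \<le> \<eta> / real n + \<gamma> / (8 * real n)"
        "\<eta> / real n + \<gamma> / (8 * real n) < (\<eta> + \<gamma> / 4) / real n"
        using \<eta> \<gamma> n by (auto simp: field_simps)
      have LL: "(real CARD('m))\<^sup>2 * (real n * ((\<eta> + \<gamma> / 4) / real n)) \<le> L"
        using n by (simp add: L_def)
      obtain \<pi> where \<pi>: "near_coupling n (?x \<omega>) L \<pi>" "distr \<pi> borel snd = Q"
        "integrable \<pi> (\<lambda>z. (lp_norm q (snd z - fst z))\<^sup>2)"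
        "(\<integral>z. (lp_norm q (snd z - fst z))\<^sup>2 \<partial>\<pi>) \<le> (\<eta> + \<gamma> / 4) / real n"
        using ambiguity_set_near_coupling[OF q cost n Q(1) \<delta> LL] by blast
      define s where "s = sqrt (real n) *\<^sub>R (\<integral>z. Dx (fst z) *v (snd z - fst z) \<partial>\<pi>)"
      define u' where "u' = sqrt (real n) *\<^sub>R (\<beta> - \<beta>ERM n \<omega>)"
      define wE where "wE = sqrt (real n) *\<^sub>R (\<beta>ERM n \<omega> - \<beta>s)"
      define w where "w = sqrt (real n) *\<^sub>R (\<beta> - \<beta>s)"
      have w: "w = u' + wE" by (simp add: w_def u'_def wE_def scaleR_diff_right)
      have "norm (u' - u) = sqrt (real n) * dist \<beta> \<beta>0"
      proof -
        have "u' - u = sqrt (real n) *\<^sub>R (\<beta> - \<beta>0)" by (simp add: u'_def \<beta>0(2) scaleR_diff_right)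
        then show ?thesis by (simp add: dist_norm)
      qed
      also have "\<dots> \<le> r" using \<beta>(2) rn by (simp add: field_simps)
      finally have u'u: "norm (u' - u) \<le> r" .
      obtain u0 where u0: "C *v u0 = - scaled_score n \<omega>" by (rule solve_of_lower_bound[OF b])
      have wE: "norm (wE - u0) < e2" unfolding wE_def using scH by (intro ev2) (simp_all add: u0)
      have "b * norm u0 \<le> norm (C *v u0)" by (rule norm_le_of_lower_bound[OF b])
      also have "\<dots> \<le> H" using scH by (simp add: u0)
      finally have u0H: "norm u0 \<le> H / b" using b by (simp add: field_simps)
      have "norm w \<le> norm u + norm (u' - u) + (norm u0 + norm (wE - u0))"
        unfolding w using norm_triangle_ineq[of u' wE] norm_triangle_sub[of u' u] norm_triangle_sub[of wE u0]
        by linarith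
      also have "\<dots> < R" using k(2)[OF u(2)] u'u u0H wE unfolding R_def by linarith
      finally have wR: "norm w < R" .
      have "\<beta>s + w /\<^sub>R sqrt (real n) = \<beta>" using rn by (simp add: w_def)
      with Q(2) have "\<beta>s + w /\<^sub>R sqrt (real n) \<in> risk_minimizers l B (distr \<pi> borel snd)"
        by (simp add: \<pi>(2))
      from ev3[OF \<pi>(1) wR this] have eq1: "norm (C *v w + (scaled_score n \<omega> + s)) \<le> e1"
        by (simp add: score_shift_def s_def)
      have eq2: "norm (C *v wE + scaled_score n \<omega>) \<le> e1"
      proof -
        have "C *v wE + scaled_score n \<omega> = C *v (wE - u0)"
          by (simp add: matrix_vector_mult_diff_distrib u0)
        also have "norm \<dots> \<le> norm C * norm (wE - u0)" by (rule norm_mult_vec_le_norm)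
        also have "\<dots> \<le> N * e2" using N wE by (intro mult_mono) auto
        finally show ?thesis using e2 by simp
      qed
      obtain \<xi> where \<xi>: "\<xi> \<in> \<Xi>" "\<eta> + \<gamma> < \<xi> \<bullet> (C *v u) - \<phi> \<xi>" using sep[OF u(2)] by blast
      have cs: "\<xi> \<bullet> y \<le> t * d" if "norm y \<le> d" for y d
      proof -
        have "\<xi> \<bullet> y \<le> norm \<xi> * norm y" by (rule norm_cauchy_schwarz)
        also have "\<dots> \<le> t * d" using t \<xi>(1) that by (intro mult_mono) auto
        finally show ?thesis .
      qed
      \<comment> \<open>The scaled score occurs in both brackets and cancels, leaving
        \<open>- s\<close>, the effect of the transport, up to small terms.\<close>
      have "C *v u = (C *v w + (scaled_score n \<omega> + s)) + (- (C *v wE + scaled_score n \<omega>)) - s + C *v (u - u')"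
        by (simp add: w matrix_vector_right_distrib matrix_vector_mult_diff_distrib)
      then have "\<xi> \<bullet> (C *v u) = \<xi> \<bullet> (C *v w + (scaled_score n \<omega> + s)) + \<xi> \<bullet> (- (C *v wE + scaled_score n \<omega>))
          + (- \<xi>) \<bullet> s + \<xi> \<bullet> (C *v (u - u'))"
        by (simp add: inner_add_right inner_diff_right)
      moreover have "\<xi> \<bullet> (C *v w + (scaled_score n \<omega> + s)) \<le> t * e1" by (rule cs[OF eq1])
      moreover have "\<xi> \<bullet> (- (C *v wE + scaled_score n \<omega>)) \<le> t * e1"
        by (rule cs) (use eq2 in \<open>simp only: norm_minus_cancel\<close>)
      moreover have "\<xi> \<bullet> (C *v (u - u')) \<le> t * (N * r)"
      proof (rule cs)
        have "norm (C *v (u - u')) \<le> norm C * norm (u - u')" by (rule norm_mult_vec_le_norm)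
        also have "\<dots> \<le> N * r" using N u'u by (intro mult_mono) (auto simp: norm_minus_commute)
        finally show "norm (C *v (u - u')) \<le> N * r" .
      qed
      moreover have "(- \<xi>) \<bullet> s \<le> \<phi> \<xi> + \<gamma> / 8 + (\<eta> + \<gamma> / 4)"
      proof -
        have "(- \<xi>) \<bullet> s \<le> empirical_form p l B n (?x \<omega>) \<beta>s (- \<xi>)
            + real n * (\<integral>z. (lp_norm q (snd z - fst z))\<^sup>2 \<partial>\<pi>)"
          using coupling_weak_duality[OF n \<pi>(1,3), of "- \<xi>"] by (simp add: s_def)
        moreover have "real n * (\<integral>z. (lp_norm q (snd z - fst z))\<^sup>2 \<partial>\<pi>) \<le> \<eta> + \<gamma> / 4"
          using \<pi>(4) n by (simp add: field_simps)
        moreover have "empirical_form p l B n (?x \<omega>) \<beta>s (- \<xi>) < \<phi> \<xi> + \<gamma> / 8"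
          using ev1[OF \<xi>(1)] unfolding \<phi>_minus by linarith
        ultimately show ?thesis by linarith
      qed
      ultimately show False using \<xi>(2) e1(2) r(2) \<gamma> by linarith
    qed
    then show ?case by blast
  qed
qed

end

theorem corollary2:
  fixes p q \<eta> :: real
    and B :: "(real ^ 'd) set"
    and l :: "real ^ 'm \<Rightarrow> real ^ 'd \<Rightarrow> real"
    and c :: "real ^ 'm \<Rightarrow> real ^ 'm \<Rightarrow> real"
    and M :: "'w measure"
    and X :: "nat \<Rightarrow> 'w \<Rightarrow> real ^ 'm"
    and P :: "(real ^ 'm) measure"
    and \<beta>s :: "real ^ 'd"
    and \<beta>ERM :: "nat \<Rightarrow> 'w \<Rightarrow> real ^ 'd"
  assumes exponents: "1 < q" "1 / p + 1 / q = 1"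
    and B: "closed B" "convex B"
    and prob: "prob_space M"
    and indep: "prob_space.indep_vars M (\<lambda>_. borel) X UNIV"
    and law: "\<And>i. distr M borel (X i) = P"
    and second_moment: "integrable P (\<lambda>x. (norm x)\<^sup>2)"
    and cost: "\<And>u w. c u w = (lp_norm q (u - w))\<^sup>2"
    and smooth: "loss_smooth_convex B l"
    and optimality: "loss_optimality p P B l \<beta>s"
    and bounds: "loss_derivative_bounds p q P B l \<beta>s"
    and ERM: "\<And>n \<omega>. n \<ge> 1 \<Longrightarrow> \<omega> \<in> space M \<Longrightarrow>
      risk_minimizers l B (empirical_measure n (\<lambda>i. X i \<omega>)) \<noteq> {} \<Longrightarrow>
      \<beta>ERM n \<omega> \<in> risk_minimizers l B (empirical_measure n (\<lambda>i. X i \<omega>))"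
    and \<eta>: "0 < \<eta>"
  shows "converges_weakly fell_topology M
      (\<lambda>n \<omega>. (\<lambda>\<beta>. sqrt (real n) *\<^sub>R (\<beta> - \<beta>ERM n \<omega>)) `
        compatible_set_plus c l B (\<eta> / real n) (empirical_measure n (\<lambda>i. X i \<omega>)))
      (return (borel_sets_of fell_topology)
        (conjugate_sublevel (limit_form p l B P \<beta>s) (mean_hessian l B P \<beta>s) \<eta>))
    \<and> (\<forall>(\<eta>n :: nat \<Rightarrow> real) (Cn :: nat \<Rightarrow> 'w \<Rightarrow> real ^ 'd ^ 'd).
        \<eta>n \<longlonglongrightarrow> \<eta> \<and> converges_in_prob euclidean M Cn (mean_hessian l B P \<beta>s) \<longrightarrow>
        converges_in_prob fell_topology M
          (\<lambda>n \<omega>. conjugate_sublevel (empirical_form p l B n (\<lambda>i. X i \<omega>) \<beta>s) (Cn n \<omega>) (\<eta>n n))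
          (conjugate_sublevel (limit_form p l B P \<beta>s) (mean_hessian l B P \<beta>s) \<eta>))"
proof -
  interpret prob_space M by (rule prob)
  interpret iid_sample M X P
    by unfold_locales (rule indep law)+
  interpret P: prob_space P by (rule prob_space_P)
  interpret robust_erm M X P B l p q \<beta>s c \<beta>ERM \<eta>
    by unfold_locales
      (rule exponents smooth optimality bounds second_moment cost ERM \<eta> sets_P | assumption)+
  \<comment> \<open>The limit is a fixed closed set, so the limiting law is the point mass
    there.\<close>
  have weak: "converges_weakly fell_topology M confidence_region
      (return (borel_sets_of fell_topology) limit_set)"
  proof (rule converges_weakly_return)
    show "limit_set \<in> topspace fell_topology"
      by (simp add: topspace_fell_topology closed_conjugate_sublevel)
    show "confidence_region n \<omega> \<in> topspace fell_topology" for n \<omega>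
      by (simp add: topspace_fell_topology closed_confidence_region)
    show "whp M (\<lambda>n \<omega>. confidence_region n \<omega> \<in> U)" if "openin fell_topology U" "limit_set \<in> U" for U
      by (rule whp_fell_open[OF closed_confidence_region confidence_region_miss confidence_region_hit that])
  qed
  have in_prob: "converges_in_prob fell_topology M
      (\<lambda>n \<omega>. conjugate_sublevel (empirical_form p l B n (\<lambda>i. X i \<omega>) \<beta>s) (Cn n \<omega>) (\<eta>n n)) limit_set"
    if \<eta>n: "\<eta>n \<longlonglongrightarrow> \<eta>" and Cn: "converges_in_prob euclidean M Cn (mean_hessian l B P \<beta>s)" for \<eta>n Cn
  proof -
    \<comment> \<open>Convergence in probability of the matrices is tested on open balls around the
      mean Hessian.\<close>
    have near: "whp M (\<lambda>n \<omega>. norm (Cn n \<omega> - mean_hessian l B P \<beta>s) < e)" if "0 < e" for e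
      using converges_in_prob_whp[OF Cn, of "ball (mean_hessian l B P \<beta>s) e"] that
      by (simp add: dist_norm norm_minus_commute)
    show ?thesis
      by (intro converges_in_prob_fellI closed_conjugate_sublevel
          empirical_conjugate_sublevel_miss empirical_conjugate_sublevel_hit near)
        (rule \<eta>n \<eta> | assumption)+
  qed
  show ?thesis
    by (intro conjI allI impI weak[unfolded confidence_region_def [abs_def]] in_prob; elim conjE; assumption)
qed

end
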